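(* Let $r,k\in\mathbb Z$ with $0\le k\le r$. Suppose Assumptions (A1), (A2), (A4) hold and that Assumption (A5a) or (A5b) is satisfied. Let $u$ be the (sufficiently smooth) solution of the initial value problem and $U$ the solution of the method (M). Then there exist $\tau_0>0$ and a constant $C$ independent of the mesh (depending in general exponentially on the product $T\mathfrak C_2$) such that, whenever $\tau\le\tau_0$, for $1\le n\le N$ and $l\in\{0,1\}$, $$\sup_{t\in I_n}\|(u-U)^{(l)}(t)\|\le C\max_{1\le\nu\le n}\Big(\sup_{t\in I_\nu}\|(u-\mathcal I^{\rm app}_\nu u)(t)\|+\sum_{j=0}^{l}\sup_{t\in I_\nu}\|(u-\mathcal J_\nu u)^{(j)}(t)\|\Big)+C\max_{1\le\nu\le n-1}\tau_\nu^{-1}\|(u-\mathcal J_\nu u)(t_\nu^-)\|.$$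
   Context: Problem: $u'(t)=f(t,u(t))$, $u(t_0)=u_0\in\mathbb R^d$, on $I=(t_0,t_0+T]$, $f$ smooth. Mesh $t_0<\dots<t_N=t_0+T$, $I_n=(t_{n-1},t_n]$, $\tau_n=t_n-t_{n-1}\le1$, $\tau=\max_n\tau_n$; $v(t_n^\pm)$ one-sided limits, $[v]_n=v(t_n^+)-v(t_n^-)$. $T_n(\hat t)=\frac{t_n+t_{n-1}}{2}+\frac{\tau_n}{2}\hat t$. $\|\cdot\|$, $(\cdot,\cdot)$ Euclidean norm/inner product; $P_s$ polynomials of degree $\le s$; $\delta_{i,j}$ Kronecker symbol. Operators: $\widehat{\mathscr I}$ linear functional, $\widehat{\mathcal I}$ linear operator; $k_{\mathscr I},k_{\mathcal I}\ge0$ smallest integers with $\widehat{\mathscr I}$ well defined on $C^{k_{\mathscr I}}([-1,1])$, $\widehat{\mathcal I}$ on $C^{k_{\mathcal I}}([-1,1])$; $\widehat{\mathcal I}\hat v\in C^l$ whenever $\hat v\in C^{\max\{k_{\mathcal I},l\}}$. Local: $\mathscr I_n[\varphi]=\frac{\tau_n}{2}\widehat{\mathscr I}[\varphi\circ T_n]$, $\mathcal I_n\psi=(\widehat{\mathcal I}(\psi\circ T_n))\circ T_n^{-1}$, componentwise. $k_{\mathcal J}:=\max\{\lfloor k/2\rfloor-1,k_{\mathscr I},k_{\mathcal I}\}$. Method (M): given $U(t_{n-1}^-)$ ($U(t_0^-)=u_0$), find $U\in P_r(I_n,\mathbb R^d)$ with: if $k\ge1$, $U(t_{n-1}^+)=U(t_{n-1}^-)$;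 if $k\ge2$, $U^{(i+1)}(t_n^-)=\frac{d^i}{dt^i}f(t,U(t))|_{t_n^-}$, $i=0,\dots,\lfloor k/2\rfloor-1$; if $k\ge3$, $U^{(i+1)}(t_{n-1}^+)=\frac{d^i}{dt^i}f(t,U(t))|_{t_{n-1}^+}$, $i=0,\dots,\lfloor (k-1)/2\rfloor-1$; and $\mathscr I_n[(U',\varphi)]+\delta_{0,k}([U]_{n-1},\varphi(t_{n-1}^+))=\mathscr I_n[(\mathcal I_nf(\cdot,U(\cdot)),\varphi)]$ for all $\varphi\in P_{r-k}(I_n,\mathbb R^d)$. $\mathcal J_nv\in P_r(I_n,\mathbb R^d)$: if $k\ge1$, $(\mathcal J_nv)^{(i)}(t_{n-1}^+)=v^{(i)}(t_{n-1}^+)$, $i=0,\dots,\lfloor (k-1)/2\rfloor$; if $k\ge2$, $(\mathcal J_nv)^{(i)}(t_n^-)=v^{(i)}(t_n^-)$, $i=1,\dots,\lfloor k/2\rfloor$; $\mathscr I_n[((\mathcal J_nv)',\varphi)]+\delta_{0,k}(\mathcal J_nv(t_{n-1}^+),\varphi(t_{n-1}^+))=\mathscr I_n[(\mathcal I_n(v'),\varphi)]+\delta_{0,k}(v(t_{n-1}^+),\varphi(t_{n-1}^+))$ for all $\varphi\in P_{r-k}(I_n,\mathbb R^d)$. (A1): if $\hat\psi\in P_{r-\max\{1,k\}}([-1,1])$ and $\widehat{\mathscr I}[(1-\hat t)^{\lfloor k/2\rfloor}(1+\hat t)^{|\lfloor (k-1)/2\rfloor|}\hat\psi\hat\varphi]=0$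 for all $\hat\varphi\in P_{r-\max\{1,k\}}([-1,1])$, then $\hat\psi\equiv0$. (A2): $\|\widehat{\mathscr I}[\hat\varphi]\|\le\mathfrak C_0\sum_{j=0}^{k_{\mathscr I}}\sup_{[-1,1]}\|\hat\varphi^{(j)}\|$ for all $\hat\varphi\in C^{k_{\mathscr I}}([-1,1],\mathbb R^d)$. (A4): for $0\le i\le k_{\mathcal J}$ and all $v,w$ sufficiently smooth on each mesh interval, $\|\frac{d^i}{dt^i}(f(t,v(t))-f(t,w(t)))|_{t=s}\|\le\mathfrak C_2\sum_{l=0}^i\|(v-w)^{(l)}(s)\|$ for a.e. $s\in[t_0,t_0+T]$. (A5a): for all $n$ and $0\le l\le k_{\mathscr I}$, $\mathcal I_n\varphi\in C^l(\overline I_n,\mathbb R^d)$, and there are distinct points $\hat t^{\mathcal I}_m\in[-1,1]$, $m=0,\dots,K^{\mathcal I}$, and integers $\widetilde K^{\mathcal I}_m\ge0$ with $(\frac{\tau_n}{2})^l\sup_{I_n}\|(\mathcal I_n\varphi)^{(l)}\|\le\mathfrak C_{1,1}\sum_{m=0}^{K^{\mathcal I}}\sum_{j=0}^{\widetilde K^{\mathcal I}_m}(\frac{\tau_n}{2})^j\|\varphi^{(j)}(t^{\mathcal I}_{n,m})\|+\mathfrak C_{1,2}\sup_{I_n}\|\varphi\|$ for all $\varphi\in C^{k_{\mathcal I}}(\overline I_n,\mathbb R^d)$, where $t^{\mathcal I}_{n,m}=T_n(\hat t^{\mathcal I}_m)$. (A5b): there are distinct points $\hat t^{\mathscr I}_m\in[-1,1]$,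 $m=0,\dots,K^{\mathscr I}$, integers $\widetilde K^{\mathscr I}_m\ge0$, with $t^{\mathscr I}_{n,m}=T_n(\hat t^{\mathscr I}_m)$, such that $\|\mathscr I_n[\varphi]\|\le\widetilde{\mathfrak C}_{0,1}\frac{\tau_n}{2}\sum_{m=0}^{K^{\mathscr I}}\sum_{j=0}^{\widetilde K^{\mathscr I}_m}(\frac{\tau_n}{2})^j\|\varphi^{(j)}(t^{\mathscr I}_{n,m})\|+\widetilde{\mathfrak C}_{0,2}\frac{\tau_n}{2}\sup_{I_n}\|\varphi\|$ for all $\varphi\in C^{k_{\mathscr I}}(\overline I_n,\mathbb R^d)$; and there are distinct points $\hat t^{\mathcal I}_m\in[-1,1]$, $m=0,\dots,K^{\mathcal I}$, integers $\widetilde K^{\mathcal I}_m\ge0$, $t^{\mathcal I}_{n,m}=T_n(\hat t^{\mathcal I}_m)$, such that $\sum_{m=0}^{K^{\mathscr I}}\sum_{l=0}^{\widetilde K^{\mathscr I}_m}(\frac{\tau_n}{2})^l\|(\mathcal I_n\varphi)^{(l)}(t^{\mathscr I}_{n,m})\|+\sup_{I_n}\|\mathcal I_n\varphi\|\le\widetilde{\mathfrak C}_{1,1}\sum_{m=0}^{K^{\mathcal I}}\sum_{j=0}^{\widetilde K^{\mathcal I}_m}(\frac{\tau_n}{2})^j\|\varphi^{(j)}(t^{\mathcal I}_{n,m})\|+\widetilde{\mathfrak C}_{1,2}\sup_{I_n}\|\varphi\|$ for all $\varphi\in C^{\max\{k_{\mathscr I},k_{\mathcal I}\}}(\overline I_n,\mathbb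 R^d)$. All constants $\mathfrak C$ are independent of $n$ and $\tau_n$. Auxiliary interpolant $\mathcal I^{\rm app}_n$ (componentwise Hermite interpolation on $I_n$): it satisfies $(\mathcal I^{\rm app}_n\varphi)^{(l)}(t_n^-)=\varphi^{(l)}(t_n^-)$ for $0\le l\le\lfloor k/2\rfloor-1$, $(\mathcal I^{\rm app}_n\varphi)^{(l)}(t_{n-1}^+)=\varphi^{(l)}(t_{n-1}^+)$ for $0\le l\le\lfloor (k-1)/2\rfloor-1$, and $(\mathcal I^{\rm app}_n\varphi)^{(l)}(t^{\mathcal I}_{n,m})=\varphi^{(l)}(t^{\mathcal I}_{n,m})$ for $0\le m\le K^{\mathcal I}$, $0\le l\le\widetilde K^{\mathcal I}_m$ (points from (A5a) or (A5b)); if these give $r^{\rm app}<r+1$ independent conditions, $r+1-r^{\rm app}$ further conditions $(\mathcal I^{\rm app}_n\varphi)(t^{\mathcal I}_{n,m})=\varphi(t^{\mathcal I}_{n,m})$ at new distinct points $\hat t^{\mathcal I}_m\in(-1,1)$ are added; $\mathcal I^{\rm app}_n\varphi$ is the resulting polynomial of degree $\max\{r^{\rm app}-1,r\}$. *)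

theory Defs
  imports "HOL-Analysis.Analysis"
begin

text \<open>j-th derivative of a function of one real variable, taken within the set S
 (on a closed interval this gives one-sided derivatives at the endpoints).\<close>
fun hderiv :: "real set \<Rightarrow> nat \<Rightarrow> (real \<Rightarrow> 'a::real_normed_vector) \<Rightarrow> real \<Rightarrow> 'a" where
  "hderiv S 0 g = g"
| "hderiv S (Suc j) g = (\<lambda>x. vector_derivative (hderiv S j g) (at x within S))"

definition Ck_on :: "real set \<Rightarrow> nat \<Rightarrow> (real \<Rightarrow> 'a::real_normed_vector) \<Rightarrow> bool" where
  "Ck_on S k g \<longleftrightarrow>
     (\<forall>j\<le>k. continuous_on S (hderiv S j g)) \<and>
     (\<forall>j<k. \<forall>x\<in>S. (hderiv S j g has_vector_derivative hderiv S (Suc j) g x) (at x within S))"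

definition Cinf_on :: "real set \<Rightarrow> (real \<Rightarrow> 'a::real_normed_vector) \<Rightarrow> bool" where
  "Cinf_on S g \<longleftrightarrow> (\<forall>k. Ck_on S k g)"

fun dird :: "'a list \<Rightarrow> ('a::real_normed_vector \<Rightarrow> 'b::real_normed_vector) \<Rightarrow> 'a \<Rightarrow> 'b" where
  "dird [] F = F"
| "dird (h # hs) F = (\<lambda>x. frechet_derivative (dird hs F) (at x) h)"

definition smooth_map :: "('a::real_normed_vector \<Rightarrow> 'b::real_normed_vector) \<Rightarrow> bool" where
  "smooth_map F \<longleftrightarrow> (\<forall>hs x. dird hs F differentiable (at x))"

text \<open>Real polynomials of degree at most m (for m < 0 only the zero polynomial).\<close>
definition Pdeg :: "int \<Rightarrow> (real \<Rightarrow> real) set" where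
  "Pdeg m = {p. \<exists>c::nat \<Rightarrow> real. \<forall>t. p t = (\<Sum>i<nat (m + 1). c i * t ^ i)}"

definition VPdeg :: "int \<Rightarrow> (real \<Rightarrow> real ^ 'd) set" where
  "VPdeg m = {p. \<exists>c::nat \<Rightarrow> real ^ 'd. \<forall>t. p t = (\<Sum>i<nat (m + 1). t ^ i *\<^sub>R c i)}"

definition Tmap :: "real \<Rightarrow> real \<Rightarrow> real \<Rightarrow> real" where
  "Tmap a b x = (a + b) / 2 + (b - a) / 2 * x"

definition Tinv :: "real \<Rightarrow> real \<Rightarrow> real \<Rightarrow> real" where
  "Tinv a b t = (2 * t - (a + b)) / (b - a)"

definition vecF :: "((real \<Rightarrow> real) \<Rightarrow> real) \<Rightarrow> (real \<Rightarrow> real ^ 'd) \<Rightarrow> real ^ 'd" where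
  "vecF Ih \<phi> = (\<chi> i. Ih (\<lambda>t. \<phi> t $ i))"

definition locF :: "((real \<Rightarrow> real) \<Rightarrow> real) \<Rightarrow> real \<Rightarrow> real \<Rightarrow> (real \<Rightarrow> real) \<Rightarrow> real" where
  "locF Ih a b \<phi> = (b - a) / 2 * Ih (\<phi> \<circ> Tmap a b)"

definition locFv :: "((real \<Rightarrow> real) \<Rightarrow> real) \<Rightarrow> real \<Rightarrow> real \<Rightarrow> (real \<Rightarrow> real ^ 'd) \<Rightarrow> real ^ 'd" where
  "locFv Ih a b \<phi> = (\<chi> i. locF Ih a b (\<lambda>t. \<phi> t $ i))"

definition locOp :: "((real \<Rightarrow> real) \<Rightarrow> (real \<Rightarrow> real)) \<Rightarrow> real \<Rightarrow> real \<Rightarrow> (real \<Rightarrow> real ^ 'd) \<Rightarrow> real \<Rightarrow> real ^ 'd" where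
  "locOp Ic a b \<psi> = (\<lambda>t. \<chi> i. Ic (\<lambda>x. \<psi> (Tmap a b x) $ i) (Tinv a b t))"

definition supn :: "real set \<Rightarrow> (real \<Rightarrow> 'a::real_normed_vector) \<Rightarrow> real" where
  "supn S g = Sup ((\<lambda>t. norm (g t)) ` S)"

definition maxz :: "nat set \<Rightarrow> (nat \<Rightarrow> real) \<Rightarrow> real" where
  "maxz A g = (if A = {} then 0 else Max (g ` A))"

definition functional_ok :: "((real \<Rightarrow> real) \<Rightarrow> real) \<Rightarrow> nat \<Rightarrow> bool" where
  "functional_ok Ih kI \<longleftrightarrow>
     (\<forall>f g (\<alpha>::real) (\<beta>::real). Ck_on {-1..1} kI f \<longrightarrow> Ck_on {-1..1} kI g \<longrightarrow>
        Ih (\<lambda>t. \<alpha> * f t + \<beta> * g t) = \<alpha> * Ih f + \<beta> * Ih g) \<and>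
     (\<forall>f g. Ck_on {-1..1} kI f \<longrightarrow> Ck_on {-1..1} kI g \<longrightarrow> (\<forall>t\<in>{-1..1}. f t = g t) \<longrightarrow> Ih f = Ih g)"

definition operator_ok :: "((real \<Rightarrow> real) \<Rightarrow> (real \<Rightarrow> real)) \<Rightarrow> nat \<Rightarrow> bool" where
  "operator_ok Ic kc \<longleftrightarrow>
     (\<forall>f g (\<alpha>::real) (\<beta>::real). Ck_on {-1..1} kc f \<longrightarrow> Ck_on {-1..1} kc g \<longrightarrow>
        (\<forall>t\<in>{-1..1}. Ic (\<lambda>s. \<alpha> * f s + \<beta> * g s) t = \<alpha> * Ic f t + \<beta> * Ic g t)) \<and>
     (\<forall>f g. Ck_on {-1..1} kc f \<longrightarrow> Ck_on {-1..1} kc g \<longrightarrow> (\<forall>t\<in>{-1..1}. f t = g t) \<longrightarrow>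
        (\<forall>t\<in>{-1..1}. Ic f t = Ic g t)) \<and>
     (\<forall>l v. Ck_on {-1..1} (max kc l) v \<longrightarrow> Ck_on {-1..1} l (Ic v))"

text \<open>U n is the polynomial on the n-th interval [tm (n-1), tm n]; values of U n at the
  endpoints give the one-sided limits U(t_{n-1}^+), U(t_n^-).\<close>
definition method_M ::
  "nat \<Rightarrow> nat \<Rightarrow> ((real \<Rightarrow> real) \<Rightarrow> real) \<Rightarrow> ((real \<Rightarrow> real) \<Rightarrow> (real \<Rightarrow> real)) \<Rightarrow>
   (real \<Rightarrow> real ^ 'd \<Rightarrow> real ^ 'd) \<Rightarrow> real ^ 'd \<Rightarrow> (nat \<Rightarrow> real) \<Rightarrow> nat \<Rightarrow>
   (nat \<Rightarrow> real \<Rightarrow> real ^ 'd) \<Rightarrow> bool" where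
  "method_M r k Ih Ic f u0 tm N U \<longleftrightarrow>
    (\<forall>n\<in>{1..N}.
      let a = tm (n - 1); b = tm n; S = {a..b};
          Uprev = (if n = 1 then u0 else U (n - 1) a) in
      U n \<in> VPdeg (int r) \<and>
      (1 \<le> k \<longrightarrow> U n a = Uprev) \<and>
      (2 \<le> k \<longrightarrow> (\<forall>i < k div 2.
          hderiv S (Suc i) (U n) b = hderiv S i (\<lambda>t. f t (U n t)) b)) \<and>
      (3 \<le> k \<longrightarrow> (\<forall>i < (k - 1) div 2.
          hderiv S (Suc i) (U n) a = hderiv S i (\<lambda>t. f t (U n t)) a)) \<and>
      (\<forall>\<phi> \<in> VPdeg (int r - int k).
          locF Ih a b (\<lambda>t. inner (hderiv S 1 (U n) t) (\<phi> t))
            + (if k = 0 then inner (U n a - Uprev) (\<phi> a) else 0)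
          = locF Ih a b (\<lambda>t. inner (locOp Ic a b (\<lambda>s. f s (U n s)) t) (\<phi> t))))"

definition isJ ::
  "nat \<Rightarrow> nat \<Rightarrow> ((real \<Rightarrow> real) \<Rightarrow> real) \<Rightarrow> ((real \<Rightarrow> real) \<Rightarrow> (real \<Rightarrow> real)) \<Rightarrow>
   real \<Rightarrow> real \<Rightarrow> (real \<Rightarrow> real ^ 'd) \<Rightarrow> (real \<Rightarrow> real ^ 'd) \<Rightarrow> bool" where
  "isJ r k Ih Ic a b v p \<longleftrightarrow>
    (let S = {a..b} in
      p \<in> VPdeg (int r) \<and>
      (1 \<le> k \<longrightarrow> (\<forall>i \<le> (k - 1) div 2. hderiv S i p a = hderiv S i v a)) \<and>
      (2 \<le> k \<longrightarrow> (\<forall>i \<in> {1..k div 2}. hderiv S i p b = hderiv S i v b)) \<and>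
      (\<forall>\<phi> \<in> VPdeg (int r - int k).
          locF Ih a b (\<lambda>t. inner (hderiv S 1 p t) (\<phi> t))
            + (if k = 0 then inner (p a) (\<phi> a) else 0)
          = locF Ih a b (\<lambda>t. inner (locOp Ic a b (hderiv S 1 v) t) (\<phi> t))
            + (if k = 0 then inner (v a) (\<phi> a) else 0)))"

definition Jop ::
  "nat \<Rightarrow> nat \<Rightarrow> ((real \<Rightarrow> real) \<Rightarrow> real) \<Rightarrow> ((real \<Rightarrow> real) \<Rightarrow> (real \<Rightarrow> real)) \<Rightarrow>
   real \<Rightarrow> real \<Rightarrow> (real \<Rightarrow> real ^ 'd) \<Rightarrow> (real \<Rightarrow> real ^ 'd)" where
  "Jop r k Ih Ic a b v = (THE p. isJ r k Ih Ic a b v p)"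

text \<open>Hermite data of I^app on the reference interval: pairs (point, derivative order).\<close>
definition Dapp :: "nat \<Rightarrow> (nat \<Rightarrow> real) \<Rightarrow> nat \<Rightarrow> (nat \<Rightarrow> nat) \<Rightarrow> (real \<times> nat) set" where
  "Dapp k tI KI KtI =
     {(1, l) | l. l < k div 2} \<union> {(-1, l) | l. l < (k - 1) div 2} \<union>
     {(tI m, l) | m l. m \<le> KI \<and> l \<le> KtI m}"

definition rapp :: "nat \<Rightarrow> (nat \<Rightarrow> real) \<Rightarrow> nat \<Rightarrow> (nat \<Rightarrow> nat) \<Rightarrow> nat" where
  "rapp k tI KI KtI = card (Dapp k tI KI KtI)"

definition Dext :: "nat \<Rightarrow> nat \<Rightarrow> (nat \<Rightarrow> real) \<Rightarrow> nat \<Rightarrow> (nat \<Rightarrow> nat) \<Rightarrow> (nat \<Rightarrow> real) \<Rightarrow> (real \<times> nat) set" where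
  "Dext r k tI KI KtI sx = {(sx j, 0) | j. j < r + 1 - rapp k tI KI KtI}"

definition Iapp ::
  "nat \<Rightarrow> nat \<Rightarrow> (nat \<Rightarrow> real) \<Rightarrow> nat \<Rightarrow> (nat \<Rightarrow> nat) \<Rightarrow> (nat \<Rightarrow> real) \<Rightarrow>
   real \<Rightarrow> real \<Rightarrow> (real \<Rightarrow> real ^ 'd) \<Rightarrow> (real \<Rightarrow> real ^ 'd)" where
  "Iapp r k tI KI KtI sx a b \<phi> =
    (THE p. p \<in> VPdeg (max (int (rapp k tI KI KtI) - 1) (int r)) \<and>
       (\<forall>(x, l) \<in> Dapp k tI KI KtI \<union> Dext r k tI KI KtI sx.
          hderiv {a..b} l p (Tmap a b x) = hderiv {a..b} l \<phi> (Tmap a b x)))"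

definition A1 :: "nat \<Rightarrow> nat \<Rightarrow> ((real \<Rightarrow> real) \<Rightarrow> real) \<Rightarrow> bool" where
  "A1 r k Ih \<longleftrightarrow>
    (\<forall>\<psi> \<in> Pdeg (int r - int (max 1 k)).
      (\<forall>\<phi> \<in> Pdeg (int r - int (max 1 k)).
         Ih (\<lambda>t. (1 - t) ^ (k div 2) * (1 + t) ^ nat \<bar>(int k - 1) div 2\<bar> * \<psi> t * \<phi> t) = 0)
      \<longrightarrow> (\<forall>t. \<psi> t = 0))"

definition A2 :: "((real \<Rightarrow> real) \<Rightarrow> real) \<Rightarrow> nat \<Rightarrow> 'd::finite itself \<Rightarrow> bool" where
  "A2 Ih kI (_::'d itself) \<longleftrightarrow>
    (\<exists>C0. \<forall>\<phi> :: real \<Rightarrow> real ^ 'd. Ck_on {-1..1} kI \<phi> \<longrightarrow>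
       norm (vecF Ih \<phi>) \<le> C0 * (\<Sum>j\<le>kI. supn {-1..1} (hderiv {-1..1} j \<phi>)))"

text \<open>(A4), for every subinterval [a,b] of [t0,t0+T] (any such interval can be a mesh
 interval), with one-sided derivatives at the endpoints.\<close>
definition A4 :: "(real \<Rightarrow> real ^ 'd \<Rightarrow> real ^ 'd) \<Rightarrow> real \<Rightarrow> real \<Rightarrow> nat \<Rightarrow> real \<Rightarrow> bool" where
  "A4 f t0 T kJ C2 \<longleftrightarrow>
    (\<forall>a b (v :: real \<Rightarrow> real ^ 'd) w s i. t0 \<le> a \<longrightarrow> a < b \<longrightarrow> b \<le> t0 + T \<longrightarrow>
       Cinf_on {a..b} v \<longrightarrow> Cinf_on {a..b} w \<longrightarrow> s \<in> {a..b} \<longrightarrow> i \<le> kJ \<longrightarrow>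
       norm (hderiv {a..b} i (\<lambda>t. f t (v t) - f t (w t)) s)
         \<le> C2 * (\<Sum>l\<le>i. norm (hderiv {a..b} l (\<lambda>t. v t - w t) s)))"

definition admissible_interval :: "real \<Rightarrow> real \<Rightarrow> real \<Rightarrow> real \<Rightarrow> bool" where
  "admissible_interval t0 T a b \<longleftrightarrow> t0 \<le> a \<and> a < b \<and> b \<le> t0 + T \<and> b - a \<le> 1"

definition pt_terms :: "real \<Rightarrow> real \<Rightarrow> (nat \<Rightarrow> real) \<Rightarrow> nat \<Rightarrow> (nat \<Rightarrow> nat) \<Rightarrow> (real \<Rightarrow> real ^ 'd) \<Rightarrow> real" where
  "pt_terms a b tp K Kt \<phi> =
     (\<Sum>m\<le>K. \<Sum>j\<le>Kt m. ((b - a) / 2) ^ j * norm (hderiv {a..b} j \<phi> (Tmap a b (tp m))))"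

definition distinct_pts :: "(nat \<Rightarrow> real) \<Rightarrow> nat \<Rightarrow> bool" where
  "distinct_pts tp K \<longleftrightarrow> inj_on tp {..K} \<and> tp ` {..K} \<subseteq> {-1..1}"

definition A5a ::
  "((real \<Rightarrow> real) \<Rightarrow> (real \<Rightarrow> real)) \<Rightarrow> nat \<Rightarrow> nat \<Rightarrow> real \<Rightarrow> real \<Rightarrow>
   (nat \<Rightarrow> real) \<Rightarrow> nat \<Rightarrow> (nat \<Rightarrow> nat) \<Rightarrow> 'd::finite itself \<Rightarrow> bool" where
  "A5a Ic kI kc t0 T tI KI KtI (_::'d itself) \<longleftrightarrow>
    distinct_pts tI KI \<and>
    (\<exists>C11 C12. \<forall>a b. admissible_interval t0 T a b \<longrightarrow>
      (\<forall>\<phi> :: real \<Rightarrow> real ^ 'd. Ck_on {a..b} kc \<phi> \<longrightarrow> (\<forall>l\<le>kI.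
         Ck_on {a..b} l (locOp Ic a b \<phi>) \<and>
         ((b - a) / 2) ^ l * supn {a<..b} (hderiv {a..b} l (locOp Ic a b \<phi>))
           \<le> C11 * pt_terms a b tI KI KtI \<phi> + C12 * supn {a<..b} \<phi>)))"

definition A5b ::
  "((real \<Rightarrow> real) \<Rightarrow> real) \<Rightarrow> ((real \<Rightarrow> real) \<Rightarrow> (real \<Rightarrow> real)) \<Rightarrow> nat \<Rightarrow> nat \<Rightarrow> real \<Rightarrow> real \<Rightarrow>
   (nat \<Rightarrow> real) \<Rightarrow> nat \<Rightarrow> (nat \<Rightarrow> nat) \<Rightarrow> 'd::finite itself \<Rightarrow> bool" where
  "A5b Ih Ic kI kc t0 T tI KI KtI (_::'d itself) \<longleftrightarrow>
    distinct_pts tI KI \<and>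
    (\<exists>tS KS KtS C01 C02 C11 C12. distinct_pts tS KS \<and>
      (\<forall>a b. admissible_interval t0 T a b \<longrightarrow>
        (\<forall>\<phi> :: real \<Rightarrow> real ^ 'd. Ck_on {a..b} kI \<phi> \<longrightarrow>
           norm (locFv Ih a b \<phi>)
             \<le> C01 * ((b - a) / 2) * pt_terms a b tS KS KtS \<phi>
               + C02 * ((b - a) / 2) * supn {a<..b} \<phi>) \<and>
        (\<forall>\<phi> :: real \<Rightarrow> real ^ 'd. Ck_on {a..b} (max kI kc) \<phi> \<longrightarrow>
           pt_terms a b tS KS KtS (locOp Ic a b \<phi>) + supn {a<..b} (locOp Ic a b \<phi>)
             \<le> C11 * pt_terms a b tI KI KtI \<phi> + C12 * supn {a<..b} \<phi>)))"

definition mesh :: "real \<Rightarrow> real \<Rightarrow> real \<Rightarrow> (nat \<Rightarrow> real) \<Rightarrow> nat \<Rightarrow> bool" where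
  "mesh t0 T \<tau>0 tm N \<longleftrightarrow> 1 \<le> N \<and> tm 0 = t0 \<and> tm N = t0 + T \<and>
     (\<forall>n\<in>{1..N}. tm (n - 1) < tm n \<and> tm n - tm (n - 1) \<le> 1 \<and> tm n - tm (n - 1) \<le> \<tau>0)"

end

theory Submission
  imports Defs
begin

text \<open>On one interval write \<open>J\<close> for the projection of \<open>u\<close> and \<open>c\<close> for the value of the numerical solution
  \<open>V\<close> from the left. The data that define the polynomial \<open>V - J + (u(a) - c)\<close> (end point
  derivatives, moments of its derivative) only involve \<open>f(V) - f(u)\<close>. By (A1) these data are unisolvent, so after scaling to \<open>[-1,1]\<close> the polynomial
  is bounded by the data. By (A2), (A4), (A5) the data are at most the step size times scaled derivatives of
  \<open>u - V\<close> at the Hermite nodes of the auxiliary interpolant \<open>I\<close>. There \<open>u\<close> may be replaced by \<open>I u\<close>, and an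
  inverse inequality on polynomials bounds everything by \<open>h (sup |u - V| + sup |u - I u|)\<close>. A discrete
  Gronwall argument finishes the proof.

  The orders of the point derivatives in (A5) may exceed those controlled by (A4). Since (A5) is assumed for
  all functions of finite smoothness only, it can be tested with functions perturbed by a small multiple of
  an antiderivative of a nowhere differentiable function. All derivatives of too high order then take one
  fixed junk value, which disappears after scaling; hence these terms can be dropped from (A5).\<close>

text \<open>The constant \<open>u a - c\<close> is added because only then do all data carry a
  factor h, the step size: it removes the one contribution without it, the value from the left for k
  \<ge> 1 or the jump term for k = 0. This factor lets the error of V be absorbed for small steps
  and gives the growth factor 1 + O(h) per interval. Differentiating in t costs it again, so the
  case l = 1 is a local consequence of the case l = 0.

  The detour through I u is forced because derivatives of u - V are not controlled by its supremum.
  The difference V - I u is a polynomial of a degree that does not depend on the mesh.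

  End point defects of J are transported without a factor h. Each is written as h times a quotient,
  and summing the step sizes gives at most T; this produces the term with 1/\<tau>. The defect of
  the last interval is transported nowhere, so the second maximum stops at n - 1.

  All step constants come from finitely many functionals on [-1,1]. The resulting constant L of one
  step is built as a multiple of |C2|, whence the dependence exp(2 L T).\<close>

section \<open>Iterated one-sided derivatives and smoothness classes\<close>

lemma hderiv_cong:
  assumes "\<And>x. x \<in> S \<Longrightarrow> g x = g' x" "x \<in> S"
  shows "hderiv S j g x = hderiv S j g' x"
  using assms(2)
proof (induction j arbitrary: x)
  case (Suc j)
  \<comment> \<open>The predicates agree for every \<open>d\<close>, so the choice hidden in
    \<open>vector_derivative\<close> agrees as well, even where no derivative exists. The junk
    values used later rely on this.\<close>
  have "(hderiv S j g has_vector_derivative d) (at x within S) \<longleftrightarrow>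
        (hderiv S j g' has_vector_derivative d) (at x within S)" for d
    using Suc has_vector_derivative_transform[of x S "hderiv S j g" "hderiv S j g'" d]
      has_vector_derivative_transform[of x S "hderiv S j g'" "hderiv S j g" d] by auto
  then show ?case by (simp add: vector_derivative_def)
qed (use assms in simp)

text \<open>A guessed chain of derivatives is the right one because derivatives within a
  nondegenerate closed interval are unique. All formulas for iterated derivatives below are obtained
  by naming such a chain \<open>G\<close>.\<close>

lemma hderiv_eq_sequence:
  fixes g :: "real \<Rightarrow> 'a::real_normed_vector"
  assumes ab: "a < b"
    and G0: "\<And>x. x \<in> {a..b} \<Longrightarrow> g x = G 0 x"
    and GS: "\<And>j x. j < k \<Longrightarrow> x \<in> {a..b} \<Longrightarrow>
               (G j has_vector_derivative G (Suc j) x) (at x within {a..b})"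
    and "j \<le> k" "x \<in> {a..b}"
  shows "hderiv {a..b} j g x = G j x"
  using assms(4,5)
proof (induction j arbitrary: x)
  case (Suc j)
  have "(hderiv {a..b} j g has_vector_derivative G (Suc j) x) (at x within {a..b})"
    by (rule has_vector_derivative_transform[OF _ _ GS]) (use Suc in auto)
  then show ?case
    using vector_derivative_within_cbox[OF ab] Suc.prems(2) by simp
qed (use G0 in simp)

lemma Ck_on_sequence:
  fixes g :: "real \<Rightarrow> 'a::real_normed_vector"
  assumes ab: "a < b"
    and G0: "\<And>x. x \<in> {a..b} \<Longrightarrow> g x = G 0 x"
    and GS: "\<And>j x. j < k \<Longrightarrow> x \<in> {a..b} \<Longrightarrow>
               (G j has_vector_derivative G (Suc j) x) (at x within {a..b})"
    and cont: "continuous_on {a..b} (G k)"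
  shows "Ck_on {a..b} k g"
proof -
  have eq: "hderiv {a..b} j g x = G j x" if "j \<le> k" "x \<in> {a..b}" for j x
    using hderiv_eq_sequence[OF ab G0 GS that] .
  have D: "(hderiv {a..b} j g has_vector_derivative hderiv {a..b} (Suc j) g x) (at x within {a..b})"
    if "j < k" "x \<in> {a..b}" for j x
  proof -
    have "(hderiv {a..b} j g has_vector_derivative G (Suc j) x) (at x within {a..b})"
      by (rule has_vector_derivative_transform[OF _ _ GS]) (use that eq in auto)
    then show ?thesis using eq[of "Suc j" x] that by simp
  qed
  have "continuous_on {a..b} (hderiv {a..b} j g)" if "j \<le> k" for j
  proof (cases "j = k")
    case True
    then show ?thesis using cont eq by (subst continuous_on_cong[OF refl, of _ _ "G k"]) auto
  next
    case False
    then show ?thesis using D[of j] that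
      unfolding continuous_on_eq_continuous_within
      using has_vector_derivative_continuous by (metis le_neq_implies_less)
  qed
  then show ?thesis using D by (auto simp: Ck_on_def)
qed

lemma Ck_onD:
  assumes "Ck_on S k g"
  shows "j < k \<Longrightarrow> x \<in> S \<Longrightarrow>
      (hderiv S j g has_vector_derivative hderiv S (Suc j) g x) (at x within S)"
    and Ck_on_continuous: "j \<le> k \<Longrightarrow> continuous_on S (hderiv S j g)"
  using assms by (auto simp: Ck_on_def)

lemma Ck_on_mono: "Ck_on S k g \<Longrightarrow> j \<le> k \<Longrightarrow> Ck_on S j g"
  by (auto simp: Ck_on_def)

lemma Cinf_on_imp_Ck_on: "Cinf_on S g \<Longrightarrow> Ck_on S k g"
  by (simp add: Cinf_on_def)

lemma Ck_on_Suc: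
  assumes ab: "a < b"
    and D: "\<And>x. x \<in> {a..b} \<Longrightarrow> (g has_vector_derivative g' x) (at x within {a..b})"
    and g': "Ck_on {a..b} k g'"
  shows "Ck_on {a..b} (Suc k) g"
    and "j \<le> k \<Longrightarrow> x \<in> {a..b} \<Longrightarrow> hderiv {a..b} (Suc j) g x = hderiv {a..b} j g' x"
proof -
  let ?G = "\<lambda>j. case j of 0 \<Rightarrow> g | Suc i \<Rightarrow> hderiv {a..b} i g'"
  have GS: "(?G j has_vector_derivative ?G (Suc j) x) (at x within {a..b})"
    if "j < Suc k" "x \<in> {a..b}" for j x
    using that D Ck_onD[OF g'] by (auto split: nat.split)
  show "Ck_on {a..b} (Suc k) g"
    by (rule Ck_on_sequence[where G = ?G, OF ab _ GS]) (use Ck_onD[OF g'] in auto)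
  show "hderiv {a..b} (Suc j) g x = hderiv {a..b} j g' x" if "j \<le> k" "x \<in> {a..b}"
    using hderiv_eq_sequence[where G = ?G and g = g, OF ab _ GS, of "Suc k" "Suc j" x] that by auto
qed

lemma Ck_on_hderiv_1:
  assumes "a < b" "Ck_on {a..b} (Suc k) g"
  shows "Ck_on {a..b} k (hderiv {a..b} 1 g)"
  by (rule Ck_on_sequence[where G = "\<lambda>j. hderiv {a..b} (Suc j) g", OF assms(1)])
    (use Ck_onD[OF assms(2)] in \<open>auto simp del: hderiv.simps(2)\<close>)

lemma Cinf_on_hderiv_1: "a < b \<Longrightarrow> Cinf_on {a..b} g \<Longrightarrow> Cinf_on {a..b} (hderiv {a..b} 1 g)"
  unfolding Cinf_on_def using Ck_on_hderiv_1 by blast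

lemma
  assumes "a < b" "Ck_on {a..b} k f" "Ck_on {a..b} k g"
  shows Ck_on_add: "Ck_on {a..b} k (\<lambda>t. f t + g t)"
    and hderiv_add: "j \<le> k \<Longrightarrow> x \<in> {a..b} \<Longrightarrow>
      hderiv {a..b} j (\<lambda>t. f t + g t) x = hderiv {a..b} j f x + hderiv {a..b} j g x"
proof -
  let ?G = "\<lambda>j x. hderiv {a..b} j f x + hderiv {a..b} j g x"
  have GS: "(?G j has_vector_derivative ?G (Suc j) x) (at x within {a..b})"
    if "j < k" "x \<in> {a..b}" for j x
    using Ck_onD[OF assms(2)] Ck_onD[OF assms(3)] that
    by (intro has_vector_derivative_add) auto
  show "Ck_on {a..b} k (\<lambda>t. f t + g t)"
    by (rule Ck_on_sequence[where G = ?G, OF assms(1) _ GS])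
      (use Ck_onD[OF assms(2)] Ck_onD[OF assms(3)] in \<open>auto intro!: continuous_on_add\<close>)
  show "hderiv {a..b} j (\<lambda>t. f t + g t) x = ?G j x" if "j \<le> k" "x \<in> {a..b}"
    by (rule hderiv_eq_sequence[where G = ?G, OF assms(1) _ GS that]) auto
qed

lemma
  assumes "bounded_linear L" "a < b" "Ck_on {a..b} k f"
  shows Ck_on_bounded_linear: "Ck_on {a..b} k (\<lambda>t. L (f t))"
    and hderiv_bounded_linear: "j \<le> k \<Longrightarrow> x \<in> {a..b} \<Longrightarrow>
      hderiv {a..b} j (\<lambda>t. L (f t)) x = L (hderiv {a..b} j f x)"
proof -
  let ?G = "\<lambda>j x. L (hderiv {a..b} j f x)"
  have GS: "(?G j has_vector_derivative ?G (Suc j) x) (at x within {a..b})"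
    if "j < k" "x \<in> {a..b}" for j x
    using Ck_onD[OF assms(3)] that
    by (intro bounded_linear.has_vector_derivative[OF assms(1)]) auto
  show "Ck_on {a..b} k (\<lambda>t. L (f t))"
    by (rule Ck_on_sequence[where G = ?G, OF assms(2) _ GS])
      (use Ck_onD[OF assms(3)] in \<open>auto intro!: bounded_linear.continuous_on[OF assms(1)]\<close>)
  show "hderiv {a..b} j (\<lambda>t. L (f t)) x = ?G j x" if "j \<le> k" "x \<in> {a..b}"
    by (rule hderiv_eq_sequence[where G = ?G, OF assms(2) _ GS that]) auto
qed

lemmas Ck_on_scale = Ck_on_bounded_linear[OF bounded_linear_scaleR_right]
lemmas hderiv_scale = hderiv_bounded_linear[OF bounded_linear_scaleR_right]

lemma
  assumes "a < b" "Ck_on {a..b} k f" "Ck_on {a..b} k g"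
  shows Ck_on_diff: "Ck_on {a..b} k (\<lambda>t. f t - g t)"
    and hderiv_diff: "j \<le> k \<Longrightarrow> x \<in> {a..b} \<Longrightarrow>
      hderiv {a..b} j (\<lambda>t. f t - g t) x = hderiv {a..b} j f x - hderiv {a..b} j g x"
proof -
  have m: "Ck_on {a..b} k (\<lambda>t. - g t)"
    by (rule Ck_on_bounded_linear[OF bounded_linear_minus[OF bounded_linear_ident] assms(1,3)])
  show "Ck_on {a..b} k (\<lambda>t. f t - g t)"
    using Ck_on_add[OF assms(1,2) m] by simp
  show "hderiv {a..b} j (\<lambda>t. f t - g t) x = hderiv {a..b} j f x - hderiv {a..b} j g x"
    if "j \<le> k" "x \<in> {a..b}"
    using hderiv_add[OF assms(1,2) m that]
      hderiv_bounded_linear[OF bounded_linear_minus[OF bounded_linear_ident] assms(1,3) that]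
    by simp
qed

lemma Ck_on_const: "a < b \<Longrightarrow> Ck_on {a..b} k (\<lambda>t. c)"
  by (rule Ck_on_sequence[where G = "\<lambda>j t. if j = 0 then c else 0"]) auto

lemma Ck_on_sum:
  assumes "a < b" "\<And>i. i \<in> I \<Longrightarrow> Ck_on {a..b} k (f i)"
  shows "Ck_on {a..b} k (\<lambda>t. \<Sum>i\<in>I. f i t)"
  using assms(2)
  by (induction I rule: infinite_finite_induct)
    (auto intro: Ck_on_const[OF assms(1)] Ck_on_add[OF assms(1)])

text \<open>Only membership in the class is claimed, so induction on k with the product rule
  suffices and the general Leibniz formula is avoided.\<close>

lemma Ck_on_scaleR:
  fixes g :: "real \<Rightarrow> 'a::real_normed_vector"
  assumes "a < b" "Ck_on {a..b} k p" "Ck_on {a..b} k g"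
  shows "Ck_on {a..b} k (\<lambda>t. p t *\<^sub>R g t)"
  using assms(2,3)
proof (induction k arbitrary: p g)
  case 0
  then show ?case by (auto simp: Ck_on_def intro!: continuous_on_scaleR)
next
  case (Suc k)
  let ?p' = "hderiv {a..b} 1 p" and ?g' = "hderiv {a..b} 1 g"
  show ?case
  proof (rule Ck_on_Suc(1)[OF assms(1), where g' = "\<lambda>t. p t *\<^sub>R ?g' t + ?p' t *\<^sub>R g t"])
    fix x assume "x \<in> {a..b}"
    then show "((\<lambda>t. p t *\<^sub>R g t) has_vector_derivative p x *\<^sub>R ?g' x + ?p' x *\<^sub>R g x)
        (at x within {a..b})"
      using Ck_onD(1)[OF Suc.prems(1), of 0 x] Ck_onD(1)[OF Suc.prems(2), of 0 x]
      by (auto intro!: has_vector_derivative_scaleR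
          simp: has_real_derivative_iff_has_vector_derivative)
  next
    show "Ck_on {a..b} k (\<lambda>t. p t *\<^sub>R ?g' t + ?p' t *\<^sub>R g t)"
      using Suc.prems by (intro Ck_on_add[OF assms(1)] Suc.IH)
        (auto intro: Ck_on_mono Ck_on_hderiv_1[OF assms(1)] simp del: hderiv.simps One_nat_def)
  qed
qed

lemma Ck_on_subinterval:
  assumes "c < d" "{c..d} \<subseteq> {a..b}" "Ck_on {a..b} k g"
  shows "Ck_on {c..d} k g"
proof -
  let ?G = "\<lambda>j. hderiv {a..b} j g"
  have GS: "(?G j has_vector_derivative ?G (Suc j) x) (at x within {c..d})"
    if "j < k" "x \<in> {c..d}" for j x
    using has_vector_derivative_within_subset[OF Ck_onD(1)[OF assms(3)] assms(2)] that assms(2) by blast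
  show "Ck_on {c..d} k g"
    by (rule Ck_on_sequence[where G = ?G, OF assms(1) _ GS])
      (use Ck_onD(2)[OF assms(3)] assms(2) in \<open>auto intro: continuous_on_subset[of "{a..b}"]\<close>)
qed

lemma Cinf_on_subinterval: "c < d \<Longrightarrow> {c..d} \<subseteq> {a..b} \<Longrightarrow> Cinf_on {a..b} g \<Longrightarrow> Cinf_on {c..d} g"
  unfolding Cinf_on_def using Ck_on_subinterval by blast

lemma Ck_on_continuous_on: "Ck_on S k g \<Longrightarrow> continuous_on S g"
  using Ck_on_continuous[of S k g 0] by simp

subsection \<open>Affine change of variables\<close>

lemma Tmap_in: "a < b \<Longrightarrow> x \<in> {-1..1} \<Longrightarrow> Tmap a b x \<in> {a..b}"
proof -
  assume ab: "a < b" and x: "x \<in> {-1..1}"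
  then have "(b - a) * (1 + x) \<ge> 0" "(b - a) * (1 - x) \<ge> 0" by auto
  then show ?thesis by (simp add: Tmap_def field_simps)
qed

lemma Tinv_in: "a < b \<Longrightarrow> t \<in> {a..b} \<Longrightarrow> Tinv a b t \<in> {-1..1}"
  by (simp add: Tinv_def field_simps)

lemma Tinv_Tmap [simp]: "a < b \<Longrightarrow> Tinv a b (Tmap a b x) = x"
  by (simp add: Tmap_def Tinv_def field_simps)

lemma Tmap_Tinv [simp]: "a < b \<Longrightarrow> Tmap a b (Tinv a b t) = t"
  by (simp add: Tmap_def Tinv_def field_simps)

lemma Tmap_1 [simp]: "Tmap a b 1 = b" and Tmap_m1 [simp]: "Tmap a b (-1) = a"
  by (simp_all add: Tmap_def field_simps)

lemma
  fixes g :: "real \<Rightarrow> 'a::real_normed_vector"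
  assumes "c < d" "Ck_on {a..b} k g" "\<And>x. x \<in> {c..d} \<Longrightarrow> m * x + q \<in> {a..b}"
  shows Ck_on_affine: "Ck_on {c..d} k (\<lambda>x. g (m * x + q))"
    and hderiv_affine: "j \<le> k \<Longrightarrow> x \<in> {c..d} \<Longrightarrow>
      hderiv {c..d} j (\<lambda>x. g (m * x + q)) x = m ^ j *\<^sub>R hderiv {a..b} j g (m * x + q)"
proof -
  let ?G = "\<lambda>j x. m ^ j *\<^sub>R hderiv {a..b} j g (m * x + q)"
  have GS: "(?G j has_vector_derivative ?G (Suc j) x) (at x within {c..d})"
    if "j < k" "x \<in> {c..d}" for j x
  proof -
    have 1: "((\<lambda>x. m * x + q) has_vector_derivative m) (at x within {c..d})"
      unfolding has_real_derivative_iff_has_vector_derivative[symmetric]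
      by (auto intro!: derivative_eq_intros)
    have "(hderiv {a..b} j g has_vector_derivative hderiv {a..b} (Suc j) g (m * x + q))
        (at (m * x + q) within (\<lambda>x. m * x + q) ` {c..d})"
      using assms(3) that
      by (intro has_vector_derivative_within_subset[OF Ck_onD(1)[OF assms(2)]]) auto
    from vector_diff_chain_within[OF 1 this]
    have "((\<lambda>x. hderiv {a..b} j g (m * x + q)) has_vector_derivative
        m *\<^sub>R hderiv {a..b} (Suc j) g (m * x + q)) (at x within {c..d})"
      by (simp add: o_def)
    from bounded_linear.has_vector_derivative[OF bounded_linear_scaleR_right this, of "m ^ j"]
    show ?thesis by (simp add: mult.commute)
  qed
  show "Ck_on {c..d} k (\<lambda>x. g (m * x + q))"
    by (rule Ck_on_sequence[where G = ?G, OF assms(1) _ GS])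
      (use assms(3) in \<open>auto intro!: continuous_intros continuous_on_compose2[OF Ck_onD(2)[OF assms(2)]]\<close>)
  show "hderiv {c..d} j (\<lambda>x. g (m * x + q)) x = ?G j x" if "j \<le> k" "x \<in> {c..d}"
    by (rule hderiv_eq_sequence[where G = ?G, OF assms(1) _ GS that]) auto
qed

lemma Tmap_affine: "Tmap a b = (\<lambda>x. (b - a) / 2 * x + (a + b) / 2)"
  by (simp add: Tmap_def fun_eq_iff)

lemma Tinv_affine: "Tinv a b = (\<lambda>t. 2 / (b - a) * t + (- ((a + b) / (b - a))))"
  by (rule ext) (simp add: Tinv_def diff_divide_distrib[of _ "a + b"] del: minus_add_distrib)

lemma Ck_on_Tmap:
  assumes "a < b" "Ck_on {a..b} k g"
  shows "Ck_on {-1..1} k (\<lambda>x. g (Tmap a b x))"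
  using Tmap_in[OF assms(1)] unfolding Tmap_affine
  by (intro Ck_on_affine[OF _ assms(2)]) auto

lemma hderiv_Tmap:
  assumes "a < b" "Ck_on {a..b} k g" "j \<le> k" "x \<in> {-1..1}"
  shows "hderiv {-1..1} j (\<lambda>x. g (Tmap a b x)) x = ((b - a) / 2) ^ j *\<^sub>R hderiv {a..b} j g (Tmap a b x)"
  using Tmap_in[OF assms(1)] unfolding Tmap_affine
  by (intro hderiv_affine[OF _ assms(2) _ assms(3,4)]) auto

lemma Ck_on_Tinv:
  assumes "a < b" "Ck_on {-1..1} k g"
  shows "Ck_on {a..b} k (\<lambda>t. g (Tinv a b t))"
  using Ck_on_affine[OF assms(1,2)] Tinv_in[OF assms(1)] unfolding Tinv_affine by blast

subsection \<open>Composition with smooth maps\<close>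

text \<open>Turns \<open>f t (v t)\<close> into a map on the product space composed with a curve, so
  that smoothness of the uncurried f applies.\<close>

lemma Ck_on_pair:
  fixes v :: "real \<Rightarrow> 'a::real_normed_vector"
  assumes "a < b" "Ck_on {a..b} k v"
  shows "Ck_on {a..b} k (\<lambda>t. (t, v t))"
proof -
  let ?G = "\<lambda>j t. (if j = 0 then t else if j = 1 then 1 else 0, hderiv {a..b} j v t)"
  have "continuous_on {a..b} (\<lambda>t. if k = 0 then t else if k = 1 then 1 else (0::real))"
    by (cases "k = 0"; cases "k = 1") auto
  then have "continuous_on {a..b} (\<lambda>t. (if k = 0 then t else if k = 1 then 1 else 0, hderiv {a..b} k v t))"
    using Ck_onD(2)[OF assms(2), of k] by (rule continuous_on_Pair) simp
  moreover
  have "((\<lambda>t. if j = 0 then t else if j = 1 then 1 else (0::real)) has_vector_derivative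
      (if Suc j = 0 then x else if Suc j = 1 then 1 else 0)) (at x within {a..b})" for j x
    by (cases "j = 0") (auto intro: has_vector_derivative_id)
  ultimately show ?thesis
    using Ck_onD[OF assms(2)]
    by (intro Ck_on_sequence[OF assms(1), where G = ?G] has_vector_derivative_Pair)
      (auto simp del: hderiv.simps(2))
qed

text \<open>The list \<open>hs\<close> is kept general so that the induction closes: one derivative
  of \<open>dird hs F\<close> along the curve is a combination of the \<open>dird (e # hs) F\<close>
  with coefficients from the derivative of the curve.\<close>

lemma Ck_on_smooth_map:
  fixes F :: "'a::euclidean_space \<Rightarrow> 'b::real_normed_vector"
  assumes "a < b" "smooth_map F" "Ck_on {a..b} k w"
  shows "Ck_on {a..b} k (\<lambda>t. dird hs F (w t))"
  using assms(3)
proof (induction k arbitrary: hs)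
  case 0
  have "isCont (dird hs F) x" for x
    using assms(2) differentiable_imp_continuous_within[of _ x UNIV] by (auto simp: smooth_map_def)
  then have "continuous_on UNIV (dird hs F)" by (simp add: continuous_at_imp_continuous_on)
  then have "continuous_on {a..b} (\<lambda>t. dird hs F (w t))"
    using Ck_onD(2)[OF 0, of 0] by (auto intro: continuous_on_compose2)
  then show ?case by (simp add: Ck_on_def)
next
  case (Suc k)
  let ?w' = "hderiv {a..b} 1 w"
  show ?case
  proof (rule Ck_on_Suc(1)[OF assms(1), where g' = "\<lambda>t. \<Sum>e\<in>Basis. (?w' t \<bullet> e) *\<^sub>R dird (e # hs) F (w t)"])
    fix x assume x: "x \<in> {a..b}"
    let ?D = "frechet_derivative (dird hs F) (at (w x))"
    have D: "(dird hs F has_derivative ?D) (at (w x))"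
      using assms(2) by (auto simp: smooth_map_def frechet_derivative_works)
    then have lin: "linear ?D" by (rule has_derivative_linear)
    have "(w has_vector_derivative ?w' x) (at x within {a..b})"
      using Ck_onD(1)[OF Suc.prems, of 0 x] x by simp
    from vector_derivative_diff_chain_within[OF this has_derivative_at_withinI[OF D]]
    have "((\<lambda>t. dird hs F (w t)) has_vector_derivative ?D (?w' x)) (at x within {a..b})"
      by (simp add: o_def)
    \<comment> \<open>\<open>dird\<close> differentiates in fixed directions only, whereas the
      velocity of the curve varies; it is therefore expanded in the basis.\<close>
    moreover have "?D (?w' x) = ?D (\<Sum>e\<in>Basis. (?w' x \<bullet> e) *\<^sub>R e)"
      by (simp only: euclidean_representation)
    ultimately show "((\<lambda>t. dird hs F (w t)) has_vector_derivative
        (\<Sum>e\<in>Basis. (?w' x \<bullet> e) *\<^sub>R dird (e # hs) F (w x))) (at x within {a..b})"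
      by (simp add: linear_sum[OF lin] linear_cmul[OF lin])
  next
    show "Ck_on {a..b} k (\<lambda>t. \<Sum>e\<in>Basis. (?w' t \<bullet> e) *\<^sub>R dird (e # hs) F (w t))"
      using Suc.prems
      by (intro Ck_on_sum[OF assms(1)] Ck_on_scaleR[OF assms(1)] Suc.IH
          Ck_on_bounded_linear[OF bounded_linear_inner_left assms(1)])
        (auto intro: Ck_on_mono Ck_on_hderiv_1[OF assms(1)] simp del: hderiv.simps dird.simps One_nat_def)
  qed
qed

lemma Cinf_on_smooth_map:
  fixes v :: "real \<Rightarrow> 'a::euclidean_space"
  assumes "a < b" "smooth_map (\<lambda>(t, x). f t x)" "Cinf_on {a..b} v"
  shows "Cinf_on {a..b} (\<lambda>t. f t (v t))"
  unfolding Cinf_on_def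
proof
  fix k
  show "Ck_on {a..b} k (\<lambda>t. f t (v t))"
    using Ck_on_smooth_map[OF assms(1,2) Ck_on_pair[OF assms(1)], of k v "[]"] assms(3)
    by (simp add: Cinf_on_def)
qed

subsection \<open>Suprema\<close>

lemma supn_bdd:
  fixes a b :: real
  assumes "a < b" "continuous_on {a..b} g"
  shows "bdd_above ((\<lambda>t. norm (g t)) ` {a..b})"
  using assms compact_interval[of a b]
  by (intro bounded_imp_bdd_above compact_imp_bounded compact_continuous_image continuous_intros) auto

text \<open>The suprema of the estimate run over half-open intervals, yet values at the left end
  point are needed too; continuity and density supply them.\<close>

lemma norm_le_supn:
  assumes "a < b" "continuous_on {a..b} g" "t \<in> {a..b}"
  shows "norm (g t) \<le> supn {a<..b} g"
proof -
  have "bdd_above ((\<lambda>t. norm (g t)) ` {a<..b})"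
    by (rule bdd_above_mono[OF supn_bdd[OF assms(1,2)]]) auto
  then have 1: "norm (g s) \<le> supn {a<..b} g" if "s \<in> {a<..b}" for s
    unfolding supn_def using that by (intro cSup_upper) auto
  have "closure {a<..b} = {a..b}"
    using assms(1) by simp
  then show ?thesis
    using continuous_on_closure_norm_le[of "{a<..b}" g "supn {a<..b} g" t] 1 assms by auto
qed

lemma supn_nonneg:
  assumes "a < b" "continuous_on {a..b} g"
  shows "0 \<le> supn {a<..b} g"
  using norm_le_supn[OF assms, of b] assms(1) by (meson atLeastAtMost_iff less_eq_real_def norm_ge_zero order_trans)

lemma
  assumes "a < b" "\<And>t. t \<in> {a..b} \<Longrightarrow> norm (g t) \<le> B"
  shows supn_le_Ioc: "supn {a<..b} g \<le> B" and supn_le_Icc: "supn {a..b} g \<le> B"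
  unfolding supn_def using assms by (auto intro!: cSup_least)

lemma norm_le_supn_Icc:
  assumes "a < b" "continuous_on {a..b} g" "t \<in> {a..b}"
  shows "norm (g t) \<le> supn {a..b} g"
  unfolding supn_def using supn_bdd[OF assms(1,2)] assms(3) by (intro cSup_upper) auto

subsection \<open>Polynomials\<close>

text \<open>Vector polynomials as families of scalar ones, which gives access to
  \<open>degree\<close>, \<open>pderiv\<close> and \<open>order\<close> in each component.\<close>

definition vpoly :: "('d::finite \<Rightarrow> real poly) \<Rightarrow> real \<Rightarrow> real ^ 'd" where
  "vpoly P t = (\<chi> s. poly (P s) t)"

lemma vpoly_nth [simp]: "vpoly P t $ s = poly (P s) t"
  by (simp add: vpoly_def)

lemma poly_eq_sum_lessThan:
  fixes P :: "real poly"
  assumes "\<forall>i\<ge>n. coeff P i = 0"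
  shows "poly P t = (\<Sum>i<n. coeff P i * t ^ i)"
proof -
  have "poly P t = (\<Sum>i\<le>degree P. coeff P i * t ^ i)" by (rule poly_altdef)
  also have "\<dots> = (\<Sum>i<n. coeff P i * t ^ i)"
  proof (rule sum.mono_neutral_cong)
    show "coeff P i * t ^ i = 0" if "i \<in> {..degree P} - {..<n}" for i using that assms by auto
    show "coeff P i * t ^ i = 0" if "i \<in> {..<n} - {..degree P}" for i
      using that by (auto simp: coeff_eq_0)
  qed auto
  finally show ?thesis .
qed

text \<open>Stated through vanishing coefficients because for negative m only the zero polynomial
  remains, which no bound on \<open>degree\<close> can express.\<close>

lemma Pdeg_iff: "p \<in> Pdeg m \<longleftrightarrow> (\<exists>P. (\<forall>i\<ge>nat (m + 1). coeff P i = 0) \<and> p = poly P)"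
proof
  assume "p \<in> Pdeg m"
  then obtain c where c: "\<And>t. p t = (\<Sum>i<nat (m + 1). c i * t ^ i)" by (auto simp: Pdeg_def)
  let ?P = "\<Sum>i<nat (m + 1). monom (c i) i"
  have "p = poly ?P" by (auto simp: c fun_eq_iff poly_sum poly_monom)
  moreover have "\<forall>i\<ge>nat (m + 1). coeff ?P i = 0" by (simp add: coeff_sum)
  ultimately show "\<exists>P. (\<forall>i\<ge>nat (m + 1). coeff P i = 0) \<and> p = poly P" by blast
qed (auto simp: Pdeg_def poly_eq_sum_lessThan)

lemma coeff_zero_iff_degree_le: "(\<forall>i\<ge>Suc n. coeff P i = 0) \<longleftrightarrow> degree P \<le> n"
  by (auto intro: degree_le coeff_eq_0)

lemma VPdeg_iff:
  "p \<in> VPdeg (int r) \<longleftrightarrow> (\<exists>P. (\<forall>s. degree (P s) \<le> r) \<and> p = vpoly P)"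
proof
  assume "p \<in> VPdeg (int r)"
  then obtain c where c: "\<And>t. p t = (\<Sum>i<nat (int r + 1). t ^ i *\<^sub>R c i)" by (auto simp: VPdeg_def)
  let ?P = "\<lambda>s. \<Sum>i<Suc r. monom (c i $ s) i"
  have "nat (int r + 1) = Suc r" by simp
  then have "p = vpoly ?P"
    by (auto simp: c fun_eq_iff poly_sum poly_monom vec_eq_iff mult.commute
        simp del: sum.lessThan_Suc)
  moreover have "degree (?P s) \<le> r" for s
    unfolding coeff_zero_iff_degree_le[symmetric] by (simp add: coeff_sum del: sum.lessThan_Suc)
  ultimately show "\<exists>P. (\<forall>s. degree (P s) \<le> r) \<and> p = vpoly P" by (intro exI[of _ ?P]) blast
next
  assume "\<exists>P. (\<forall>s. degree (P s) \<le> r) \<and> p = vpoly P"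
  then obtain P where P: "\<And>s. degree (P s) \<le> r" "p = vpoly P" by blast
  have "p t = (\<Sum>i<nat (int r + 1). t ^ i *\<^sub>R (\<chi> s. coeff (P s) i))" for t
  proof -
    have "poly (P s) t = (\<Sum>i<nat (int r + 1). coeff (P s) i * t ^ i)" for s
      using P(1)[of s] by (intro poly_eq_sum_lessThan) (auto intro!: coeff_eq_0)
    then show ?thesis by (simp add: P(2) vec_eq_iff mult.commute)
  qed
  then show "p \<in> VPdeg (int r)"
    unfolding VPdeg_def by (intro CollectI exI[of _ "\<lambda>i. \<chi> s. coeff (P s) i"]) blast
qed

lemma has_vector_derivative_poly:
  "(poly P has_vector_derivative poly (pderiv P) x) (at x within S)"
  unfolding has_real_derivative_iff_has_vector_derivative[symmetric]
  by (rule has_field_derivative_at_within[OF poly_DERIV])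

lemma has_vector_derivative_vec_nth:
  fixes f :: "real \<Rightarrow> real ^ 'd"
  assumes "\<And>s. ((\<lambda>t. f t $ s) has_vector_derivative f' $ s) F"
  shows "(f has_vector_derivative f') F"
proof -
  have "((\<lambda>t. \<Sum>s\<in>UNIV. (f t $ s) *\<^sub>R (axis s 1 :: real ^ 'd)) has_vector_derivative
      (\<Sum>s\<in>UNIV. (f' $ s) *\<^sub>R axis s 1)) F"
    by (intro has_vector_derivative_sum
        bounded_linear.has_vector_derivative[OF bounded_linear_scaleR_left] assms)
  moreover have "(\<Sum>s\<in>UNIV. (v $ s) *\<^sub>R axis s 1) = v" for v :: "real ^ 'd"
    using basis_expansion[of v] by (simp add: scalar_mult_eq_scaleR)
  ultimately show ?thesis by (simp only:)
qed

lemma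
  assumes "a < b"
  shows Cinf_on_vpoly: "Cinf_on {a..b} (vpoly P)"
    and hderiv_vpoly: "x \<in> {a..b} \<Longrightarrow> hderiv {a..b} j (vpoly P) x = vpoly (\<lambda>s. (pderiv ^^ j) (P s)) x"
proof -
  let ?G = "\<lambda>j. vpoly (\<lambda>s. (pderiv ^^ j) (P s))"
  have GS: "(?G j has_vector_derivative ?G (Suc j) x) (at x within {a..b})" for j x
    using has_vector_derivative_poly
    by (intro has_vector_derivative_vec_nth) simp
  have "continuous_on {a..b} (?G j)" for j
    unfolding vpoly_def by (intro continuous_intros)
  then show "Cinf_on {a..b} (vpoly P)"
    unfolding Cinf_on_def using Ck_on_sequence[where G = ?G, OF assms _ GS] by simp
  show "hderiv {a..b} j (vpoly P) x = ?G j x" if "x \<in> {a..b}"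
    using hderiv_eq_sequence[where G = ?G, OF assms _ GS _ that, of "vpoly P" j j] by simp
qed

lemma Cinf_on_poly:
  assumes "a < b"
  shows "Cinf_on {a..b} (poly P)"
proof -
  let ?G = "\<lambda>j. poly ((pderiv ^^ j) P)"
  have GS: "(?G j has_vector_derivative ?G (Suc j) x) (at x within {a..b})" for j x
    using has_vector_derivative_poly by simp
  show "Cinf_on {a..b} (poly P)"
    unfolding Cinf_on_def using Ck_on_sequence[where G = ?G, OF assms _ GS]
    by (simp add: continuous_on_poly)
qed

lemma vpoly_affine:
  assumes "\<And>s. degree (P s) \<le> r"
  obtains R where "\<And>s. degree (R s) \<le> r" "\<And>x. vpoly R x = vpoly P (m * x + q)"
proof
  show "degree (pcompose (P s) [:q, m:]) \<le> r" for s
    using assms[of s] by (simp add: degree_pcompose)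
  show "vpoly (\<lambda>s. pcompose (P s) [:q, m:]) x = vpoly P (m * x + q)" for x
    by (simp add: vec_eq_iff poly_pcompose algebra_simps)
qed

subsection \<open>Unisolvent families of functionals\<close>

text \<open>Gaussian elimination: one equation with a nonzero entry is solved for one unknown, and
  both are removed.\<close>

lemma underdetermined_system:
  fixes M :: "'j \<Rightarrow> 'i \<Rightarrow> real"
  assumes "finite J" "finite I" "card J < card I"
  shows "\<exists>c. (\<exists>i\<in>I. c i \<noteq> 0) \<and> (\<forall>j\<in>J. (\<Sum>i\<in>I. c i * M j i) = 0)"
  using assms
proof (induction J arbitrary: I M)
  case empty
  then have "I \<noteq> {}" by auto
  then show ?case by (intro exI[of _ "\<lambda>_. 1"]) auto
next
  case (insert k J)
  show ?case
  proof (cases "\<forall>i\<in>I. M k i = 0")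
    case True
    with insert.IH[OF insert.prems(1), of M] insert show ?thesis by auto
  next
    case False
    then obtain p where p: "p \<in> I" "M k p \<noteq> 0" by blast
    \<comment> \<open>The matrix after eliminating the unknown \<open>p\<close> by means of equation
      \<open>k\<close>.\<close>
    let ?N = "\<lambda>j i. M j i - M k i / M k p * M j p"
    have "card J < card (I - {p})"
      using insert.prems insert.hyps p(1) by simp
    from insert.IH[OF _ this, of ?N] insert.prems(1) obtain c where
      c: "\<exists>i\<in>I - {p}. c i \<noteq> 0" "\<forall>j\<in>J. (\<Sum>i\<in>I - {p}. c i * ?N j i) = 0" by blast
    \<comment> \<open>Back substitution: this value of the unknown \<open>p\<close> makes equation
      \<open>k\<close> hold.\<close>
    let ?cp = "- (\<Sum>i\<in>I - {p}. c i * M k i) / M k p"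
    let ?c = "c(p := ?cp)"
    have split: "(\<Sum>i\<in>I. ?c i * M j i) = (\<Sum>i\<in>I - {p}. c i * M j i) + ?cp * M j p" for j
      using insert.prems(1) p(1) by (subst sum.remove[of I p]) auto
    have "(\<Sum>i\<in>I. ?c i * M j i) = (\<Sum>i\<in>I - {p}. c i * ?N j i)" for j
      unfolding split
      by (simp add: right_diff_distrib sum_subtractf sum_distrib_right sum_divide_distrib mult.assoc)
    moreover have "(\<Sum>i\<in>I. ?c i * M k i) = 0"
      unfolding split using p(2) by simp
    ultimately have "\<forall>j\<in>insert k J. (\<Sum>i\<in>I. ?c i * M j i) = 0"
      using c(2) by simp
    moreover have "\<exists>i\<in>I. ?c i \<noteq> 0" using c(1) by auto
    ultimately show ?thesis by blast
  qed
qed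

text \<open>As many functionals as the space of polynomials of degree at most n has dimensions, and
  jointly injective there: on that space they form a basis of the dual.\<close>

locale unisolvent =
  fixes J :: "'j set" and n :: nat and \<Lambda> :: "'j \<Rightarrow> real poly \<Rightarrow> real"
  assumes finite_J: "finite J" and card_J: "card J = Suc n"
    and add: "j \<in> J \<Longrightarrow> \<Lambda> j (P + R) = \<Lambda> j P + \<Lambda> j R"
    and smult: "j \<in> J \<Longrightarrow> \<Lambda> j (smult c P) = c * \<Lambda> j P"
    and inj: "degree P \<le> n \<Longrightarrow> (\<And>j. j \<in> J \<Longrightarrow> \<Lambda> j P = 0) \<Longrightarrow> P = 0"
begin

lemma zero: "j \<in> J \<Longrightarrow> \<Lambda> j 0 = 0"
  using smult[of j 0 0] by simp

lemma sum_smult: "j \<in> J \<Longrightarrow> \<Lambda> j (\<Sum>i\<in>I. smult (c i) (P i)) = (\<Sum>i\<in>I. c i * \<Lambda> j (P i))"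
  by (induction I rule: infinite_finite_induct) (simp_all add: zero add smult)

lemma diff: "j \<in> J \<Longrightarrow> \<Lambda> j (P - R) = \<Lambda> j P - \<Lambda> j R"
  using add[of j P "smult (-1) R"] smult[of j "-1" R] by simp

text \<open>Dropping one functional leaves n equations for n + 1 coefficients, hence a nonzero
  solution. Injectivity forbids the dropped functional to vanish on it, so it can be
  normalised.\<close>

lemma ex_dual_element:
  assumes "j \<in> J"
  shows "\<exists>Q. degree Q \<le> n \<and> (\<forall>i\<in>J. \<Lambda> i Q = (if i = j then 1 else 0))"
proof -
  have "card (J - {j}) < card {..n}" using assms finite_J card_J by simp
  from underdetermined_system[OF _ _ this, of "\<lambda>i l. \<Lambda> i (monom 1 l)"] finite_J
  obtain c where c: "\<exists>l\<in>{..n}. c l \<noteq> 0" "\<forall>i\<in>J - {j}. (\<Sum>l\<le>n. c l * \<Lambda> i (monom 1 l)) = 0" by auto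
  let ?P = "\<Sum>l\<le>n. smult (c l) (monom 1 l)"
  have coeff: "coeff ?P l = (if l \<le> n then c l else 0)" for l
    by (simp add: coeff_sum if_distrib cong: if_cong)
  have deg: "degree ?P \<le> n" by (intro degree_le) (simp add: coeff)
  have "?P \<noteq> 0" using c(1) coeff by (metis atMost_iff coeff_0)
  moreover have z: "\<Lambda> i ?P = 0" if "i \<in> J - {j}" for i
    using c(2) that by (simp only: sum_smult DiffD1)
  ultimately have nz: "\<Lambda> j ?P \<noteq> 0" using inj[OF deg] by (metis DiffI singletonD)
  show ?thesis
    using deg z nz assms smult
    by (intro exI[of _ "smult (1 / \<Lambda> j ?P) ?P"]) (auto intro: order_trans[OF degree_smult_le])
qed

definition dual :: "'j \<Rightarrow> real poly" where
  "dual j = (SOME Q. degree Q \<le> n \<and> (\<forall>i\<in>J. \<Lambda> i Q = (if i = j then 1 else 0)))"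

lemma degree_dual: "j \<in> J \<Longrightarrow> degree (dual j) \<le> n"
  and functional_dual: "j \<in> J \<Longrightarrow> i \<in> J \<Longrightarrow> \<Lambda> i (dual j) = (if i = j then 1 else 0)"
  unfolding dual_def using someI_ex[OF ex_dual_element[of j]] by auto

lemma degree_combination: "degree (\<Sum>j\<in>J. smult (y j) (dual j)) \<le> n"
  by (intro degree_sum_le finite_J) (auto intro: order_trans[OF degree_smult_le] degree_dual)

lemma functional_combination: "i \<in> J \<Longrightarrow> \<Lambda> i (\<Sum>j\<in>J. smult (y j) (dual j)) = y i"
  using finite_J by (simp add: sum_smult functional_dual if_distrib cong: if_cong)

lemma expansion:
  assumes "degree P \<le> n"
  shows "P = (\<Sum>j\<in>J. smult (\<Lambda> j P) (dual j))"
proof -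
  have "P - (\<Sum>j\<in>J. smult (\<Lambda> j P) (dual j)) = 0"
  proof (rule inj)
    show "degree (P - (\<Sum>j\<in>J. smult (\<Lambda> j P) (dual j))) \<le> n"
      by (intro degree_diff_le assms degree_combination)
  qed (simp add: diff functional_combination)
  then show ?thesis by simp
qed

lemma ex_vpoly:
  fixes y :: "'j \<Rightarrow> real ^ 'd"
  shows "\<exists>P. (\<forall>s. degree (P s) \<le> n) \<and> (\<forall>j\<in>J. \<forall>s. \<Lambda> j (P s) = y j $ s)"
  by (intro exI[of _ "\<lambda>s. \<Sum>j\<in>J. smult (y j $ s) (dual j)"])
    (simp add: degree_combination functional_combination)

text \<open>Expansion in the dual basis; K adds up bounds for the i-th derivatives of the dual
  polynomials. It depends on the functionals and on i only, which is the source of all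
  mesh-independent constants.\<close>

lemma vpoly_bound:
  "\<exists>K\<ge>0. \<forall>P :: 'd::finite \<Rightarrow> real poly. (\<forall>s. degree (P s) \<le> n) \<longrightarrow>
     (\<forall>x\<in>{-1..1}. norm (vpoly (\<lambda>s. (pderiv ^^ i) (P s)) x) \<le> K * (\<Sum>j\<in>J. norm (\<chi> s. \<Lambda> j (P s))))"
proof -
  let ?q = "\<lambda>j. poly ((pderiv ^^ i) (dual j))"
  have "\<exists>B. \<forall>x\<in>{-1..1}. \<bar>?q j x\<bar> \<le> B" for j
  proof -
    have "bounded (?q j ` {-1..1})"
      by (intro compact_imp_bounded compact_continuous_image continuous_intros) simp_all
    then show ?thesis by (auto simp: bounded_iff)
  qed
  then obtain B where B: "\<And>j x. x \<in> {-1..1} \<Longrightarrow> \<bar>?q j x\<bar> \<le> B j" by metis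
  let ?K = "\<Sum>j\<in>J. \<bar>B j\<bar>"
  have "norm (vpoly (\<lambda>s. (pderiv ^^ i) (P s)) x) \<le> ?K * (\<Sum>j\<in>J. norm (\<chi> s. \<Lambda> j (P s)))"
    if P: "\<forall>s. degree (P s) \<le> n" and x: "x \<in> {-1..1}" for P :: "'d \<Rightarrow> real poly" and x
  proof -
    have "poly ((pderiv ^^ i) (P s)) x = (\<Sum>j\<in>J. \<Lambda> j (P s) * ?q j x)" for s
      by (subst expansion[OF P[rule_format, of s]]) (simp add: higher_pderiv_sum higher_pderiv_smult poly_sum)
    then have "vpoly (\<lambda>s. (pderiv ^^ i) (P s)) x = (\<Sum>j\<in>J. ?q j x *\<^sub>R (\<chi> s. \<Lambda> j (P s)))"
      by (simp add: vec_eq_iff mult.commute)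
    also have "norm \<dots> \<le> (\<Sum>j\<in>J. ?K * norm (\<chi> s. \<Lambda> j (P s)))"
    proof (rule sum_norm_le)
      fix j assume j: "j \<in> J"
      have "\<bar>?q j x\<bar> \<le> \<bar>B j\<bar>" using B[OF x, of j] by linarith
      also have "\<dots> \<le> ?K" using finite_J j by (intro member_le_sum) auto
      finally show "norm (?q j x *\<^sub>R (\<chi> s. \<Lambda> j (P s))) \<le> ?K * norm (\<chi> s. \<Lambda> j (P s))"
        by (simp add: mult_right_mono)
    qed
    finally show ?thesis by (simp add: sum_distrib_left)
  qed
  then show ?thesis by (intro exI[of _ ?K]) (auto intro: sum_nonneg)
qed

end

section \<open>Hermite interpolation and the inverse inequality\<close>

lemma le_order_if_pderiv_zero:
  assumes "P \<noteq> 0" "\<And>l. l < m \<Longrightarrow> poly ((pderiv ^^ l) P) x = (0::real)"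
  shows "m \<le> order x P"
  using assms
proof (induction m arbitrary: P)
  case (Suc m)
  have root: "poly P x = 0" using Suc.prems(2)[of 0] by simp
  have nz: "pderiv P \<noteq> 0"
  proof
    assume "pderiv P = 0"
    then obtain c where "P = [:c:]" using pderiv_iszero by blast
    with root Suc.prems(1) show False by simp
  qed
  have "m \<le> order x (pderiv P)"
    using nz Suc.prems(2)[of "Suc _"] by (intro Suc.IH) (auto simp: funpow_swap1)
  then show ?case using order_pderiv[OF Suc.prems(1) root] by simp
qed simp

text \<open>Zeros counted with multiplicity: a polynomial annihilated by all conditions has at least
  \<open>card D\<close> of them, more than its degree allows unless it is zero.\<close>

lemma unisolvent_Hermite:
  fixes D :: "(real \<times> nat) set"
  assumes fin: "finite D" and card: "card D = Suc n"
    and down: "\<And>x l j. (x, l) \<in> D \<Longrightarrow> j \<le> l \<Longrightarrow> (x, j) \<in> D"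
  shows "unisolvent D n (\<lambda>(x, l) P. poly ((pderiv ^^ l) P) x)"
proof
  fix P :: "real poly"
  assume deg: "degree P \<le> n" and z: "\<And>j. j \<in> D \<Longrightarrow> (\<lambda>(x, l) P. poly ((pderiv ^^ l) P) x) j P = 0"
  show "P = 0"
  proof (rule ccontr)
    assume nz: "P \<noteq> 0"
    let ?L = "\<lambda>x. {l. (x, l) \<in> D}"
    have zero: "poly ((pderiv ^^ l) P) x = 0" if "(x, l) \<in> D" for x l
      using z[OF that] by simp
    have finL: "finite (?L x)" for x
      using finite_imageI[OF fin, of snd] by (rule rev_finite_subset) force
    have ord: "card (?L x) \<le> order x P" for x
    proof -
      \<comment> \<open>Since \<open>D\<close> is closed downwards, the orders prescribed at x form
        an initial segment, so their number is a lower bound for the multiplicity of the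
        zero.\<close>
      have in_D: "(x, m) \<in> D" if "m < card (?L x)" for m
      proof (rule ccontr)
        assume "(x, m) \<notin> D"
        then have "?L x \<subseteq> {..<m}" using down not_le_imp_less by blast
        then have "card (?L x) \<le> m" using card_mono[of "{..<m}" "?L x"] by simp
        with that show False by simp
      qed
      show ?thesis by (intro le_order_if_pderiv_zero nz zero in_D)
    qed
    have "D = (SIGMA x:fst ` D. ?L x)" by force
    then have "card D = (\<Sum>x\<in>fst ` D. card (?L x))"
      using fin finL card_SigmaI[of "fst ` D" ?L] by simp
    also have "\<dots> \<le> (\<Sum>x\<in>fst ` D. order x P)" by (intro sum_mono ord)
    also have "\<dots> \<le> (\<Sum>x | poly P x = 0. order x P)"
    proof (rule sum_mono2)
      show "fst ` D \<subseteq> {x. poly P x = 0}" using down zero[of _ 0] by auto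
    qed (use nz poly_roots_finite in auto)
    also have "\<dots> \<le> degree P" using sum_order_le_degree[OF nz] .
    finally show False using deg card by simp
  qed
qed (auto simp: fin card higher_pderiv_add higher_pderiv_smult)

text \<open>Lagrange interpolation makes the values at n + 1 nodes a unisolvent family, and each of
  these values is at most B.\<close>

lemma inverse_inequality:
  "\<exists>K\<ge>0. \<forall>(P :: 'd::finite \<Rightarrow> real poly) B. (\<forall>s. degree (P s) \<le> n) \<longrightarrow>
     (\<forall>x\<in>{-1..1}. norm (vpoly P x) \<le> B) \<longrightarrow>
     (\<forall>x\<in>{-1..1}. norm (vpoly (\<lambda>s. (pderiv ^^ i) (P s)) x) \<le> K * B)"
proof -
  \<comment> \<open>Any n + 1 distinct points of [-1,1] would do; these lie in [0,1).\<close>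
  let ?D = "(\<lambda>j. (real j / real (Suc n), 0::nat)) ` {..n}"
  have "inj_on (\<lambda>j. (real j / real (Suc n), 0::nat)) {..n}" by (auto simp: inj_on_def)
  then have card: "card ?D = Suc n" by (simp add: card_image)
  interpret unisolvent ?D n "\<lambda>(x, l) P. poly ((pderiv ^^ l) P) x"
    by (rule unisolvent_Hermite) (use card in auto)
  obtain K where K: "K \<ge> 0" "\<And>(P :: 'd \<Rightarrow> real poly) x. (\<forall>s. degree (P s) \<le> n) \<Longrightarrow> x \<in> {-1..1} \<Longrightarrow>
     norm (vpoly (\<lambda>s. (pderiv ^^ i) (P s)) x)
       \<le> K * (\<Sum>j\<in>?D. norm (\<chi> s. (\<lambda>(x, l) P. poly ((pderiv ^^ l) P) x) j (P s)))"
    using vpoly_bound[of i, where 'd = 'd] by blast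
  have "norm (vpoly (\<lambda>s. (pderiv ^^ i) (P s)) x) \<le> K * real (Suc n) * B"
    if P: "\<forall>s. degree (P s) \<le> n" "\<forall>x\<in>{-1..1}. norm (vpoly P x) \<le> B" "x \<in> {-1..1}"
    for P :: "'d \<Rightarrow> real poly" and B x
  proof -
    have "norm (\<chi> s. (\<lambda>(x, l) P. poly ((pderiv ^^ l) P) x) j (P s)) \<le> B" if j: "j \<in> ?D" for j
    proof -
      obtain m where m: "m \<le> n" "j = (real m / real (Suc n), 0)" using j by auto
      then have "real m / real (Suc n) \<in> {-1..1}" by (auto intro: order_trans[of "-1" 0])
      then have "norm (vpoly P (real m / real (Suc n))) \<le> B" using P(2) by blast
      then show ?thesis unfolding m(2) vpoly_def by simp
    qed
    then have S: "(\<Sum>j\<in>?D. norm (\<chi> s. (\<lambda>(x, l) P. poly ((pderiv ^^ l) P) x) j (P s))) \<le> real (card ?D) * B"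
      (is "?S \<le> _") by (rule sum_bounded_above)
    have "norm (vpoly (\<lambda>s. (pderiv ^^ i) (P s)) x) \<le> K * ?S"
      using P(1,3) by (rule K(2)[of P x])
    also have "\<dots> \<le> K * (real (Suc n) * B)"
      using S K(1) unfolding card by (intro mult_left_mono)
    finally show ?thesis by (simp only: mult.assoc)
  qed
  then show ?thesis using K(1) by (intro exI[of _ "K * real (Suc n)"]) auto
qed

subsection \<open>A nowhere differentiable function\<close>

text \<open>Distance to the nearest integer, the tent function of period 1.\<close>

definition dist_int :: "real \<Rightarrow> real" where
  "dist_int x = \<bar>x - of_int (round x)\<bar>"

lemma dist_int_le: "dist_int x \<le> 1 / 2"
  unfolding dist_int_def using of_int_round_abs_le[of x] by (simp add: abs_minus_commute)

lemma dist_int_Lipschitz: "dist_int x \<le> \<bar>x - y\<bar> + dist_int y"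
proof -
  have "dist_int x \<le> \<bar>x - of_int (round y)\<bar>"
    unfolding dist_int_def by (rule round_diff_minimal)
  then show ?thesis unfolding dist_int_def by linarith
qed

lemma continuous_dist_int: "continuous_on A dist_int"
proof (rule continuous_on_subset)
  show "continuous_on UNIV dist_int"
  proof (rule lipschitz_on_continuous_on)
    show "1-lipschitz_on UNIV dist_int"
    proof (rule lipschitz_onI)
      show "dist (dist_int x) (dist_int y) \<le> 1 * dist x y" for x y
        using dist_int_Lipschitz[of x y] dist_int_Lipschitz[of y x] by (simp add: dist_real_def)
    qed simp
  qed
qed simp

text \<open>The blancmange function: tents of halving height and halving period, superposed.\<close>

definition takagi :: "real \<Rightarrow> real" where
  "takagi x = (\<Sum>k. dist_int (2 ^ k * x) / 2 ^ k)"

lemma continuous_takagi: "continuous_on A takagi"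
proof -
  have "uniform_limit A (\<lambda>n x. \<Sum>k<n. dist_int (2 ^ k * x) / 2 ^ k) takagi sequentially"
    unfolding takagi_def[abs_def]
  proof (rule Weierstrass_m_test)
    show "norm (dist_int (2 ^ k * x) / 2 ^ k) \<le> (1 / 2) ^ k" for k x
    proof -
      have "norm (dist_int (2 ^ k * x)) \<le> 1"
        using dist_int_le[of "2 ^ k * x"] by (simp add: dist_int_def)
      then show ?thesis by (simp add: power_divide divide_right_mono)
    qed
    show "summable (\<lambda>k. (1 / 2 :: real) ^ k)" by (simp add: summable_geometric)
  qed
  moreover have "continuous_on A (\<lambda>x. \<Sum>k<n. dist_int (2 ^ k * x) / 2 ^ k)" for n
    by (intro continuous_intros continuous_on_compose2[OF continuous_dist_int[of UNIV]]) auto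
  ultimately show ?thesis
    by (intro uniform_limit_theorem[of _ _ sequentially]) auto
qed

text \<open>At m / 2^n all terms with k \<ge> n vanish, since there the argument of the tent is an
  integer. Each of the n remaining terms, multiplied by 2^n, is an integer of the parity of
  m.\<close>

lemma takagi_dyadic:
  obtains A :: int where "2 ^ n * takagi (of_int m / 2 ^ n) = of_int A" "even (A - int n * m)"
proof
  let ?N = "\<lambda>k. (2::int) ^ (n - k)"
  let ?a = "\<lambda>k. \<bar>m - ?N k * round (of_int m / of_int (?N k) :: real)\<bar>"
  have z: "dist_int (2 ^ k * (of_int m / 2 ^ n)) / 2 ^ k = 0" if "k \<notin> {..<n}" for k
  proof -
    have "(2::real) ^ k = 2 ^ (k - n) * 2 ^ n" using that by (simp flip: power_add)
    then have "2 ^ k * (of_int m / 2 ^ n) = (of_int (2 ^ (k - n) * m) :: real)" by simp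
    then show ?thesis unfolding dist_int_def by (simp only: round_of_int) simp
  qed
  have t: "2 ^ n * (dist_int (2 ^ k * (of_int m / 2 ^ n)) / 2 ^ k) = of_int (?a k)" if "k < n" for k
  proof -
    have N: "(2::real) ^ n = 2 ^ k * of_int (?N k)"
      using that by (simp flip: power_add)
    have pos: "of_int (?N k) > (0::real)" by simp
    have "2 ^ k * (of_int m / 2 ^ n) = (of_int m / of_int (?N k) :: real)"
      unfolding N by simp
    then have "2 ^ n * (dist_int (2 ^ k * (of_int m / 2 ^ n)) / 2 ^ k) =
        of_int (?N k) * dist_int (of_int m / of_int (?N k))"
      unfolding N by simp
    also have "\<dots> = \<bar>of_int (?N k) * (of_int m / of_int (?N k) - of_int (round (of_int m / of_int (?N k) :: real)))\<bar>"
      unfolding dist_int_def abs_mult using pos by (simp only: abs_of_pos)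
    also have "\<dots> = of_int (?a k)"
      using pos by (simp add: right_diff_distrib del: of_int_power)
    finally show ?thesis .
  qed
  have "takagi (of_int m / 2 ^ n) = (\<Sum>k<n. dist_int (2 ^ k * (of_int m / 2 ^ n)) / 2 ^ k)"
    unfolding takagi_def by (rule suminf_finite) (use z in auto)
  then have "2 ^ n * takagi (of_int m / 2 ^ n) =
      (\<Sum>k<n. 2 ^ n * (dist_int (2 ^ k * (of_int m / 2 ^ n)) / 2 ^ k))"
    by (simp only: sum_distrib_left)
  also have "\<dots> = (\<Sum>k<n. of_int (?a k))" by (rule sum.cong[OF refl], rule t) simp
  finally show "2 ^ n * takagi (of_int m / 2 ^ n) = of_int (\<Sum>k<n. ?a k)" by simp
  \<comment> \<open>For k < n the modulus \<open>?N k\<close> is even, and taking the absolute value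
    does not change parity.\<close>
  have "even (?a k - m)" if "k < n" for k
    using that by simp
  then have "even (\<Sum>k<n. ?a k - m)" by (intro dvd_sum) simp
  then show "even ((\<Sum>k<n. ?a k) - int n * m)" by (simp add: sum_subtractf)
qed

text \<open>By the parity in \<open>takagi_dyadic\<close>, the difference quotients over dyadic intervals of level \<open>n\<close> are integers
  congruent to \<open>n\<close> modulo 2, hence do not converge.\<close>

lemma takagi_not_differentiable:
  assumes x: "x \<in> {0..1}"
  shows "\<not> (takagi has_vector_derivative d) (at x within {0..1})"
proof
  assume "(takagi has_vector_derivative d) (at x within {0..1})"
  then have "(takagi has_derivative (\<lambda>h. h * d)) (at x within {0..1})"
    by (simp add: has_vector_derivative_def)
  then obtain \<delta> where \<delta>: "\<delta> > 0" "\<And>y. y \<in> {0..1} \<Longrightarrow> \<bar>y - x\<bar> < \<delta> \<Longrightarrow>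
      \<bar>takagi y - takagi x - (y - x) * d\<bar> \<le> 1 / 4 * \<bar>y - x\<bar>"
    unfolding has_derivative_within_alt using zero_less_divide_1_iff[of "4::real"]
    by (metis real_norm_def zero_less_numeral)
  obtain n0 where n0: "(1 / 2) ^ n0 < \<delta>" using real_arch_pow_inv[OF \<delta>(1), of "1/2"] by auto
  \<comment> \<open>The tolerance 1/4 is chosen so that the integers of two consecutive levels, both
    this close to d, differ by less than 1 and hence coincide, against their opposite
    parities.\<close>
  have quot: "\<exists>D::int. \<bar>of_int D - d\<bar> \<le> 1 / 4 \<and> even (D - int n)" if n: "n \<ge> n0" for n
  proof -
    \<comment> \<open>The minimum matters for x = 1 only, where the dyadic interval must be the one
      to the left of x to stay inside [0,1].\<close>
    define m where "m = min \<lfloor>2 ^ n * x\<rfloor> (2 ^ n - 1)"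
    let ?u = "of_int m / 2 ^ n :: real" and ?v = "of_int (m + 1) / 2 ^ n :: real"
    have "of_int m \<le> 2 ^ n * x" unfolding m_def
      by (metis le_floor_iff min.cobounded1)
    moreover have "0 \<le> m" using x by (simp add: m_def)
    moreover have "2 ^ n * x \<le> of_int (m + 1)"
    proof (cases "\<lfloor>2 ^ n * x\<rfloor> \<le> 2 ^ n - 1")
      case True
      then have "m = \<lfloor>2 ^ n * x\<rfloor>" by (simp add: m_def)
      then show ?thesis by linarith
    next
      case False
      then have "m + 1 = 2 ^ n" by (simp add: m_def)
      then show ?thesis using x by (simp add: mult_left_le)
    qed
    moreover have "m + 1 \<le> 2 ^ n" by (simp add: m_def)
    then have "of_int (m + 1) \<le> (2::real) ^ n" by (metis of_int_le_iff of_int_numeral of_int_power)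
    ultimately have uv: "0 \<le> ?u" "?u \<le> x" "x \<le> ?v" "?v \<le> 1"
      by (simp_all add: field_simps)
    have w: "?v - ?u = (1 / 2) ^ n" by (simp add: field_simps power_divide)
    have small: "(1 / 2 :: real) ^ n < \<delta>"
      by (rule order_le_less_trans[OF power_decreasing[OF n] n0]) simp_all
    have "\<bar>takagi ?v - takagi x - (?v - x) * d\<bar> \<le> 1 / 4 * \<bar>?v - x\<bar>"
      by (rule \<delta>(2)) (use uv w small in \<open>unfold atLeastAtMost_iff, linarith+\<close>)
    moreover have "\<bar>takagi ?u - takagi x - (?u - x) * d\<bar> \<le> 1 / 4 * \<bar>?u - x\<bar>"
      by (rule \<delta>(2)) (use uv w small in \<open>unfold atLeastAtMost_iff, linarith+\<close>)
    \<comment> \<open>Straddling: for u \<le> x \<le> v the two one-sided errors add up to 1/4 of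
      the whole length, so the quotient over [u,v] is as close to d as those based at x.\<close>
    moreover have "\<bar>gv - gu - (v - u) * d\<bar> \<le> 1 / 4 * (v - u)"
      if "\<bar>gv - gx - (v - x) * d\<bar> \<le> 1 / 4 * \<bar>v - x\<bar>" "\<bar>gu - gx - (u - x) * d\<bar> \<le> 1 / 4 * \<bar>u - x\<bar>"
        "u \<le> x" "x \<le> v" for gu gv gx u v :: real
    proof -
      have "gv - gu - (v - u) * d = (gv - gx - (v - x) * d) - (gu - gx - (u - x) * d)"
        by (simp add: left_diff_distrib)
      then have "\<bar>gv - gu - (v - u) * d\<bar> \<le> 1 / 4 * \<bar>v - x\<bar> + 1 / 4 * \<bar>u - x\<bar>"
        by (simp only:) (rule order_trans[OF abs_triangle_ineq4 add_mono[OF that(1,2)]])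
      also have "1 / 4 * \<bar>v - x\<bar> + 1 / 4 * \<bar>u - x\<bar> = 1 / 4 * (v - u)"
        using that(3,4) by (simp add: abs_of_nonneg abs_of_nonpos diff_divide_distrib)
      finally show ?thesis .
    qed
    ultimately have "\<bar>takagi ?v - takagi ?u - (?v - ?u) * d\<bar> \<le> 1 / 4 * (?v - ?u)"
      using uv by blast
    then have "2 ^ n * \<bar>takagi ?v - takagi ?u - (1 / 2) ^ n * d\<bar> \<le> 2 ^ n * (1 / 4 * (1 / 2) ^ n)"
      unfolding w by (intro mult_left_mono) auto
    moreover have "2 ^ n * \<bar>takagi ?v - takagi ?u - (1 / 2) ^ n * d\<bar>
        = \<bar>2 ^ n * (takagi ?v - takagi ?u - (1 / 2) ^ n * d)\<bar>" by (simp add: abs_mult)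
    moreover have "2 ^ n * (takagi ?v - takagi ?u - (1 / 2) ^ n * d) = 2 ^ n * takagi ?v - 2 ^ n * takagi ?u - d"
      by (simp add: power_divide right_diff_distrib)
    ultimately have 1: "\<bar>2 ^ n * takagi ?v - 2 ^ n * takagi ?u - d\<bar> \<le> 1 / 4"
      by (simp add: power_divide)
    obtain A where A: "2 ^ n * takagi ?u = of_int A" "even (A - int n * m)"
      using takagi_dyadic[of n m] .
    obtain B where B: "2 ^ n * takagi ?v = of_int B" "even (B - int n * (m + 1))"
      using takagi_dyadic[of n "m + 1"] .
    have "B - A - int n = (B - int n * (m + 1)) - (A - int n * m)" by (simp add: algebra_simps)
    then have "even (B - A - int n)" using A(2) B(2) by (metis dvd_diff)
    moreover have "\<bar>of_int (B - A) - d\<bar> \<le> 1 / 4" using 1 unfolding A B by simp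
    ultimately show ?thesis by blast
  qed
  obtain D E :: int where D: "\<bar>of_int D - d\<bar> \<le> 1 / 4" "even (D - int n0)"
    and E: "\<bar>of_int E - d\<bar> \<le> 1 / 4" "even (E - int (Suc n0))"
    using quot[of n0] quot[of "Suc n0"] by auto
  have "\<bar>of_int (E - D) :: real\<bar> < 1" using D(1) E(1) unfolding of_int_diff by linarith
  then have "E = D" by linarith
  then show False using D(2) E(2) by simp
qed

text \<open>A rescaled Takagi function integrated K times: each integration gains one order of
  smoothness and leaves the top derivative nowhere differentiable.\<close>

lemma ex_rough_function:
  assumes ab: "a < b"
  shows "\<exists>\<delta>::real \<Rightarrow> real. Ck_on {a..b} K \<delta> \<and>
    (\<forall>t\<in>{a..b}. \<forall>d. \<not> (hderiv {a..b} K \<delta> has_vector_derivative d) (at t within {a..b}))"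
proof (induction K)
  case 0
  let ?g = "\<lambda>t. takagi ((t - a) / (b - a))"
  have "continuous_on {a..b} ?g"
    using ab by (intro continuous_on_compose2[OF continuous_takagi[of UNIV]] continuous_intros) auto
  moreover have "\<not> (?g has_vector_derivative d) (at t within {a..b})" if t: "t \<in> {a..b}" for t d
  proof
    assume g: "(?g has_vector_derivative d) (at t within {a..b})"
    let ?x = "(t - a) / (b - a)" and ?s = "\<lambda>x. a + (b - a) * x"
    have s: "(?s has_vector_derivative (b - a)) (at ?x within {0..1})"
      unfolding has_real_derivative_iff_has_vector_derivative[symmetric]
      by (auto intro!: derivative_eq_intros)
    have x: "?s ?x = t" using ab by simp
    have "?s ` {0..1} \<subseteq> {a..b}"
    proof
      fix y assume "y \<in> ?s ` {0..1}"
      then obtain z where z: "0 \<le> z" "z \<le> 1" "y = ?s z" by auto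
      then have "(b - a) * z \<le> (b - a) * 1" "0 \<le> (b - a) * z" using ab by (auto intro!: mult_left_mono)
      then show "y \<in> {a..b}" using z(3) by simp
    qed
    then have "(?g has_vector_derivative d) (at (?s ?x) within ?s ` {0..1})"
      unfolding x using g by (rule has_vector_derivative_within_subset[rotated])
    from vector_diff_chain_within[OF s this]
    have "(takagi has_vector_derivative (b - a) * d) (at ?x within {0..1})"
      using ab by (simp add: o_def)
    moreover have "?x \<in> {0..1}" using t ab by (auto simp: divide_le_eq)
    ultimately show False using takagi_not_differentiable by blast
  qed
  ultimately show ?case by (intro exI[of _ ?g]) (auto simp: Ck_on_def)
next
  case (Suc K)
  then obtain \<delta> :: "real \<Rightarrow> real" where \<delta>: "Ck_on {a..b} K \<delta>"
    "\<And>t d. t \<in> {a..b} \<Longrightarrow> \<not> (hderiv {a..b} K \<delta> has_vector_derivative d) (at t within {a..b})" by blast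
  obtain F where F: "\<And>x. x \<in> {a..b} \<Longrightarrow> (F has_vector_derivative \<delta> x) (at x within {a..b})"
    using antiderivative_continuous[OF Ck_on_continuous_on[OF \<delta>(1)]] by blast
  have eq: "hderiv {a..b} K \<delta> y = hderiv {a..b} (Suc K) F y" if "y \<in> {a..b}" for y
    by (rule sym, rule Ck_on_Suc(2)[OF ab _ \<delta>(1) le_refl that]) (rule F)
  have "\<not> (hderiv {a..b} (Suc K) F has_vector_derivative d) (at t within {a..b})"
    if t: "t \<in> {a..b}" for t d
  proof
    assume "(hderiv {a..b} (Suc K) F has_vector_derivative d) (at t within {a..b})"
    then have "(hderiv {a..b} K \<delta> has_vector_derivative d) (at t within {a..b})"
      by (rule has_vector_derivative_transform[OF t, rotated]) (rule eq)
    then show False using \<delta>(2)[OF t] by blast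
  qed
  moreover have "Ck_on {a..b} (Suc K) F"
    by (rule Ck_on_Suc(1)[OF ab _ \<delta>(1)]) (rule F)
  ultimately show ?case by blast
qed

subsection \<open>Estimates that do not see derivatives beyond the order of smoothness\<close>

lemma hderiv_plus: "hderiv S (i + j) g = hderiv S j (hderiv S i g)"
  by (induction j) simp_all

lemma hderiv_const:
  assumes "a < b" "x \<in> {a..b}"
  shows "hderiv {a..b} j (\<lambda>t. c) x = (if j = 0 then c else 0)"
  using hderiv_eq_sequence[where G = "\<lambda>j t. if j = 0 then c else 0", OF assms(1) _ _ _ assms(2), of "\<lambda>t. c" j j]
  by simp

text \<open>Where a function is not differentiable, \<open>vector_derivative\<close> is the fixed value \<open>SOME v. False\<close>, so the
  bound \<open>R\<close> can be chosen independently of the scaling factor \<open>s\<close>.\<close>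

lemma ex_rough_direction:
  assumes ab: "a < b"
  shows "\<exists>\<delta> :: real \<Rightarrow> real ^ 'd. \<exists>R. Ck_on {a..b} K \<delta> \<and>
    (\<forall>\<phi> s \<epsilon> j x. Ck_on {a..b} (Suc K) \<phi> \<longrightarrow> s \<noteq> 0 \<longrightarrow> \<epsilon> \<noteq> 0 \<longrightarrow> K < j \<longrightarrow> x \<in> {a..b} \<longrightarrow>
       norm (hderiv {a..b} j (\<lambda>t. s *\<^sub>R (\<phi> t + \<epsilon> *\<^sub>R \<delta> t)) x) \<le> R)"
proof -
  obtain \<gamma> :: "real \<Rightarrow> real" where \<gamma>: "Ck_on {a..b} K \<gamma>"
    "\<And>t d. t \<in> {a..b} \<Longrightarrow> \<not> (hderiv {a..b} K \<gamma> has_vector_derivative d) (at t within {a..b})"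
    using ex_rough_function[OF ab, of K] by blast
  \<comment> \<open>With all entries equal to 1, every single component of the perturbation is
    rough.\<close>
  define e :: "real ^ 'd" where "e = (\<chi> i. 1)"
  define c where "c = (SOME v :: real ^ 'd. False)"
  define \<delta> where "\<delta> t = \<gamma> t *\<^sub>R e" for t
  have C\<delta>: "Ck_on {a..b} K \<delta>"
    unfolding \<delta>_def[abs_def] by (rule Ck_on_bounded_linear[OF bounded_linear_scaleR_left ab \<gamma>(1)])
  have \<delta>K: "hderiv {a..b} K \<delta> y = hderiv {a..b} K \<gamma> y *\<^sub>R e" if "y \<in> {a..b}" for y
    unfolding \<delta>_def[abs_def] by (rule hderiv_bounded_linear[OF bounded_linear_scaleR_left ab \<gamma>(1) le_refl that])
  have "norm (hderiv {a..b} j (\<lambda>t. s *\<^sub>R (\<phi> t + \<epsilon> *\<^sub>R \<delta> t)) x) \<le> norm c"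
    if \<phi>: "Ck_on {a..b} (Suc K) \<phi>" and s: "s \<noteq> 0" and \<epsilon>: "\<epsilon> \<noteq> 0" and j: "K < j" and x: "x \<in> {a..b}"
    for \<phi> :: "real \<Rightarrow> real ^ 'd" and s \<epsilon> j x
  proof -
    let ?\<psi> = "\<lambda>t. s *\<^sub>R (\<phi> t + \<epsilon> *\<^sub>R \<delta> t)"
    have \<phi>K: "Ck_on {a..b} K \<phi>" using \<phi> Ck_on_mono le_SucI by blast
    have K: "hderiv {a..b} K ?\<psi> y = s *\<^sub>R (hderiv {a..b} K \<phi> y + \<epsilon> *\<^sub>R hderiv {a..b} K \<gamma> y *\<^sub>R e)"
      if "y \<in> {a..b}" for y
      using that
      by (simp add: hderiv_scale[OF ab Ck_on_add[OF ab \<phi>K Ck_on_scale[OF ab C\<delta>]]]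
          hderiv_add[OF ab \<phi>K Ck_on_scale[OF ab C\<delta>]] hderiv_scale[OF ab C\<delta>] \<delta>K)
    have "\<not> (hderiv {a..b} K ?\<psi> has_vector_derivative d) (at y within {a..b})"
      if y: "y \<in> {a..b}" for y d
    proof
      fix i :: 'd
      assume D: "(hderiv {a..b} K ?\<psi> has_vector_derivative d) (at y within {a..b})"
      have "((\<lambda>t. (1 / (s * \<epsilon>)) *\<^sub>R (hderiv {a..b} K ?\<psi> t $ i) - (1 / \<epsilon>) *\<^sub>R (hderiv {a..b} K \<phi> t $ i))
          has_vector_derivative (1 / (s * \<epsilon>)) *\<^sub>R (d $ i) - (1 / \<epsilon>) *\<^sub>R (hderiv {a..b} (Suc K) \<phi> y $ i))
          (at y within {a..b})"
        by (intro has_vector_derivative_diff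
            bounded_linear.has_vector_derivative[OF bounded_linear_scaleR_right]
            bounded_linear.has_vector_derivative[OF bounded_linear_vec_nth] D
            Ck_onD(1)[OF \<phi> _ y]) simp
      \<comment> \<open>One component of \<open>?\<psi>\<close> recovers \<gamma> up to a
        differentiable term, so a derivative of \<open>?\<psi>\<close> would pass on to
        \<gamma>.\<close>
      moreover have "hderiv {a..b} K \<gamma> t =
          (1 / (s * \<epsilon>)) *\<^sub>R (hderiv {a..b} K ?\<psi> t $ i) - (1 / \<epsilon>) *\<^sub>R (hderiv {a..b} K \<phi> t $ i)" if "t \<in> {a..b}" for t
        unfolding K[OF that] using s \<epsilon> by (simp add: e_def field_simps)
      ultimately have "(hderiv {a..b} K \<gamma> has_vector_derivative
          (1 / (s * \<epsilon>)) *\<^sub>R (d $ i) - (1 / \<epsilon>) *\<^sub>R (hderiv {a..b} (Suc K) \<phi> y $ i)) (at y within {a..b})"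
        by (rule has_vector_derivative_transform[OF y, rotated])
      then show False using \<gamma>(2)[OF y] by blast
    qed
    \<comment> \<open>The derivative of order K + 1 is the same junk vector at every point, hence a
      constant function. All further derivatives are therefore genuine and equal 0.\<close>
    then have "hderiv {a..b} (Suc K) ?\<psi> y = c" if "y \<in> {a..b}" for y
      using that by (simp add: vector_derivative_def c_def)
    then have "hderiv {a..b} (j - Suc K) (hderiv {a..b} (Suc K) ?\<psi>) x = hderiv {a..b} (j - Suc K) (\<lambda>_. c) x"
      using x by (rule hderiv_cong)
    then have "hderiv {a..b} j ?\<psi> x = (if j - Suc K = 0 then c else 0)"
      using j by (simp only: hderiv_const[OF ab x] flip: hderiv_plus) simp
    then show ?thesis by (simp split: if_splits)
  qed
  with C\<delta> show ?thesis by blast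
qed

lemma pt_terms_nonneg: "a < b \<Longrightarrow> 0 \<le> pt_terms a b tp K Kt \<phi>"
  unfolding pt_terms_def by (intro sum_nonneg mult_nonneg_nonneg) auto

lemma
  assumes "a < b" "tp ` {..Kp} \<subseteq> {-1..1}" "\<And>m. m \<le> Kp \<Longrightarrow> Kt m \<le> K" "Ck_on {a..b} K \<phi>" "Ck_on {a..b} K \<psi>"
  shows pt_terms_add: "pt_terms a b tp Kp Kt (\<lambda>t. \<phi> t + \<psi> t) \<le> pt_terms a b tp Kp Kt \<phi> + pt_terms a b tp Kp Kt \<psi>"
    and pt_terms_scale: "pt_terms a b tp Kp Kt (\<lambda>t. s *\<^sub>R \<phi> t) = \<bar>s\<bar> * pt_terms a b tp Kp Kt \<phi>"
proof -
  have T: "Tmap a b (tp m) \<in> {a..b}" if "m \<le> Kp" for m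
    using Tmap_in[OF assms(1)] that assms(2) by blast
  have "norm (hderiv {a..b} j (\<lambda>t. \<phi> t + \<psi> t) (Tmap a b (tp m))) \<le>
      norm (hderiv {a..b} j \<phi> (Tmap a b (tp m))) + norm (hderiv {a..b} j \<psi> (Tmap a b (tp m)))"
    if "m \<le> Kp" "j \<le> Kt m" for m j
    using hderiv_add[OF assms(1,4,5) _ T[OF that(1)], of j] that assms(3)[of m] norm_triangle_ineq by simp
  then show "pt_terms a b tp Kp Kt (\<lambda>t. \<phi> t + \<psi> t) \<le> pt_terms a b tp Kp Kt \<phi> + pt_terms a b tp Kp Kt \<psi>"
    unfolding pt_terms_def sum.distrib[symmetric] distrib_left[symmetric]
    using assms(1) by (intro sum_mono mult_left_mono) auto
  have "norm (hderiv {a..b} j (\<lambda>t. s *\<^sub>R \<phi> t) (Tmap a b (tp m))) = \<bar>s\<bar> * norm (hderiv {a..b} j \<phi> (Tmap a b (tp m)))"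
    if "m \<le> Kp" "j \<le> Kt m" for m j
    using hderiv_scale[OF assms(1,4) _ T[OF that(1)], of j] that assms(3)[of m] by simp
  then show "pt_terms a b tp Kp Kt (\<lambda>t. s *\<^sub>R \<phi> t) = \<bar>s\<bar> * pt_terms a b tp Kp Kt \<phi>"
    unfolding pt_terms_def sum_distrib_left
    by (intro sum.cong) (simp_all add: algebra_simps)
qed

lemma supn_add:
  fixes \<phi> \<psi> :: "real \<Rightarrow> 'a::real_normed_vector"
  assumes "a < b" "continuous_on {a..b} \<phi>" "continuous_on {a..b} \<psi>"
  shows "supn {a<..b} (\<lambda>t. \<phi> t + \<psi> t) \<le> supn {a<..b} \<phi> + supn {a<..b} \<psi>"
  using norm_le_supn[OF assms(1,2)] norm_le_supn[OF assms(1,3)]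
  by (intro supn_le_Ioc[OF assms(1)] norm_triangle_le add_mono)

lemma supn_scale:
  fixes \<phi> :: "real \<Rightarrow> 'a::real_normed_vector"
  assumes "a < b" "continuous_on {a..b} \<phi>" "0 < s"
  shows "supn {a<..b} (\<lambda>t. s *\<^sub>R \<phi> t) = s * supn {a<..b} \<phi>"
proof (rule antisym)
  show "supn {a<..b} (\<lambda>t. s *\<^sub>R \<phi> t) \<le> s * supn {a<..b} \<phi>"
    using norm_le_supn[OF assms(1,2)] assms(3) by (intro supn_le_Ioc[OF assms(1)]) (simp add: mult_left_mono)
  have "supn {a<..b} \<phi> \<le> supn {a<..b} (\<lambda>t. s *\<^sub>R \<phi> t) / s"
    using norm_le_supn[OF assms(1), of "\<lambda>t. s *\<^sub>R \<phi> t"] assms(2,3)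
    by (intro supn_le_Ioc[OF assms(1)]) (simp add: continuous_on_scaleR continuous_on_const field_simps)
  then show "s * supn {a<..b} \<phi> \<le> supn {a<..b} (\<lambda>t. s *\<^sub>R \<phi> t)"
    using assms(3) by (simp add: field_simps)
qed

lemma le_if_le_plus_multiple:
  fixes x y c :: real
  assumes "\<And>\<epsilon>. 0 < \<epsilon> \<Longrightarrow> x \<le> y + \<epsilon> * c"
  shows "x \<le> y"
proof (rule field_le_epsilon)
  fix e :: real assume "0 < e"
  then have "x \<le> y + e / (\<bar>c\<bar> + 1) * c" by (intro assms) (simp add: field_simps)
  moreover have "e / (\<bar>c\<bar> + 1) * c \<le> e / (\<bar>c\<bar> + 1) * (\<bar>c\<bar> + 1)"
    using \<open>0 < e\<close> by (intro mult_left_mono) auto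
  moreover have "e / (\<bar>c\<bar> + 1) * (\<bar>c\<bar> + 1) = e" by simp
  ultimately show "x \<le> y + e" by linarith
qed

text \<open>The bound is tested with s (f + \<epsilon> \<delta>). Orders up to K grow like s, while
  higher ones stay below a fixed bound, so dividing by s and letting s grow removes them; afterwards
  \<epsilon> tends to 0. Since the test functions leave the smooth class, M has to be homogeneous
  and satisfy the triangle inequality on all of C^K.\<close>

lemma truncated_estimate:
  fixes M :: "(real \<Rightarrow> real ^ 'd) \<Rightarrow> real"
  assumes ab: "a < b" and tp: "tp ` {..Kp} \<subseteq> {-1..1}"
    and sub: "\<And>f g. Ck_on {a..b} K f \<Longrightarrow> Ck_on {a..b} K g \<Longrightarrow> M f \<le> M (\<lambda>t. f t + g t) + M g"
    and scale: "\<And>f s. Ck_on {a..b} K f \<Longrightarrow> 0 < s \<Longrightarrow> M (\<lambda>t. s *\<^sub>R f t) = s * M f"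
    and bound: "\<And>f. Ck_on {a..b} K f \<Longrightarrow> M f \<le> C1 * pt_terms a b tp Kp Kt f + C2 * supn {a<..b} f"
    and \<phi>: "Cinf_on {a..b} \<phi>"
  shows "M \<phi> \<le> \<bar>C1\<bar> * pt_terms a b tp Kp (\<lambda>m. min (Kt m) K) \<phi> + \<bar>C2\<bar> * supn {a<..b} \<phi>"
proof -
  let ?pt = "pt_terms a b tp Kp (\<lambda>m. min (Kt m) K)"
  let ?B = "\<lambda>f. \<bar>C1\<bar> * ?pt f + \<bar>C2\<bar> * supn {a<..b} f"
  obtain \<delta> :: "real \<Rightarrow> real ^ 'd" and R where \<delta>: "Ck_on {a..b} K \<delta>"
    and R: "\<And>\<phi> s \<epsilon> j x. Ck_on {a..b} (Suc K) \<phi> \<Longrightarrow> s \<noteq> 0 \<Longrightarrow> \<epsilon> \<noteq> 0 \<Longrightarrow> K < j \<Longrightarrow> x \<in> {a..b} \<Longrightarrow>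
       norm (hderiv {a..b} j (\<lambda>t. s *\<^sub>R (\<phi> t + \<epsilon> *\<^sub>R \<delta> t)) x) \<le> R"
    using ex_rough_direction[OF ab, of K, where 'd = 'd] by blast
  \<comment> \<open>Bounds all point terms of order above K at once, whatever the scaling.\<close>
  define R' where "R' = (\<Sum>m\<le>Kp. \<Sum>j\<le>Kt m. ((b - a) / 2) ^ j * \<bar>R\<bar>)"
  have B_add: "?B (\<lambda>t. f t + g t) \<le> ?B f + ?B g" and B_scale: "0 < s \<Longrightarrow> ?B (\<lambda>t. s *\<^sub>R f t) = s * ?B f"
    if "Ck_on {a..b} K f" "Ck_on {a..b} K g" for f g :: "real \<Rightarrow> real ^ 'd" and s
  proof -
    note c = Ck_on_continuous_on[OF that(1)] Ck_on_continuous_on[OF that(2)]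
    have "\<bar>C1\<bar> * ?pt (\<lambda>t. f t + g t) \<le> \<bar>C1\<bar> * (?pt f + ?pt g)"
      by (intro mult_left_mono pt_terms_add[OF ab tp _ that]) auto
    moreover have "\<bar>C2\<bar> * supn {a<..b} (\<lambda>t. f t + g t) \<le> \<bar>C2\<bar> * (supn {a<..b} f + supn {a<..b} g)"
      by (intro mult_left_mono supn_add[OF ab] c) auto
    ultimately show "?B (\<lambda>t. f t + g t) \<le> ?B f + ?B g" by (simp add: algebra_simps)
    show "?B (\<lambda>t. s *\<^sub>R f t) = s * ?B f" if "0 < s"
      using pt_terms_scale[OF ab tp _ \<open>Ck_on {a..b} K f\<close> \<open>Ck_on {a..b} K g\<close>, of "\<lambda>m. min (Kt m) K" s]
        supn_scale[OF ab c(1) that] that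
      by (simp add: algebra_simps)
  qed
  have rough: "M (\<lambda>t. f t + \<epsilon> *\<^sub>R \<delta> t) \<le> ?B (\<lambda>t. f t + \<epsilon> *\<^sub>R \<delta> t)"
    if f: "Cinf_on {a..b} f" and \<epsilon>: "0 < \<epsilon>" for f \<epsilon>
  proof (rule le_if_le_plus_multiple)
    \<comment> \<open>\<open>q\<close> is the reciprocal of the scaling factor; small q means large
      multiples of \<open>?\<psi>\<close>.\<close>
    fix q :: real assume q: "0 < q"
    let ?\<psi> = "\<lambda>t. f t + \<epsilon> *\<^sub>R \<delta> t" and ?s = "1 / q"
    let ?\<psi>s = "\<lambda>t. ?s *\<^sub>R ?\<psi> t"
    have C: "Ck_on {a..b} K ?\<psi>"
      by (intro Ck_on_add[OF ab] Ck_on_scale[OF ab] Cinf_on_imp_Ck_on[OF f] \<delta>)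
    have Cs: "Ck_on {a..b} K ?\<psi>s" by (rule Ck_on_scale[OF ab C])
    have "pt_terms a b tp Kp Kt ?\<psi>s \<le> ?pt ?\<psi>s + R'"
    proof -
      have "(\<Sum>j\<le>Kt m. ((b - a) / 2) ^ j * norm (hderiv {a..b} j ?\<psi>s (Tmap a b (tp m))))
         \<le> (\<Sum>j\<le>min (Kt m) K. ((b - a) / 2) ^ j * norm (hderiv {a..b} j ?\<psi>s (Tmap a b (tp m))))
           + (\<Sum>j\<le>Kt m. ((b - a) / 2) ^ j * \<bar>R\<bar>)" (is "sum ?w _ \<le> _ + ?r") if m: "m \<le> Kp" for m
      proof -
        have T: "Tmap a b (tp m) \<in> {a..b}"
          using Tmap_in[OF ab] m tp by blast
        have "sum ?w {..Kt m} = sum ?w ({..Kt m} - {..min (Kt m) K}) + sum ?w {..min (Kt m) K}"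
          by (rule sum.subset_diff) auto
        moreover have "sum ?w ({..Kt m} - {..min (Kt m) K})
            \<le> (\<Sum>j\<in>{..Kt m} - {..min (Kt m) K}. ((b - a) / 2) ^ j * \<bar>R\<bar>)"
        proof (intro sum_mono mult_left_mono)
          fix j assume "j \<in> {..Kt m} - {..min (Kt m) K}"
          then have "norm (hderiv {a..b} j ?\<psi>s (Tmap a b (tp m))) \<le> R"
            using q \<epsilon> by (intro R[OF Cinf_on_imp_Ck_on[OF f] _ _ _ T]) auto
          then show "norm (hderiv {a..b} j ?\<psi>s (Tmap a b (tp m))) \<le> \<bar>R\<bar>" by linarith
        qed (use ab in auto)
        moreover have "(\<Sum>j\<in>{..Kt m} - {..min (Kt m) K}. ((b - a) / 2) ^ j * \<bar>R\<bar>) \<le> ?r"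
          by (intro sum_mono2) (use ab in auto)
        ultimately show ?thesis by linarith
      qed
      then show ?thesis unfolding pt_terms_def R'_def sum.distrib[symmetric] by (intro sum_mono) auto
    qed
    then have "\<bar>C1\<bar> * pt_terms a b tp Kp Kt ?\<psi>s \<le> \<bar>C1\<bar> * (?pt ?\<psi>s + R')" by (rule mult_left_mono) simp
    moreover have "C1 * pt_terms a b tp Kp Kt ?\<psi>s \<le> \<bar>C1\<bar> * pt_terms a b tp Kp Kt ?\<psi>s"
      by (intro mult_right_mono pt_terms_nonneg[OF ab]) auto
    moreover have "C2 * supn {a<..b} ?\<psi>s \<le> \<bar>C2\<bar> * supn {a<..b} ?\<psi>s"
      by (intro mult_right_mono supn_nonneg[OF ab] Ck_on_continuous_on[OF Cs]) auto
    ultimately have "M ?\<psi>s \<le> ?B ?\<psi>s + \<bar>C1\<bar> * R'"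
      using bound[OF Cs] by (simp add: algebra_simps)
    moreover have "M ?\<psi>s = ?s * M ?\<psi>" by (rule scale[OF C]) (use q in simp)
    moreover have "?B ?\<psi>s = ?s * ?B ?\<psi>" by (rule B_scale[OF C C]) (use q in simp)
    ultimately have "?s * M ?\<psi> \<le> ?s * ?B ?\<psi> + \<bar>C1\<bar> * R'" by simp
    then have "q * (?s * M ?\<psi>) \<le> q * (?s * ?B ?\<psi> + \<bar>C1\<bar> * R')" using q by (intro mult_left_mono) auto
    then show "M ?\<psi> \<le> ?B ?\<psi> + q * (\<bar>C1\<bar> * R')" using q by (simp add: distrib_left)
  qed
  show ?thesis
  proof (rule le_if_le_plus_multiple)
    fix \<epsilon> :: real assume \<epsilon>: "0 < \<epsilon>"
    let ?e = "\<lambda>t. \<epsilon> *\<^sub>R \<delta> t"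
    have C: "Ck_on {a..b} K \<phi>" "Ck_on {a..b} K ?e"
      by (rule Cinf_on_imp_Ck_on[OF \<phi>], rule Ck_on_scale[OF ab \<delta>])
    have "M \<phi> \<le> M (\<lambda>t. \<phi> t + ?e t) + M ?e" by (rule sub[OF C])
    moreover have "M (\<lambda>t. \<phi> t + ?e t) \<le> ?B \<phi> + ?B ?e"
      using rough[OF \<phi> \<epsilon>] B_add[OF C] by linarith
    \<comment> \<open>Taking f = 0 in \<open>rough\<close> bounds M on the perturbation alone, which
      is what the triangle inequality leaves over.\<close>
    moreover have Z: "Cinf_on {a..b} (\<lambda>_. 0 :: real ^ 'd)"
      by (simp add: Cinf_on_def Ck_on_const[OF ab])
    have "M ?e \<le> ?B ?e"
      using rough[OF Z \<epsilon>] by simp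
    moreover have "?B ?e = \<epsilon> * ?B \<delta>" by (rule B_scale[OF \<delta> \<delta> \<epsilon>])
    ultimately show "M \<phi> \<le> ?B \<phi> + \<epsilon> * (2 * ?B \<delta>)" by linarith
  qed
qed

subsection \<open>Multiplication by powers of the variable\<close>

text \<open>The Leibniz formula has just two terms for the factor x. At j = 0 the truncated order j
  - 1 is harmless because its coefficient is 0.\<close>

lemma hderiv_times_ident:
  fixes g :: "real \<Rightarrow> 'a::real_normed_vector"
  assumes "a < b" "Ck_on {a..b} k g" "j \<le> k" "x \<in> {a..b}"
  shows "hderiv {a..b} j (\<lambda>x. x *\<^sub>R g x) x = x *\<^sub>R hderiv {a..b} j g x + real j *\<^sub>R hderiv {a..b} (j - 1) g x"
proof -
  let ?G = "\<lambda>j x. x *\<^sub>R hderiv {a..b} j g x + real j *\<^sub>R hderiv {a..b} (j - 1) g x"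
  have "(?G j has_vector_derivative ?G (Suc j) x) (at x within {a..b})" if "j < k" "x \<in> {a..b}" for j x
  proof -
    have 1: "((\<lambda>x. x *\<^sub>R hderiv {a..b} j g x) has_vector_derivative
        x *\<^sub>R hderiv {a..b} (Suc j) g x + 1 *\<^sub>R hderiv {a..b} j g x) (at x within {a..b})"
      using Ck_onD(1)[OF assms(2) that] by (intro has_vector_derivative_scaleR) auto
    have 2: "((\<lambda>x. real j *\<^sub>R hderiv {a..b} (j - 1) g x) has_vector_derivative
        real j *\<^sub>R hderiv {a..b} j g x) (at x within {a..b})"
    proof (cases j)
      case (Suc i)
      then show ?thesis
        using Ck_onD(1)[OF assms(2), of i x] that
        by (intro bounded_linear.has_vector_derivative[OF bounded_linear_scaleR_right]) simp
    qed simp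
    have "?G (Suc j) x = x *\<^sub>R hderiv {a..b} (Suc j) g x + 1 *\<^sub>R hderiv {a..b} j g x + real j *\<^sub>R hderiv {a..b} j g x"
      by (simp add: algebra_simps)
    then show ?thesis using has_vector_derivative_add[OF 1 2] by (simp only:)
  qed
  from hderiv_eq_sequence[where G = ?G, OF assms(1) _ this assms(3,4)] show ?thesis by simp
qed

text \<open>Sums the two-term Leibniz formula over all orders; the index shift turns the weights j
  into at most K.\<close>

lemma sum_shifted_le:
  fixes \<alpha> :: "nat \<Rightarrow> real"
  assumes "\<And>j. 0 \<le> \<alpha> j" "N \<le> K"
  shows "(\<Sum>j\<le>N. \<alpha> j + real j * \<alpha> (j - 1)) \<le> real (Suc K) * (\<Sum>j\<le>N. \<alpha> j)"
proof -
  have "(\<Sum>j\<le>N. real j * \<alpha> (j - 1)) = (\<Sum>j<N. real (Suc j) * \<alpha> j)"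
    by (subst sum.atMost_shift) simp
  also have "\<dots> \<le> (\<Sum>j<N. real K * \<alpha> j)"
    using assms by (intro sum_mono mult_right_mono) auto
  also have "\<dots> \<le> (\<Sum>j\<le>N. real K * \<alpha> j)"
    using assms by (intro sum_mono2) auto
  finally show ?thesis
    by (simp add: sum.distrib algebra_simps flip: sum_distrib_left)
qed

lemma Ck_on_power_scaleR:
  assumes "a < b" "Ck_on {a..b} k g"
  shows "Ck_on {a..b} k (\<lambda>x. x ^ m *\<^sub>R g x)"
proof -
  have "poly (monom 1 m) = (\<lambda>x::real. x ^ m)" by (simp add: fun_eq_iff poly_monom)
  then show ?thesis
    using Ck_on_scaleR[OF assms(1) Cinf_on_imp_Ck_on[OF Cinf_on_poly[OF assms(1)]] assms(2), of "monom 1 m"]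
    by simp
qed

text \<open>The variational condition is tested with monomials. Their factors are split off one at a
  time, using |x| \<le> 1 and the two-term Leibniz formula, at the price of K + 1 per
  factor.\<close>

lemma pt_terms_power_scaleR:
  assumes g: "Ck_on {-1..1} K g" and tp: "tp ` {..Kp} \<subseteq> {-1..1}" and Kt: "\<And>m. m \<le> Kp \<Longrightarrow> Kt m \<le> K"
  shows "pt_terms (-1) 1 tp Kp Kt (\<lambda>x. x ^ m *\<^sub>R g x) \<le> real (Suc K) ^ m * pt_terms (-1) 1 tp Kp Kt g"
proof (induction m)
  case (Suc m)
  let ?g = "\<lambda>x. x ^ m *\<^sub>R g x"
  have lt: "(-1::real) < 1" by simp
  have C: "Ck_on {-1..1} K ?g" by (rule Ck_on_power_scaleR[OF lt g])
  have T: "Tmap (-1) 1 x = x" for x by (simp add: Tmap_def)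
  have "pt_terms (-1) 1 tp Kp Kt (\<lambda>x. x *\<^sub>R ?g x) \<le> real (Suc K) * pt_terms (-1) 1 tp Kp Kt ?g"
    unfolding pt_terms_def T sum_distrib_left[of "real (Suc K)"]
  proof (rule sum_mono)
    fix i assume "i \<in> {..Kp}"
    then have i: "tp i \<in> {-1..1}" "Kt i \<le> K" using tp Kt by auto
    have "((1 - - 1) / 2) ^ j * norm (hderiv {-1..1} j (\<lambda>x. x *\<^sub>R ?g x) (tp i))
       \<le> norm (hderiv {-1..1} j ?g (tp i)) + real j * norm (hderiv {-1..1} (j - 1) ?g (tp i))"
      if "j \<in> {..Kt i}" for j
    proof -
      have "norm (hderiv {-1..1} j (\<lambda>x. x *\<^sub>R ?g x) (tp i))
        \<le> \<bar>tp i\<bar> * norm (hderiv {-1..1} j ?g (tp i)) + real j * norm (hderiv {-1..1} (j - 1) ?g (tp i))"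
        using that i by (subst hderiv_times_ident[OF lt C]) (auto intro: norm_triangle_le)
      also have "\<bar>tp i\<bar> * norm (hderiv {-1..1} j ?g (tp i)) \<le> norm (hderiv {-1..1} j ?g (tp i))"
        using i(1) by (intro mult_left_le_one_le) (auto simp: abs_le_iff)
      finally show ?thesis by simp
    qed
    then have "(\<Sum>j\<le>Kt i. ((1 - - 1) / 2) ^ j * norm (hderiv {-1..1} j (\<lambda>x. x *\<^sub>R ?g x) (tp i)))
       \<le> (\<Sum>j\<le>Kt i. norm (hderiv {-1..1} j ?g (tp i)) + real j * norm (hderiv {-1..1} (j - 1) ?g (tp i)))"
      by (rule sum_mono)
    also have "\<dots> \<le> real (Suc K) * (\<Sum>j\<le>Kt i. norm (hderiv {-1..1} j ?g (tp i)))"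
      by (rule sum_shifted_le) (use i in auto)
    finally show "(\<Sum>j\<le>Kt i. ((1 - - 1) / 2) ^ j * norm (hderiv {-1..1} j (\<lambda>x. x *\<^sub>R ?g x) (tp i)))
        \<le> (\<Sum>j\<le>Kt i. real (Suc K) * (((1 - - 1) / 2) ^ j * norm (hderiv {-1..1} j ?g (tp i))))"
      by (simp add: sum_distrib_left)
  qed
  also have "\<dots> \<le> real (Suc K) * (real (Suc K) ^ m * pt_terms (-1) 1 tp Kp Kt g)"
    by (intro mult_left_mono Suc.IH) simp
  finally show ?case by (simp only: power_Suc scaleR_scaleR mult.assoc)
qed simp

lemma sum_supn_power_scaleR:
  assumes g: "Ck_on {-1..1} K g"
  shows "(\<Sum>j\<le>K. supn {-1..1} (hderiv {-1..1} j (\<lambda>x. x ^ m *\<^sub>R g x)))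
       \<le> real (Suc K) ^ m * (\<Sum>j\<le>K. supn {-1..1} (hderiv {-1..1} j g))"
proof (induction m)
  case (Suc m)
  let ?g = "\<lambda>x. x ^ m *\<^sub>R g x"
  let ?\<alpha> = "\<lambda>j. if j \<le> K then supn {-1..1} (hderiv {-1..1} j ?g) else 0"
  have lt: "(-1::real) < 1" by simp
  have C: "Ck_on {-1..1} K ?g" by (rule Ck_on_power_scaleR[OF lt g])
  have n: "norm (hderiv {-1..1} j ?g x) \<le> ?\<alpha> j" if "j \<le> K" "x \<in> {-1..1}" for j x
    using norm_le_supn_Icc[OF lt Ck_onD(2)[OF C that(1)] that(2)] that by simp
  have "supn {-1..1} (hderiv {-1..1} j (\<lambda>x. x *\<^sub>R ?g x)) \<le> ?\<alpha> j + real j * ?\<alpha> (j - 1)" if j: "j \<le> K" for j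
  proof (rule supn_le_Icc[OF lt])
    fix x :: real assume x: "x \<in> {-1..1}"
    have "norm (hderiv {-1..1} j (\<lambda>x. x *\<^sub>R ?g x) x)
        \<le> \<bar>x\<bar> * norm (hderiv {-1..1} j ?g x) + real j * norm (hderiv {-1..1} (j - 1) ?g x)"
      using j x by (subst hderiv_times_ident[OF lt C]) (auto intro: norm_triangle_le)
    also have "\<bar>x\<bar> * norm (hderiv {-1..1} j ?g x) \<le> norm (hderiv {-1..1} j ?g x)"
      using x by (intro mult_left_le_one_le) (auto simp: abs_le_iff)
    also have "norm (hderiv {-1..1} j ?g x) \<le> ?\<alpha> j" by (rule n[OF j x])
    also have "norm (hderiv {-1..1} (j - 1) ?g x) \<le> ?\<alpha> (j - 1)" by (rule n[OF _ x]) (use j in simp)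
    finally show "norm (hderiv {-1..1} j (\<lambda>x. x *\<^sub>R ?g x) x) \<le> ?\<alpha> j + real j * ?\<alpha> (j - 1)"
      by (simp add: mult_left_mono)
  qed
  then have "(\<Sum>j\<le>K. supn {-1..1} (hderiv {-1..1} j (\<lambda>x. x *\<^sub>R ?g x))) \<le> (\<Sum>j\<le>K. ?\<alpha> j + real j * ?\<alpha> (j - 1))"
    by (intro sum_mono) simp
  also have "\<dots> \<le> real (Suc K) * (\<Sum>j\<le>K. ?\<alpha> j)"
  proof (rule sum_shifted_le)
    show "0 \<le> ?\<alpha> j" for j using order_trans[OF norm_ge_zero n[of j 0]] by (cases "j \<le> K") simp_all
  qed simp
  also have "(\<Sum>j\<le>K. ?\<alpha> j) = (\<Sum>j\<le>K. supn {-1..1} (hderiv {-1..1} j ?g))" by (intro sum.cong) auto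
  also have "real (Suc K) * \<dots> \<le> real (Suc K) * (real (Suc K) ^ m * (\<Sum>j\<le>K. supn {-1..1} (hderiv {-1..1} j g)))"
    by (intro mult_left_mono Suc.IH) simp
  finally show ?case by (simp only: power_Suc scaleR_scaleR mult.assoc)
qed simp

text \<open>The weights in \<open>pt_terms\<close> are exactly the chain rule factors of
  \<open>Tmap\<close>; on the reference interval they are 1.\<close>

lemma pt_terms_Tmap:
  assumes "a < b" "Ck_on {a..b} K \<phi>" "tp ` {..Kp} \<subseteq> {-1..1}" "\<And>m. m \<le> Kp \<Longrightarrow> Kt m \<le> K"
  shows "pt_terms (-1) 1 tp Kp Kt (\<lambda>x. \<phi> (Tmap a b x)) = pt_terms a b tp Kp Kt \<phi>"
proof -
  have "norm (hderiv {-1..1} j (\<lambda>x. \<phi> (Tmap a b x)) (tp m)) = ((b - a) / 2) ^ j * norm (hderiv {a..b} j \<phi> (Tmap a b (tp m)))"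
    if "m \<le> Kp" "j \<le> Kt m" for m j
  proof -
    have "j \<le> K" "tp m \<in> {-1..1}" using that assms(3,4) order_trans by blast+
    from hderiv_Tmap[OF assms(1,2) this] show ?thesis using assms(1) by simp
  qed
  then show ?thesis unfolding pt_terms_def by (intro sum.cong) (auto simp: Tmap_def[of "-1"])
qed

subsection \<open>Componentwise functionals and operators\<close>

lemma Ck_on_vec_nth: "a < b \<Longrightarrow> Ck_on {a..b} k g \<Longrightarrow> Ck_on {a..b} k (\<lambda>t. g t $ i)"
  by (rule Ck_on_bounded_linear[OF bounded_linear_vec_nth])

lemma Ck_on_vecI:
  fixes g :: "real \<Rightarrow> real ^ 'd"
  assumes "a < b" "\<And>i. Ck_on {a..b} k (\<lambda>t. g t $ i)"
  shows "Ck_on {a..b} k g"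
proof -
  have "Ck_on {a..b} k (\<lambda>t. \<Sum>i\<in>UNIV. (g t $ i) *\<^sub>R (axis i 1 :: real ^ 'd))"
    by (intro Ck_on_sum[OF assms(1)] Ck_on_bounded_linear[OF bounded_linear_scaleR_left assms(1)] assms(2))
  moreover have "(\<Sum>i\<in>UNIV. (v $ i) *\<^sub>R (axis i 1 :: real ^ 'd)) = v" for v
    using basis_expansion[of v] by (simp add: scalar_mult_eq_scaleR)
  ultimately show ?thesis by (simp only:)
qed

lemma locFv_eq: "locFv Ih a b \<phi> = ((b - a) / 2) *\<^sub>R vecF Ih (\<lambda>x. \<phi> (Tmap a b x))"
  by (simp add: locFv_def vecF_def locF_def vec_eq_iff o_def)

context
  fixes Ih :: "(real \<Rightarrow> real) \<Rightarrow> real" and kI :: nat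
  assumes Ih_ok: "functional_ok Ih kI"
begin

lemmas Ih_linear = Ih_ok[unfolded functional_ok_def, THEN conjunct1, rule_format]
lemmas Ih_cong = Ih_ok[unfolded functional_ok_def, THEN conjunct2, rule_format]

lemma Ih_add: "Ck_on {-1..1} kI f \<Longrightarrow> Ck_on {-1..1} kI g \<Longrightarrow> Ih (\<lambda>t. f t + g t) = Ih f + Ih g"
  using Ih_linear[of f g 1 1] by simp

lemma Ih_scale: "Ck_on {-1..1} kI f \<Longrightarrow> Ih (\<lambda>t. c * f t) = c * Ih f"
  using Ih_linear[of f f c 0] by simp

lemma vecF_add:
  assumes "Ck_on {-1..1} kI f" "Ck_on {-1..1} kI g"
  shows "vecF Ih (\<lambda>t. f t + g t) = vecF Ih f + vecF Ih g"
  using Ih_add[OF Ck_on_vec_nth[OF _ assms(1)] Ck_on_vec_nth[OF _ assms(2)]]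
  by (simp add: vecF_def vec_eq_iff)

lemma vecF_scale:
  assumes "Ck_on {-1..1} kI f"
  shows "vecF Ih (\<lambda>t. c *\<^sub>R f t) = c *\<^sub>R vecF Ih f"
  using Ih_scale[OF Ck_on_vec_nth[OF _ assms]] by (simp add: vecF_def vec_eq_iff)

lemma vecF_diff:
  assumes "Ck_on {-1..1} kI f" "Ck_on {-1..1} kI g"
  shows "vecF Ih (\<lambda>t. f t - g t) = vecF Ih f - vecF Ih g"
  using vecF_add[OF assms(1) Ck_on_scale[OF _ assms(2)], of "-1"] vecF_scale[OF assms(2), of "-1"] by simp

lemma vecF_cong:
  assumes "Ck_on {-1..1} kI f" "Ck_on {-1..1} kI g" "\<And>t. t \<in> {-1..1} \<Longrightarrow> f t = g t"
  shows "vecF Ih f = vecF Ih g"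
  using Ih_cong[OF Ck_on_vec_nth[OF _ assms(1)] Ck_on_vec_nth[OF _ assms(2)]] assms(3)
  by (simp add: vecF_def vec_eq_iff)

end

context
  fixes Ic :: "(real \<Rightarrow> real) \<Rightarrow> (real \<Rightarrow> real)" and kc :: nat
  assumes Ic_ok: "operator_ok Ic kc"
begin

lemma Ck_on_locOp:
  assumes "a < b" "Ck_on {a..b} (max kc l) w"
  shows "Ck_on {a..b} l (locOp Ic a b w)"
proof (rule Ck_on_vecI[OF assms(1)])
  fix i
  have "Ck_on {-1..1} (max kc l) (\<lambda>x. w (Tmap a b x) $ i)"
    by (rule Ck_on_vec_nth[OF _ Ck_on_Tmap[OF assms]]) simp
  then have "Ck_on {-1..1} l (Ic (\<lambda>x. w (Tmap a b x) $ i))"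
    using Ic_ok by (simp add: operator_ok_def)
  then show "Ck_on {a..b} l (\<lambda>t. locOp Ic a b w t $ i)"
    using Ck_on_Tinv[OF assms(1)] by (simp add: locOp_def)
qed

lemma Cinf_on_locOp: "a < b \<Longrightarrow> Cinf_on {a..b} w \<Longrightarrow> Cinf_on {a..b} (locOp Ic a b w)"
  unfolding Cinf_on_def by (intro allI Ck_on_locOp) auto

lemma locOp_linear:
  assumes "a < b" "Ck_on {a..b} kc v" "Ck_on {a..b} kc w" "t \<in> {a..b}"
  shows "locOp Ic a b (\<lambda>t. \<alpha> *\<^sub>R v t + \<beta> *\<^sub>R w t) t = \<alpha> *\<^sub>R locOp Ic a b v t + \<beta> *\<^sub>R locOp Ic a b w t"
proof -
  have "Ck_on {-1..1} kc (\<lambda>x. v (Tmap a b x) $ i)" "Ck_on {-1..1} kc (\<lambda>x. w (Tmap a b x) $ i)" for i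
    by (rule Ck_on_vec_nth[OF _ Ck_on_Tmap[OF assms(1)]]; simp add: assms)+
  then show ?thesis
    using Ic_ok Tinv_in[OF assms(1,4)] by (simp add: locOp_def vec_eq_iff operator_ok_def)
qed

lemma locOp_add: "a < b \<Longrightarrow> Ck_on {a..b} kc v \<Longrightarrow> Ck_on {a..b} kc w \<Longrightarrow> t \<in> {a..b} \<Longrightarrow>
    locOp Ic a b (\<lambda>t. v t + w t) t = locOp Ic a b v t + locOp Ic a b w t"
  using locOp_linear[of a b v w t 1 1] by simp

lemma locOp_diff: "a < b \<Longrightarrow> Ck_on {a..b} kc v \<Longrightarrow> Ck_on {a..b} kc w \<Longrightarrow> t \<in> {a..b} \<Longrightarrow>
    locOp Ic a b (\<lambda>t. v t - w t) t = locOp Ic a b v t - locOp Ic a b w t"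
  using locOp_linear[of a b v w t 1 "-1"] by simp

lemma locOp_scale: "a < b \<Longrightarrow> Ck_on {a..b} kc v \<Longrightarrow> t \<in> {a..b} \<Longrightarrow>
    locOp Ic a b (\<lambda>t. c *\<^sub>R v t) t = c *\<^sub>R locOp Ic a b v t"
  using locOp_linear[of a b v v t c 0] by simp

lemma locOp_cong:
  assumes "a < b" "Ck_on {a..b} kc v" "Ck_on {a..b} kc w" "\<And>t. t \<in> {a..b} \<Longrightarrow> v t = w t" "t \<in> {a..b}"
  shows "locOp Ic a b v t = locOp Ic a b w t"
proof -
  have "Ck_on {-1..1} kc (\<lambda>x. v (Tmap a b x) $ i)" "Ck_on {-1..1} kc (\<lambda>x. w (Tmap a b x) $ i)" for i
    by (rule Ck_on_vec_nth[OF _ Ck_on_Tmap[OF assms(1)]]; simp add: assms)+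
  then show ?thesis
    using Ic_ok Tinv_in[OF assms(1,5)] assms(4) Tmap_in[OF assms(1)]
    by (simp add: locOp_def vec_eq_iff operator_ok_def)
qed

end

section \<open>Moments of the discretised right-hand side under (A5a) or (A5b)\<close>

text \<open>(A2) reduces the moment to derivatives up to order kI on [-1,1]; the monomial is split
  off, and scaling back yields precisely the quantities bounded by (A5a). The orders of the point
  derivatives are cut at \<open>max kI kc\<close> so that (A4) can treat them later.\<close>

lemma quadrature_bound_a:
  assumes Ic_ok: "operator_ok Ic kc"
    and A2: "A2 Ih kI TYPE('d::finite)"
    and A5: "A5a Ic kI kc t0 T tI KI KtI TYPE('d)"
  shows "\<exists>C\<ge>0. \<forall>a b (w :: real \<Rightarrow> real ^ 'd) m. admissible_interval t0 T a b \<longrightarrow> Cinf_on {a..b} w \<longrightarrow> m \<le> r \<longrightarrow>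
    norm (vecF Ih (\<lambda>x. x ^ m *\<^sub>R locOp Ic a b w (Tmap a b x)))
      \<le> C * (pt_terms a b tI KI (\<lambda>m. min (KtI m) (max kI kc)) w + supn {a<..b} w)"
proof -
  obtain C11 C12 where C1: "\<And>a b (\<phi> :: real \<Rightarrow> real ^ 'd) l. admissible_interval t0 T a b \<Longrightarrow> Ck_on {a..b} kc \<phi> \<Longrightarrow> l \<le> kI \<Longrightarrow>
      ((b - a) / 2) ^ l * supn {a<..b} (hderiv {a..b} l (locOp Ic a b \<phi>))
           \<le> C11 * pt_terms a b tI KI KtI \<phi> + C12 * supn {a<..b} \<phi>"
    and pts: "tI ` {..KI} \<subseteq> {-1..1}"
    using A5 unfolding A5a_def distinct_pts_def by metis
  obtain C0 where C0: "\<And>\<phi> :: real \<Rightarrow> real ^ 'd. Ck_on {-1..1} kI \<phi> \<Longrightarrow>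
       norm (vecF Ih \<phi>) \<le> C0 * (\<Sum>j\<le>kI. supn {-1..1} (hderiv {-1..1} j \<phi>))"
    using A2 unfolding A2_def by blast
  let ?K = "max kI kc"
  let ?C = "\<bar>C0\<bar> * (real (Suc kI) ^ r * (real (Suc kI) * (\<bar>C11\<bar> + \<bar>C12\<bar>)))"
  have "norm (vecF Ih (\<lambda>x. x ^ m *\<^sub>R locOp Ic a b w (Tmap a b x)))
      \<le> ?C * (pt_terms a b tI KI (\<lambda>m. min (KtI m) ?K) w + supn {a<..b} w)"
    if adm: "admissible_interval t0 T a b" and w: "Cinf_on {a..b} w" and m: "m \<le> r"
    for a b m and w :: "real \<Rightarrow> real ^ 'd"
  proof -
    have ab: "a < b" using adm by (simp add: admissible_interval_def)
    have lt: "(-1::real) < 1" by simp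
    let ?pt = "pt_terms a b tI KI (\<lambda>m. min (KtI m) ?K) w" and ?s = "supn {a<..b} w"
    let ?g = "locOp Ic a b w" and ?h = "(b - a) / 2"
    have pt0: "0 \<le> ?pt" by (rule pt_terms_nonneg[OF ab])
    have s0: "0 \<le> ?s" by (rule supn_nonneg[OF ab Ck_on_continuous_on[OF Cinf_on_imp_Ck_on[OF w]]])
    have Cg: "Cinf_on {a..b} ?g" by (rule Cinf_on_locOp[OF Ic_ok ab w])
    have B: "?h ^ l * supn {a<..b} (hderiv {a..b} l ?g) \<le> (\<bar>C11\<bar> + \<bar>C12\<bar>) * (?pt + ?s)" if l: "l \<le> kI" for l
    proof -
      \<comment> \<open>For f of class C^(max kI kc) the image under the operator has genuine
        derivatives up to order l \<le> kI, so \<open>?M\<close> is a seminorm there.\<close>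
      let ?M = "\<lambda>f. ?h ^ l * supn {a<..b} (hderiv {a..b} l (locOp Ic a b f))"
      have "?M w \<le> \<bar>C11\<bar> * ?pt + \<bar>C12\<bar> * ?s"
      proof (rule truncated_estimate[where M = ?M, OF ab pts _ _ _ w])
        fix f g :: "real \<Rightarrow> real ^ 'd" and s :: real
        assume f: "Ck_on {a..b} ?K f"
        have fc: "Ck_on {a..b} kc f" by (rule Ck_on_mono[OF f]) simp
        have Lf: "Ck_on {a..b} l (locOp Ic a b f)"
          by (rule Ck_on_locOp[OF Ic_ok ab Ck_on_mono[OF f]]) (use l in auto)
        note cf = Ck_onD(2)[OF Lf le_refl]
        show "?M f \<le> C11 * pt_terms a b tI KI KtI f + C12 * supn {a<..b} f"
          by (rule C1[OF adm fc l])
        {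
          assume s: "0 < s"
          have "hderiv {a..b} l (locOp Ic a b (\<lambda>t. s *\<^sub>R f t)) x = s *\<^sub>R hderiv {a..b} l (locOp Ic a b f) x"
            if x: "x \<in> {a..b}" for x
            using hderiv_cong[OF locOp_scale[OF Ic_ok ab fc, where c = s] x, where j = l] hderiv_scale[OF ab Lf le_refl x, of s] by simp
          then have "supn {a<..b} (hderiv {a..b} l (locOp Ic a b (\<lambda>t. s *\<^sub>R f t)))
              = supn {a<..b} (\<lambda>x. s *\<^sub>R hderiv {a..b} l (locOp Ic a b f) x)"
            unfolding supn_def by (intro arg_cong[where f = Sup] image_cong) auto
          then show "?M (\<lambda>t. s *\<^sub>R f t) = s * ?M f"
            using supn_scale[OF ab cf s] by simp
        }
        assume g: "Ck_on {a..b} ?K g"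
        have gc: "Ck_on {a..b} kc g" by (rule Ck_on_mono[OF g]) simp
        have Lg: "Ck_on {a..b} l (locOp Ic a b g)"
          by (rule Ck_on_locOp[OF Ic_ok ab Ck_on_mono[OF g]]) (use l in auto)
        have Lfg: "Ck_on {a..b} l (locOp Ic a b (\<lambda>t. f t + g t))"
          by (rule Ck_on_locOp[OF Ic_ok ab Ck_on_mono[OF Ck_on_add[OF ab f g]]]) (use l in auto)
        have "supn {a<..b} (hderiv {a..b} l (locOp Ic a b f))
            \<le> supn {a<..b} (hderiv {a..b} l (locOp Ic a b (\<lambda>t. f t + g t))) + supn {a<..b} (hderiv {a..b} l (locOp Ic a b g))"
        proof (rule supn_le_Ioc[OF ab])
          fix x assume x: "x \<in> {a..b}"
          have "hderiv {a..b} l (locOp Ic a b f) x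
            = hderiv {a..b} l (locOp Ic a b (\<lambda>t. f t + g t)) x - hderiv {a..b} l (locOp Ic a b g) x"
            using hderiv_cong[OF locOp_add[OF Ic_ok ab fc gc] x, where j = l] hderiv_add[OF ab Lf Lg le_refl x] by simp
          then show "norm (hderiv {a..b} l (locOp Ic a b f) x)
            \<le> supn {a<..b} (hderiv {a..b} l (locOp Ic a b (\<lambda>t. f t + g t))) + supn {a<..b} (hderiv {a..b} l (locOp Ic a b g))"
            using norm_le_supn[OF ab Ck_onD(2)[OF Lfg le_refl] x] norm_le_supn[OF ab Ck_onD(2)[OF Lg le_refl] x]
            by (simp only:) (intro norm_triangle_le_diff add_mono)
        qed
        from mult_left_mono[OF this, of "?h ^ l"]
        show "?M f \<le> ?M (\<lambda>t. f t + g t) + ?M g" using ab by (simp add: distrib_left)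
      qed
      also have "\<dots> \<le> (\<bar>C11\<bar> + \<bar>C12\<bar>) * (?pt + ?s)"
        using pt0 s0 by (simp add: algebra_simps)
      finally show ?thesis .
    qed
    let ?G = "\<lambda>x. ?g (Tmap a b x)"
    have CG: "Ck_on {-1..1} kI ?G" by (rule Ck_on_Tmap[OF ab Cinf_on_imp_Ck_on[OF Cg]])
    have C\<phi>: "Ck_on {-1..1} kI (\<lambda>x. x ^ m *\<^sub>R ?G x)" by (rule Ck_on_power_scaleR[OF lt CG])
    have S: "supn {-1..1} (hderiv {-1..1} j ?G) \<le> (\<bar>C11\<bar> + \<bar>C12\<bar>) * (?pt + ?s)" if j: "j \<le> kI" for j
    proof -
      have "supn {-1..1} (hderiv {-1..1} j ?G) \<le> ?h ^ j * supn {a<..b} (hderiv {a..b} j ?g)"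
      proof (rule supn_le_Icc[OF lt])
        fix x :: real assume x: "x \<in> {-1..1}"
        show "norm (hderiv {-1..1} j ?G x) \<le> ?h ^ j * supn {a<..b} (hderiv {a..b} j ?g)"
          using norm_le_supn[OF ab Ck_onD(2)[OF Cinf_on_imp_Ck_on[OF Cg] le_refl] Tmap_in[OF ab x]] ab
          by (simp add: hderiv_Tmap[OF ab Cinf_on_imp_Ck_on[OF Cg] le_refl x] mult_left_mono)
      qed
      with B[OF j] show ?thesis by linarith
    qed
    have sup0: "0 \<le> supn {-1..1} (hderiv {-1..1} j f)" if "Ck_on {-1..1} kI f" "j \<le> kI" for j and f :: "real \<Rightarrow> real ^ 'd"
      using order_trans[OF norm_ge_zero norm_le_supn_Icc[OF lt Ck_onD(2)[OF that], of 0]] by simp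
    have "norm (vecF Ih (\<lambda>x. x ^ m *\<^sub>R ?G x))
        \<le> C0 * (\<Sum>j\<le>kI. supn {-1..1} (hderiv {-1..1} j (\<lambda>x. x ^ m *\<^sub>R ?G x)))" by (rule C0[OF C\<phi>])
    also have "\<dots> \<le> \<bar>C0\<bar> * (\<Sum>j\<le>kI. supn {-1..1} (hderiv {-1..1} j (\<lambda>x. x ^ m *\<^sub>R ?G x)))"
      by (intro mult_right_mono sum_nonneg sup0[OF C\<phi>]) auto
    also have "\<dots> \<le> \<bar>C0\<bar> * (real (Suc kI) ^ m * (\<Sum>j\<le>kI. supn {-1..1} (hderiv {-1..1} j ?G)))"
      by (intro mult_left_mono sum_supn_power_scaleR[OF CG]) auto
    also have "\<dots> \<le> \<bar>C0\<bar> * (real (Suc kI) ^ r * (\<Sum>j\<le>kI. supn {-1..1} (hderiv {-1..1} j ?G)))"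
      by (intro mult_left_mono mult_right_mono power_increasing m sum_nonneg sup0[OF CG]) auto
    also have "\<dots> \<le> \<bar>C0\<bar> * (real (Suc kI) ^ r * (\<Sum>j\<le>kI. (\<bar>C11\<bar> + \<bar>C12\<bar>) * (?pt + ?s)))"
      by (intro mult_left_mono sum_mono S) auto
    also have "\<dots> = ?C * (?pt + ?s)" by simp
    finally show ?thesis .
  qed
  then show ?thesis by (intro exI[of _ ?C]) auto
qed

text \<open>Here truncation is applied twice: to the bound for the operator, at order
  \<open>max kI kc\<close>, and to the bound for the functional, at order kI.\<close>

lemma quadrature_bound_b:
  assumes Ih_ok: "functional_ok Ih kI" and Ic_ok: "operator_ok Ic kc"
    and A5: "A5b Ih Ic kI kc t0 T tI KI KtI TYPE('d::finite)"
  shows "\<exists>C\<ge>0. \<forall>a b (w :: real \<Rightarrow> real ^ 'd) m. admissible_interval t0 T a b \<longrightarrow> Cinf_on {a..b} w \<longrightarrow> m \<le> r \<longrightarrow>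
    norm (vecF Ih (\<lambda>x. x ^ m *\<^sub>R locOp Ic a b w (Tmap a b x)))
      \<le> C * (pt_terms a b tI KI (\<lambda>m. min (KtI m) (max kI kc)) w + supn {a<..b} w)"
proof -
  have pts: "tI ` {..KI} \<subseteq> {-1..1}" using A5 by (simp add: A5b_def distinct_pts_def)
  obtain tS KS KtS C01 C02 C11 C12 where tS: "distinct_pts tS KS"
    and est: "\<forall>a b. admissible_interval t0 T a b \<longrightarrow>
        (\<forall>\<phi> :: real \<Rightarrow> real ^ 'd. Ck_on {a..b} kI \<phi> \<longrightarrow>
           norm (locFv Ih a b \<phi>)
             \<le> C01 * ((b - a) / 2) * pt_terms a b tS KS KtS \<phi>
               + C02 * ((b - a) / 2) * supn {a<..b} \<phi>) \<and>
        (\<forall>\<phi> :: real \<Rightarrow> real ^ 'd. Ck_on {a..b} (max kI kc) \<phi> \<longrightarrow>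
           pt_terms a b tS KS KtS (locOp Ic a b \<phi>) + supn {a<..b} (locOp Ic a b \<phi>)
             \<le> C11 * pt_terms a b tI KI KtI \<phi> + C12 * supn {a<..b} \<phi>)"
    using A5 unfolding A5b_def by (elim conjE exE) (rule that)
  note C0 = est[rule_format, THEN conjunct1, rule_format]
    and C1 = est[rule_format, THEN conjunct2, rule_format]
  have tS: "tS ` {..KS} \<subseteq> {-1..1}" using tS by (simp add: distinct_pts_def)
  \<comment> \<open>For f of class C^(max kI kc) the image under the operator is only known to be
    C^kI. Point terms of higher order could be junk, and the sum would no longer be a seminorm in
    f.\<close>
  let ?K = "max kI kc" and ?KtS = "\<lambda>m. min (KtS m) kI"
  let ?C = "(\<bar>C01\<bar> * real (Suc kI) ^ r + \<bar>C02\<bar>) * (\<bar>C11\<bar> + \<bar>C12\<bar>)"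
  have "norm (vecF Ih (\<lambda>x. x ^ m *\<^sub>R locOp Ic a b w (Tmap a b x)))
      \<le> ?C * (pt_terms a b tI KI (\<lambda>m. min (KtI m) ?K) w + supn {a<..b} w)"
    if adm: "admissible_interval t0 T a b" and w: "Cinf_on {a..b} w" and m: "m \<le> r"
    for a b m and w :: "real \<Rightarrow> real ^ 'd"
  proof -
    have ab: "a < b" using adm by (simp add: admissible_interval_def)
    have lt: "(-1::real) < 1" by simp
    let ?pt = "pt_terms a b tI KI (\<lambda>m. min (KtI m) ?K) w" and ?s = "supn {a<..b} w"
    let ?g = "locOp Ic a b w" and ?h = "(b - a) / 2"
    let ?ptS = "pt_terms a b tS KS ?KtS"
    have h: "?h > 0" using ab by simp
    have pt0: "0 \<le> ?pt" by (rule pt_terms_nonneg[OF ab])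
    have s0: "0 \<le> ?s" by (rule supn_nonneg[OF ab Ck_on_continuous_on[OF Cinf_on_imp_Ck_on[OF w]]])
    have Cg: "Cinf_on {a..b} ?g" by (rule Cinf_on_locOp[OF Ic_ok ab w])
    have B: "?ptS ?g + supn {a<..b} ?g \<le> (\<bar>C11\<bar> + \<bar>C12\<bar>) * (?pt + ?s)"
    proof -
      let ?M = "\<lambda>f. ?ptS (locOp Ic a b f) + supn {a<..b} (locOp Ic a b f)"
      have cong: "?ptS f = ?ptS f'" "supn {a<..b} f = supn {a<..b} f'"
        if "\<And>x. x \<in> {a..b} \<Longrightarrow> f x = f' x" for f f' :: "real \<Rightarrow> real ^ 'd"
      proof -
        have "hderiv {a..b} j f (Tmap a b (tS i)) = hderiv {a..b} j f' (Tmap a b (tS i))" if i: "i \<le> KS" for i j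
        proof (rule hderiv_cong)
          show "Tmap a b (tS i) \<in> {a..b}" using Tmap_in[OF ab] i tS by blast
        qed fact
        then show "?ptS f = ?ptS f'" unfolding pt_terms_def by (intro sum.cong) auto
        show "supn {a<..b} f = supn {a<..b} f'"
          unfolding supn_def using that by (intro arg_cong[where f = Sup] image_cong) auto
      qed
      have "?M w \<le> \<bar>C11\<bar> * ?pt + \<bar>C12\<bar> * ?s"
      proof (rule truncated_estimate[where M = ?M, OF ab pts _ _ _ w])
        fix f g :: "real \<Rightarrow> real ^ 'd" and s :: real
        assume f: "Ck_on {a..b} ?K f"
        have fc: "Ck_on {a..b} kc f" by (rule Ck_on_mono[OF f]) simp
        have Lf: "Ck_on {a..b} kI (locOp Ic a b f)"
          by (rule Ck_on_locOp[OF Ic_ok ab Ck_on_mono[OF f]]) auto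
        have "?ptS (locOp Ic a b f) \<le> pt_terms a b tS KS KtS (locOp Ic a b f)"
          unfolding pt_terms_def using ab by (intro sum_mono sum_mono2) auto
        then show "?M f \<le> C11 * pt_terms a b tI KI KtI f + C12 * supn {a<..b} f"
          using C1[OF adm f] by linarith
        {
          assume s: "0 < s"
          have "?ptS (locOp Ic a b (\<lambda>t. s *\<^sub>R f t)) = s * ?ptS (locOp Ic a b f)"
            using cong(1)[OF locOp_scale[OF Ic_ok ab fc, where c = s]] pt_terms_scale[OF ab tS _ Lf Lf, of ?KtS s] s by simp
          moreover have "supn {a<..b} (locOp Ic a b (\<lambda>t. s *\<^sub>R f t)) = s * supn {a<..b} (locOp Ic a b f)"
            using cong(2)[OF locOp_scale[OF Ic_ok ab fc, where c = s]] supn_scale[OF ab Ck_on_continuous_on[OF Lf] s] by simp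
          ultimately show "?M (\<lambda>t. s *\<^sub>R f t) = s * ?M f" by (simp add: distrib_left)
        }
        assume g: "Ck_on {a..b} ?K g"
        let ?fg = "\<lambda>t. f t + g t"
        have gc: "Ck_on {a..b} kc g" by (rule Ck_on_mono[OF g]) simp
        have Lg: "Ck_on {a..b} kI (locOp Ic a b g)"
          by (rule Ck_on_locOp[OF Ic_ok ab Ck_on_mono[OF g]]) auto
        have Lfg: "Ck_on {a..b} kI (locOp Ic a b ?fg)"
          by (rule Ck_on_locOp[OF Ic_ok ab Ck_on_mono[OF Ck_on_add[OF ab f g]]]) auto
        have Lm: "Ck_on {a..b} kI (\<lambda>t. (-1) *\<^sub>R locOp Ic a b g t)" by (rule Ck_on_scale[OF ab Lg])
        have eq: "locOp Ic a b f x = locOp Ic a b ?fg x + (-1) *\<^sub>R locOp Ic a b g x" if "x \<in> {a..b}" for x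
          using locOp_add[OF Ic_ok ab fc gc that] by simp
        have "?ptS (locOp Ic a b f) \<le> ?ptS (locOp Ic a b ?fg) + ?ptS (locOp Ic a b g)"
          using pt_terms_add[OF ab tS _ Lfg Lm, of ?KtS] pt_terms_scale[OF ab tS _ Lg Lg, of ?KtS "-1"] cong(1)[OF eq] by simp
        moreover have "supn {a<..b} (locOp Ic a b f) \<le> supn {a<..b} (locOp Ic a b ?fg) + supn {a<..b} (locOp Ic a b g)"
          using supn_add[OF ab Ck_on_continuous_on[OF Lfg] Ck_on_continuous_on[OF Lm]] cong(2)[OF eq]
          by (simp add: supn_def)
        ultimately show "?M f \<le> ?M ?fg + ?M g" by simp
      qed
      also have "\<dots> \<le> (\<bar>C11\<bar> + \<bar>C12\<bar>) * (?pt + ?s)"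
        using pt0 s0 by (simp add: algebra_simps)
      finally show ?thesis .
    qed
    \<comment> \<open>The monomial weight has to be written on [a,b], where (A5b) bounds the
      functional; it is at most 1 in absolute value.\<close>
    let ?\<phi> = "\<lambda>t. Tinv a b t ^ m *\<^sub>R ?g t"
    let ?G = "\<lambda>x. ?g (Tmap a b x)"
    have Tinv: "Ck_on {a..b} k (\<lambda>t. Tinv a b t ^ m)" for k
      using Ck_on_Tinv[OF ab Cinf_on_imp_Ck_on[OF Cinf_on_poly[OF lt]], of k "monom 1 m"] by (simp add: poly_monom)
    have C\<phi>: "Cinf_on {a..b} ?\<phi>"
      unfolding Cinf_on_def by (intro allI Ck_on_scaleR[OF ab Tinv] Cinf_on_imp_Ck_on[OF Cg])
    have CG: "Ck_on {-1..1} k ?G" for k by (rule Ck_on_Tmap[OF ab Cinf_on_imp_Ck_on[OF Cg]])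
    have L: "norm (locFv Ih a b ?\<phi>) \<le> \<bar>C01 * ?h\<bar> * ?ptS ?\<phi> + \<bar>C02 * ?h\<bar> * supn {a<..b} ?\<phi>"
    proof (rule truncated_estimate[where M = "\<lambda>f. norm (locFv Ih a b f)", OF ab tS _ _ _ C\<phi>])
      fix f g :: "real \<Rightarrow> real ^ 'd" and s :: real
      assume f: "Ck_on {a..b} kI f"
      have Tf: "Ck_on {-1..1} kI (\<lambda>x. f (Tmap a b x))" by (rule Ck_on_Tmap[OF ab f])
      show "norm (locFv Ih a b f) \<le> C01 * ?h * pt_terms a b tS KS KtS f + C02 * ?h * supn {a<..b} f"
        by (rule C0[OF adm f])
      show "norm (locFv Ih a b (\<lambda>t. s *\<^sub>R f t)) = s * norm (locFv Ih a b f)" if "0 < s"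
        using that by (simp add: abs_mult locFv_eq vecF_scale[OF Ih_ok Tf])
      assume g: "Ck_on {a..b} kI g"
      have Tg: "Ck_on {-1..1} kI (\<lambda>x. g (Tmap a b x))" by (rule Ck_on_Tmap[OF ab g])
      have "locFv Ih a b f = locFv Ih a b (\<lambda>t. f t + g t) - locFv Ih a b g"
        by (simp add: locFv_eq vecF_add[OF Ih_ok Tf Tg] scaleR_add_right)
      then show "norm (locFv Ih a b f) \<le> norm (locFv Ih a b (\<lambda>t. f t + g t)) + norm (locFv Ih a b g)"
        by (simp add: norm_triangle_ineq4)
    qed
    have "?ptS ?\<phi> = pt_terms (-1) 1 tS KS ?KtS (\<lambda>x. ?\<phi> (Tmap a b x))"
      by (rule pt_terms_Tmap[OF ab Cinf_on_imp_Ck_on[OF C\<phi>, of kI] tS, symmetric]) simp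
    also have "\<dots> = pt_terms (-1) 1 tS KS ?KtS (\<lambda>x. x ^ m *\<^sub>R ?G x)" using ab by simp
    also have "\<dots> \<le> real (Suc kI) ^ m * pt_terms (-1) 1 tS KS ?KtS ?G"
      by (rule pt_terms_power_scaleR[OF CG tS]) simp
    also have "\<dots> \<le> real (Suc kI) ^ r * pt_terms (-1) 1 tS KS ?KtS ?G"
      by (intro mult_right_mono power_increasing m pt_terms_nonneg) auto
    also have "pt_terms (-1) 1 tS KS ?KtS ?G = ?ptS ?g"
      by (rule pt_terms_Tmap[OF ab Cinf_on_imp_Ck_on[OF Cg, of kI] tS]) simp
    finally have 1: "?ptS ?\<phi> \<le> real (Suc kI) ^ r * ?ptS ?g" .
    have 2: "supn {a<..b} ?\<phi> \<le> supn {a<..b} ?g"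
    proof (rule supn_le_Ioc[OF ab])
      fix t assume t: "t \<in> {a..b}"
      have "\<bar>Tinv a b t\<bar> ^ m \<le> 1" using Tinv_in[OF ab t] by (intro power_le_one) auto
      then have "norm (?\<phi> t) \<le> norm (?g t)"
        by (simp add: power_abs mult_left_le_one_le)
      also have "\<dots> \<le> supn {a<..b} ?g" by (rule norm_le_supn[OF ab Ck_on_continuous_on[OF Cinf_on_imp_Ck_on[OF Cg]] t])
      finally show "norm (?\<phi> t) \<le> supn {a<..b} ?g" .
    qed
    have g0: "0 \<le> ?ptS ?g" "0 \<le> supn {a<..b} ?g"
      by (rule pt_terms_nonneg[OF ab], rule supn_nonneg[OF ab Ck_on_continuous_on[OF Cinf_on_imp_Ck_on[OF Cg]]])
    have "?h * norm (vecF Ih (\<lambda>x. x ^ m *\<^sub>R ?G x)) = norm (locFv Ih a b ?\<phi>)"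
      using ab by (simp add: locFv_eq)
    also have "\<dots> \<le> ?h * (\<bar>C01\<bar> * ?ptS ?\<phi> + \<bar>C02\<bar> * supn {a<..b} ?\<phi>)"
      using L unfolding abs_mult abs_of_pos[OF h] by (simp only: distrib_left mult_ac)
    finally have "norm (vecF Ih (\<lambda>x. x ^ m *\<^sub>R ?G x)) \<le> \<bar>C01\<bar> * ?ptS ?\<phi> + \<bar>C02\<bar> * supn {a<..b} ?\<phi>"
      using h by (simp only: mult_le_cancel_left_pos)
    also have "\<dots> \<le> \<bar>C01\<bar> * (real (Suc kI) ^ r * ?ptS ?g) + \<bar>C02\<bar> * supn {a<..b} ?g"
      by (intro add_mono mult_left_mono 1 2) auto
    also have "\<dots> \<le> \<bar>C01\<bar> * (real (Suc kI) ^ r * (?ptS ?g + supn {a<..b} ?g)) + \<bar>C02\<bar> * (?ptS ?g + supn {a<..b} ?g)"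
      using g0 by (intro add_mono mult_left_mono) auto
    also have "\<dots> = (\<bar>C01\<bar> * real (Suc kI) ^ r + \<bar>C02\<bar>) * (?ptS ?g + supn {a<..b} ?g)"
      by (simp add: algebra_simps)
    also have "\<dots> \<le> (\<bar>C01\<bar> * real (Suc kI) ^ r + \<bar>C02\<bar>) * ((\<bar>C11\<bar> + \<bar>C12\<bar>) * (?pt + ?s))"
      by (intro mult_left_mono B) auto
    also have "\<dots> = ?C * (?pt + ?s)" by (simp only: mult.assoc)
    finally show ?thesis .
  qed
  then show ?thesis by (intro exI[of _ ?C]) auto
qed

subsection \<open>The functionals that determine one step of the scheme\<close>

text \<open>The bound (k + 1) div 2 is the number of conditions at the left end point and is correct
  for k = 0 as well, where there are none. At the right end point orders start at 1, because no
  value is prescribed. With the r - k + 1 moments the total is r + 1.\<close>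

definition J_index :: "nat \<Rightarrow> nat \<Rightarrow> (nat \<times> nat) set" where
  "J_index r k = {0} \<times> {..<(k + 1) div 2} \<union> {1} \<times> {1..k div 2} \<union> {2} \<times> {..r - k}"

text \<open>Indices \<open>(0, i)\<close> and \<open>(1, i)\<close> stand for the \<open>i\<close>-th derivative at the left and right end point,
  \<open>(2, m)\<close> for the variational condition tested with \<open>x ^ m\<close>.\<close>

definition J_functional :: "nat \<Rightarrow> ((real \<Rightarrow> real) \<Rightarrow> real) \<Rightarrow> nat \<times> nat \<Rightarrow> real poly \<Rightarrow> real" where
  "J_functional k Ih = (\<lambda>(c, i) P.
     if c = 0 then poly ((pderiv ^^ i) P) (-1)
     else if c = 1 then poly ((pderiv ^^ i) P) 1
     else Ih (\<lambda>x. x ^ i * poly (pderiv P) x) + (if k = 0 then poly P (-1) * (-1) ^ i else 0))"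

lemma finite_J_index: "finite (J_index r k)"
  by (simp add: J_index_def)

lemma card_J_index:
  assumes "k \<le> r"
  shows "card (J_index r k) = Suc r"
proof -
  have "card (J_index r k) = (k + 1) div 2 + k div 2 + Suc (r - k)"
    unfolding J_index_def by (subst card_Un_disjoint; auto simp: card_cartesian_product_singleton)+
  then show ?thesis using assms by presburger
qed

locale step_functionals =
  fixes r k kI :: nat and Ih :: "(real \<Rightarrow> real) \<Rightarrow> real"
  assumes kr: "k \<le> r" and Ih_ok: "functional_ok Ih kI" and A1: "A1 r k Ih"
begin

lemma Ck_poly: "Ck_on {-1..1} kI (poly P)"
  by (rule Cinf_on_imp_Ck_on[OF Cinf_on_poly]) simp

lemma Ck_mult: "Ck_on {-1..1} kI f \<Longrightarrow> Ck_on {-1..1} kI g \<Longrightarrow> Ck_on {-1..1} kI (\<lambda>x. f x * g x :: real)"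
  using Ck_on_scaleR[of "-1" 1 kI f g] by simp

lemma Ck_power_mult: "Ck_on {-1..1} kI g \<Longrightarrow> Ck_on {-1..1} kI (\<lambda>x. x ^ m * g x :: real)"
  using Ck_on_power_scaleR[of "-1" 1 kI g m] by simp

lemma Ih_zero: "Ih (\<lambda>x. 0) = 0"
  using Ih_scale[OF Ih_ok Ck_on_const, of 0 0] by simp

lemma Ih_sum:
  assumes "\<And>i. i \<in> I \<Longrightarrow> Ck_on {-1..1} kI (g i)"
  shows "Ih (\<lambda>x. \<Sum>i\<in>I. c i * g i x) = (\<Sum>i\<in>I. c i * Ih (g i))"
  using assms
proof (induction I rule: infinite_finite_induct)
  case (insert i I)
  have "Ck_on {-1..1} kI (\<lambda>x. \<Sum>i\<in>I. c i * g i x)"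
    using insert.prems by (intro Ck_on_sum Ck_mult Ck_on_const) auto
  then have "Ih (\<lambda>x. c i * g i x + 1 * (\<Sum>i\<in>I. c i * g i x)) = c i * Ih (g i) + 1 * Ih (\<lambda>x. \<Sum>i\<in>I. c i * g i x)"
    using insert.prems by (intro Ih_linear[OF Ih_ok]) auto
  then show ?case using insert by simp
qed (simp_all add: Ih_zero)

lemma Ih_poly_mult:
  assumes "Ck_on {-1..1} kI g" "degree S \<le> n"
  shows "Ih (\<lambda>x. poly S x * g x) = (\<Sum>m\<le>n. coeff S m * Ih (\<lambda>x. x ^ m * g x))"
proof -
  have "poly S x = (\<Sum>m\<le>n. coeff S m * x ^ m)" for x
    using poly_eq_sum_lessThan[of "Suc n" S x] assms(2)
    by (simp only: lessThan_Suc_atMost coeff_zero_iff_degree_le)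
  then have "(\<lambda>x. poly S x * g x) = (\<lambda>x. \<Sum>m\<le>n. coeff S m * (x ^ m * g x))"
    by (simp add: sum_distrib_right mult.assoc)
  then show ?thesis using Ih_sum[of "{..n}" "\<lambda>m x. x ^ m * g x"] Ck_power_mult[OF assms(1)] by simp
qed

text \<open>A linear combination of the moment conditions. For k = 0 they also contain P(-1), which
  enters with the factor S(-1); hence S has to vanish at -1 in that case.\<close>

lemma Ih_poly_pderiv_eq_0:
  assumes z: "\<And>m. m \<le> r - k \<Longrightarrow> J_functional k Ih (2, m) P = 0"
    and S: "degree S \<le> r - k" "k = 0 \<Longrightarrow> poly S (-1) = 0"
  shows "Ih (\<lambda>x. poly S x * poly (pderiv P) x) = 0"
proof -
  have "Ih (\<lambda>x. poly S x * poly (pderiv P) x) = (\<Sum>m\<le>r - k. coeff S m * Ih (\<lambda>x. x ^ m * poly (pderiv P) x))"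
    by (rule Ih_poly_mult[OF Ck_poly S(1)])
  also have "\<dots> = (\<Sum>m\<le>r - k. coeff S m * (- (if k = 0 then poly P (-1) * (-1) ^ m else 0)))"
    using z by (intro sum.cong refl arg_cong2[where f = "(*)"]) (force simp: J_functional_def)
  also have "\<dots> = - (if k = 0 then poly P (-1) * (\<Sum>m\<le>r - k. coeff S m * (-1) ^ m) else 0)"
    by (simp add: sum_distrib_left sum_negf mult_ac)
  also have "(\<Sum>m\<le>r - k. coeff S m * (-1) ^ m) = poly S (-1)"
    using poly_eq_sum_lessThan[of "Suc (r - k)" S "-1"] S(1)
    by (simp only: lessThan_Suc_atMost coeff_zero_iff_degree_le)
  finally show ?thesis using S(2) by simp
qed

text \<open>The end point conditions give P' a zero of order k div 2 at 1 and of order (k - 1) div 2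
  at -1. The cofactor \<psi> has degree at most r - max 1 k, and the moment conditions are then the
  hypothesis of (A1) for \<psi>.\<close>

lemma pderiv_eq_0_of_J_functional:
  assumes deg: "degree P \<le> r" and z: "\<And>j. j \<in> J_index r k \<Longrightarrow> J_functional k Ih j P = 0"
  shows "pderiv P = 0"
proof (rule ccontr)
  assume nz: "pderiv P \<noteq> 0"
  have degP: "degree (pderiv P) \<le> r - 1" using deg by (simp add: degree_pderiv)
  \<comment> \<open>For r = 0 the degree r - max 1 k is negative, and truncated subtraction would
    misstate it; but then P is constant anyway.\<close>
  have "r \<noteq> 0"
  proof
    assume "r = 0"
    then have "degree P = 0" using deg by simp
    then show False using nz by (metis degree_eq_zeroE pderiv_singleton)
  qed
  let ?\<alpha> = "k div 2" and ?\<beta> = "(k - 1) div 2"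
  have z2: "J_functional k Ih (2, m) P = 0" if "m \<le> r - k" for m
    using that by (intro z) (simp add: J_index_def)
  have "?\<alpha> \<le> order 1 (pderiv P)"
  proof (rule le_order_if_pderiv_zero[OF nz])
    fix l assume "l < ?\<alpha>"
    then have "(1, Suc l) \<in> J_index r k" by (simp add: J_index_def)
    from z[OF this] show "poly ((pderiv ^^ l) (pderiv P)) 1 = 0"
      by (simp add: J_functional_def funpow_swap1)
  qed
  then have d1: "[:-1, 1:] ^ ?\<alpha> dvd pderiv P"
    using dvd_trans[OF le_imp_power_dvd order_1[of 1 "pderiv P"]] by simp
  have "?\<beta> \<le> order (-1) (pderiv P)"
  proof (rule le_order_if_pderiv_zero[OF nz])
    fix l assume "l < ?\<beta>"
    then have "Suc l < (k + 1) div 2" by linarith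
    then have "(0, Suc l) \<in> J_index r k" by (simp add: J_index_def)
    from z[OF this] show "poly ((pderiv ^^ l) (pderiv P)) (-1) = 0"
      by (simp add: J_functional_def funpow_swap1)
  qed
  moreover obtain q where q: "pderiv P = [:-1, 1:] ^ ?\<alpha> * q" using d1 by blast
  moreover have "order (-1) ([:-1, 1:] ^ ?\<alpha> :: real poly) = 0"
    by (rule order_0I) (simp add: poly_power)
  ultimately have "?\<beta> \<le> order (-1) q" using nz order_mult[of "[:-1, 1:] ^ ?\<alpha>" q "-1"] by simp
  then have "[:1, 1:] ^ ?\<beta> dvd q"
    using dvd_trans[OF le_imp_power_dvd order_1[of "-1" q]] by simp
  then obtain \<psi>0 where "q = [:1, 1:] ^ ?\<beta> * \<psi>0" by blast
  then have \<psi>0: "pderiv P = [:-1, 1:] ^ ?\<alpha> * [:1, 1:] ^ ?\<beta> * \<psi>0"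
    using q by (simp only: mult.assoc)
  define \<psi> where "\<psi> = smult ((-1) ^ ?\<alpha>) \<psi>0"
  have "\<psi>0 \<noteq> 0" using nz \<psi>0 by auto
  then have "degree (pderiv P) = ?\<alpha> + ?\<beta> + degree \<psi>0"
    unfolding \<psi>0 by (simp add: degree_mult_eq degree_power_eq)
  then have deg\<psi>: "degree \<psi> \<le> r - max 1 k"
  proof -
    have "degree \<psi> \<le> degree \<psi>0" unfolding \<psi>_def by (rule degree_smult_le)
    moreover have "max 1 k = ?\<alpha> + ?\<beta> + 1"
    proof (cases k)
      case (Suc k')
      then have "max 1 k = Suc k'" "?\<alpha> + ?\<beta> + 1 = Suc k' div 2 + k' div 2 + 1" by simp_all
      moreover have "Suc k' div 2 + k' div 2 + 1 = Suc k'" by presburger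
      ultimately show ?thesis by simp
    qed simp
    ultimately show ?thesis using \<open>degree (pderiv P) = _\<close> degP by linarith
  qed
  have P': "poly (pderiv P) t = (1 - t) ^ ?\<alpha> * (1 + t) ^ ?\<beta> * poly \<psi> t" for t
  proof -
    have E: "(t - 1) ^ ?\<alpha> = (-1) ^ ?\<alpha> * (1 - t) ^ ?\<alpha>"
      by (simp flip: power_mult_distrib)
    have "poly (pderiv P) t = (t - 1) ^ ?\<alpha> * (1 + t) ^ ?\<beta> * poly \<psi>0 t"
      unfolding \<psi>0 by (simp add: poly_power)
    then show ?thesis unfolding \<psi>_def poly_smult E by (simp only: mult_ac)
  qed
  have n: "nat (int r - int (max 1 k) + 1) = Suc (r - max 1 k)" using kr \<open>r \<noteq> 0\<close> by auto
  have "poly \<psi> t = 0" for t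
  proof (rule A1[unfolded A1_def, rule_format, of "poly \<psi>" t])
    show "poly \<psi> \<in> Pdeg (int r - int (max 1 k))"
      unfolding Pdeg_iff n coeff_zero_iff_degree_le using deg\<psi> by blast
    fix \<phi> assume "\<phi> \<in> Pdeg (int r - int (max 1 k))"
    then obtain R where R: "degree R \<le> r - max 1 k" "\<phi> = poly R"
      unfolding Pdeg_iff n coeff_zero_iff_degree_le by blast
    \<comment> \<open>For k = 0 the factor 1 + t makes the test polynomial vanish at -1, which
      removes the jump term, and raises the degree to at most r.\<close>
    define S where "S = R * (if k = 0 then [:1, 1:] else 1)"
    have "degree S \<le> degree R + degree (if k = 0 then [:1, 1:] else 1 :: real poly)"
      unfolding S_def by (rule degree_mult_le)
    then have S: "degree S \<le> r - k" "k = 0 \<Longrightarrow> poly S (-1) = 0"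
      using R(1) kr \<open>r \<noteq> 0\<close> by (auto simp: S_def max_def split: if_splits)
    \<comment> \<open>For k = 0 the exponent in (A1) is |floor(-1/2)| = 1, not 0: the weight then
      contains exactly the extra factor carried by \<open>S\<close>.\<close>
    have w: "(1 + t) ^ nat \<bar>(int k - 1) div 2\<bar> = (1 + t) ^ ?\<beta> * (if k = 0 then 1 + t else 1)" for t :: real
    proof (cases "k = 0")
      case False
      then have "int k - 1 = int (k - 1)" by simp
      then have "(int k - 1) div 2 = int ?\<beta>" by (simp only: zdiv_int of_nat_numeral)
      then show ?thesis using False by (simp only: abs_of_nat nat_int if_False mult_1_right)
    qed simp
    have "(\<lambda>t. (1 - t) ^ ?\<alpha> * (1 + t) ^ nat \<bar>(int k - 1) div 2\<bar> * poly \<psi> t * \<phi> t)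
        = (\<lambda>t. poly S t * poly (pderiv P) t)"
      unfolding P' w R(2) S_def by (auto simp: fun_eq_iff)
    then show "Ih (\<lambda>t. (1 - t) ^ ?\<alpha> * (1 + t) ^ nat \<bar>(int k - 1) div 2\<bar> * poly \<psi> t * \<phi> t) = 0"
      using Ih_poly_pderiv_eq_0[OF z2 S] by simp
  qed
  then have "\<psi> = 0" using poly_all_0_iff_0 by blast
  then show False using \<open>\<psi>0 \<noteq> 0\<close> by (simp add: \<psi>_def)
qed

text \<open>Once P' = 0, the remaining constant is detected by the left end point value for k \<ge>
  1, and for k = 0 by the jump term in the moment with test function 1.\<close>

lemma unisolvent_J: "unisolvent (J_index r k) r (J_functional k Ih)"
proof
  fix j P Q c
  have m: "Ck_on {-1..1} kI (\<lambda>x. x ^ i * poly (pderiv P) x)" for i P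
    by (rule Ck_power_mult[OF Ck_poly])
  show "J_functional k Ih j (P + Q) = J_functional k Ih j P + J_functional k Ih j Q"
    using Ih_add[OF Ih_ok m m]
    by (cases j) (simp add: J_functional_def higher_pderiv_add pderiv_add distrib_left distrib_right)
  show "J_functional k Ih j (smult c P) = c * J_functional k Ih j P"
    using Ih_scale[OF Ih_ok m, of c]
    by (cases j) (simp add: J_functional_def higher_pderiv_smult pderiv_smult algebra_simps)
next
  fix P assume deg: "degree P \<le> r" and z: "\<And>j. j \<in> J_index r k \<Longrightarrow> J_functional k Ih j P = 0"
  from pderiv_eq_0_of_J_functional[OF this] have P': "pderiv P = 0" .
  then obtain c where c: "P = [:c:]" using pderiv_iszero by blast
  show "P = 0"
  proof (cases "k = 0")
    case True
    then have "(2, 0) \<in> J_index r k" by (simp add: J_index_def)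
    moreover have "poly 0 = (\<lambda>x. 0 :: real)" by (simp add: fun_eq_iff)
    ultimately show ?thesis using z[of "(2, 0)"] True by (simp add: J_functional_def c Ih_zero)
  next
    case False
    then have "(0, 0) \<in> J_index r k" by (auto simp: J_index_def)
    from z[OF this] show ?thesis by (simp add: J_functional_def c)
  qed
qed (simp_all add: finite_J_index card_J_index kr)

lemma J_functional_const:
  "J_functional k Ih (c, i) [:x:] =
    (if c = 0 \<and> i = 0 \<or> c = 1 \<and> i = 0 then x else if 2 \<le> c \<and> k = 0 then x * (-1) ^ i else 0)"
  by (cases i) (auto simp: J_functional_def Ih_zero funpow_swap1)

text \<open>One step of the method and the definition of the projection onto the ansatz space have this
  common shape: prescribed derivatives at the end points and a variational condition with right-hand
  side \<open>G\<close>; \<open>c\<close> is the value from the left (relevant for \<open>k = 0\<close> only).\<close>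

definition step_conditions ::
  "real \<Rightarrow> real \<Rightarrow> (nat \<Rightarrow> real ^ 'd) \<Rightarrow> (nat \<Rightarrow> real ^ 'd) \<Rightarrow> (real \<Rightarrow> real ^ 'd) \<Rightarrow> real ^ 'd \<Rightarrow> (real \<Rightarrow> real ^ 'd) \<Rightarrow> bool" where
  "step_conditions a b \<alpha> \<beta> G c p \<longleftrightarrow>
     (\<forall>i<(k + 1) div 2. hderiv {a..b} i p a = \<alpha> i) \<and>
     (\<forall>i\<in>{1..k div 2}. hderiv {a..b} i p b = \<beta> i) \<and>
     (\<forall>\<phi>\<in>VPdeg (int r - int k).
        locF Ih a b (\<lambda>t. inner (hderiv {a..b} 1 p t) (\<phi> t)) + (if k = 0 then inner (p a) (\<phi> a) else 0)
        = locF Ih a b (\<lambda>t. inner (G t) (\<phi> t)) + (if k = 0 then inner c (\<phi> a) else 0))"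

text \<open>The right-hand sides after transport to [-1,1]: an i-th derivative gains the factor ((b
  - a)/2)^i. In the variational condition the derivative on the left cancels the factor of the local
  functional, so only the term with G keeps it.\<close>

definition step_data ::
  "real \<Rightarrow> real \<Rightarrow> (nat \<Rightarrow> real ^ 'd) \<Rightarrow> (nat \<Rightarrow> real ^ 'd) \<Rightarrow> (real \<Rightarrow> real ^ 'd) \<Rightarrow> real ^ 'd \<Rightarrow> nat \<times> nat \<Rightarrow> real ^ 'd" where
  "step_data a b \<alpha> \<beta> G c = (\<lambda>(j, i).
     if j = 0 then ((b - a) / 2) ^ i *\<^sub>R \<alpha> i
     else if j = 1 then ((b - a) / 2) ^ i *\<^sub>R \<beta> i
     else ((b - a) / 2) *\<^sub>R vecF Ih (\<lambda>x. x ^ i *\<^sub>R G (Tmap a b x)) + (if k = 0 then (-1) ^ i *\<^sub>R c else 0))"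

lemma Ih_inner_vpoly:
  fixes g :: "real \<Rightarrow> real ^ 'd"
  assumes "Ck_on {-1..1} kI g" "\<And>s. degree (Q s) \<le> n"
  shows "Ih (\<lambda>x. inner (g x) (vpoly Q x)) = (\<Sum>s\<in>UNIV. \<Sum>m\<le>n. coeff (Q s) m * Ih (\<lambda>x. x ^ m * g x $ s))"
proof -
  have C: "Ck_on {-1..1} kI (\<lambda>x. g x $ s)" for s by (rule Ck_on_vec_nth[OF _ assms(1)]) simp
  have "(\<lambda>x. inner (g x) (vpoly Q x)) = (\<lambda>x. \<Sum>s\<in>UNIV. 1 * (poly (Q s) x * g x $ s))"
    by (simp add: inner_vec_def mult.commute)
  then have "Ih (\<lambda>x. inner (g x) (vpoly Q x)) = (\<Sum>s\<in>UNIV. 1 * Ih (\<lambda>x. poly (Q s) x * g x $ s))"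
    using Ih_sum[of UNIV "\<lambda>s x. poly (Q s) x * g x $ s" "\<lambda>s. 1"] Ck_mult[OF Ck_poly C] by simp
  then show ?thesis using Ih_poly_mult[OF C assms(2)] by simp
qed

lemma Ck_inner:
  fixes g h :: "real \<Rightarrow> real ^ 'd"
  assumes "Ck_on {-1..1} kI g" "Ck_on {-1..1} kI h"
  shows "Ck_on {-1..1} kI (\<lambda>x. inner (g x) (h x))"
proof -
  have "Ck_on {-1..1} kI (\<lambda>x. \<Sum>s\<in>UNIV. g x $ s * h x $ s)"
    by (intro Ck_on_sum Ck_mult Ck_on_vec_nth assms) auto
  then show ?thesis by (simp add: inner_vec_def)
qed

text \<open>Decouples the conditions into components: vector test functions on [a,b] are
  combinations of monomials on [-1,1] in single components, so the step becomes a scalar problem for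
  \<open>J_functional\<close> in each component.\<close>

lemma step_conditions_iff:
  fixes G :: "real \<Rightarrow> real ^ 'd"
  assumes ab: "a < b" and G: "Ck_on {a..b} kI G"
    and p: "p \<in> VPdeg (int r)" and R: "\<And>x. vpoly R x = p (Tmap a b x)"
  shows "step_conditions a b \<alpha> \<beta> G c p \<longleftrightarrow>
    (\<forall>j\<in>J_index r k. \<forall>s. J_functional k Ih j (R s) = step_data a b \<alpha> \<beta> G c j $ s)"
proof -
  let ?h = "(b - a) / 2"
  have lt: "(-1::real) < 1" by simp
  have h: "?h > 0" using ab by simp
  obtain P where P: "p = vpoly P" using p unfolding VPdeg_iff by blast
  have Cp: "Ck_on {a..b} l p" for l unfolding P by (rule Cinf_on_imp_Ck_on[OF Cinf_on_vpoly[OF ab]])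
  have D: "vpoly (\<lambda>s. (pderiv ^^ i) (R s)) x = ?h ^ i *\<^sub>R hderiv {a..b} i p (Tmap a b x)" if "x \<in> {-1..1}" for x i
  proof -
    have "(\<lambda>x. p (Tmap a b x)) = vpoly R" using R by (simp add: fun_eq_iff)
    then show ?thesis using hderiv_vpoly[OF lt that, of i R] hderiv_Tmap[OF ab Cp le_refl that, of i] by simp
  qed
  have ends: "(\<forall>s. poly ((pderiv ^^ i) (R s)) x = (?h ^ i *\<^sub>R v) $ s) \<longleftrightarrow> hderiv {a..b} i p (Tmap a b x) = v"
    if "x \<in> {-1..1}" for x i v
  proof -
    have "(\<forall>s. poly ((pderiv ^^ i) (R s)) x = (?h ^ i *\<^sub>R v) $ s)
        \<longleftrightarrow> vpoly (\<lambda>s. (pderiv ^^ i) (R s)) x = ?h ^ i *\<^sub>R v"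
      by (simp add: vec_eq_iff)
    also have "\<dots> \<longleftrightarrow> hderiv {a..b} i p (Tmap a b x) = v"
      unfolding D[OF that] using h by simp
    finally show ?thesis .
  qed
  let ?E = "\<lambda>\<phi>. locF Ih a b (\<lambda>t. inner (hderiv {a..b} 1 p t) (\<phi> t)) + (if k = 0 then inner (p a) (\<phi> a) else 0)"
  let ?F = "\<lambda>\<phi>. locF Ih a b (\<lambda>t. inner (G t) (\<phi> t)) + (if k = 0 then inner c (\<phi> a) else 0)"
  have pa: "p a = vpoly R (-1)" using R[of "-1"] by simp
  have E: "?E \<phi> = (\<Sum>s\<in>UNIV. \<Sum>m\<le>r - k. coeff (Q s) m * J_functional k Ih (2, m) (R s))"
    and F: "?F \<phi> = (\<Sum>s\<in>UNIV. \<Sum>m\<le>r - k. coeff (Q s) m * step_data a b \<alpha> \<beta> G c (2, m) $ s)"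
    if Q: "\<And>s. degree (Q s) \<le> r - k" "\<And>x. vpoly Q x = \<phi> (Tmap a b x)" for Q and \<phi> :: "real \<Rightarrow> real ^ 'd"
  proof -
    have CQ: "Ck_on {-1..1} kI (vpoly Q)" by (rule Cinf_on_imp_Ck_on[OF Cinf_on_vpoly]) simp
    have \<phi>a: "\<phi> a = vpoly Q (-1)" using Q(2)[of "-1"] by simp
    have inn: "inner v (vpoly Q (-1)) = (\<Sum>s\<in>UNIV. \<Sum>m\<le>r - k. coeff (Q s) m * (v $ s * (-1) ^ m))" for v
    proof -
      have "poly (Q s) (-1) = (\<Sum>m\<le>r - k. coeff (Q s) m * (-1) ^ m)" for s
        using poly_eq_sum_lessThan[of "Suc (r - k)" "Q s" "-1"] Q(1)
        by (simp only: lessThan_Suc_atMost coeff_zero_iff_degree_le)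
      then show ?thesis by (simp add: inner_vec_def sum_distrib_left mult_ac)
    qed
    let ?R' = "vpoly (\<lambda>s. pderiv (R s))"
    have CR: "Ck_on {-1..1} kI ?R'" by (rule Cinf_on_imp_Ck_on[OF Cinf_on_vpoly]) simp
    have Cd: "Ck_on {-1..1} kI (\<lambda>x. hderiv {a..b} 1 p (Tmap a b x))"
      by (rule Ck_on_Tmap[OF ab Ck_on_hderiv_1[OF ab Cp]])
    \<comment> \<open>The two integrands agree on [-1,1] only, since outside [a,b] the one-sided
      derivative of p carries no information; hence \<open>Ih_cong\<close>.\<close>
    have "Ih (\<lambda>x. inner (hderiv {a..b} 1 p (Tmap a b x)) (\<phi> (Tmap a b x))) = Ih (\<lambda>x. (1 / ?h) * inner (?R' x) (vpoly Q x))"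
    proof (rule Ih_cong[OF Ih_ok])
      show "Ck_on {-1..1} kI (\<lambda>x. inner (hderiv {a..b} 1 p (Tmap a b x)) (\<phi> (Tmap a b x)))"
        using Ck_inner[OF Cd CQ] Q(2) by simp
      show "Ck_on {-1..1} kI (\<lambda>x. (1 / ?h) * inner (?R' x) (vpoly Q x))"
        by (rule Ck_mult[OF Ck_on_const[OF lt] Ck_inner[OF CR CQ]])
      show "inner (hderiv {a..b} 1 p (Tmap a b t)) (\<phi> (Tmap a b t)) = (1 / ?h) * inner (?R' t) (vpoly Q t)"
        if "t \<in> {-1..1}" for t
      proof -
        have "?R' t = ?h *\<^sub>R hderiv {a..b} 1 p (Tmap a b t)" using D[OF that, of 1] by simp
        then show ?thesis using h Q(2)[of t] by simp
      qed
    qed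
    also have "\<dots> = (1 / ?h) * Ih (\<lambda>x. inner (?R' x) (vpoly Q x))"
      by (rule Ih_scale[OF Ih_ok Ck_inner[OF CR CQ]])
    also have "Ih (\<lambda>x. inner (?R' x) (vpoly Q x)) = (\<Sum>s\<in>UNIV. \<Sum>m\<le>r - k. coeff (Q s) m * Ih (\<lambda>x. x ^ m * poly (pderiv (R s)) x))"
      using Ih_inner_vpoly[OF CR Q(1)] by simp
    finally have "locF Ih a b (\<lambda>t. inner (hderiv {a..b} 1 p t) (\<phi> t))
        = (\<Sum>s\<in>UNIV. \<Sum>m\<le>r - k. coeff (Q s) m * Ih (\<lambda>x. x ^ m * poly (pderiv (R s)) x))"
      using h by (simp add: locF_def o_def)
    then show "?E \<phi> = (\<Sum>s\<in>UNIV. \<Sum>m\<le>r - k. coeff (Q s) m * J_functional k Ih (2, m) (R s))"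
      unfolding \<phi>a pa inn by (simp add: J_functional_def distrib_left sum.distrib)
    have CG: "Ck_on {-1..1} kI (\<lambda>x. G (Tmap a b x))" by (rule Ck_on_Tmap[OF ab G])
    have "locF Ih a b (\<lambda>t. inner (G t) (\<phi> t)) = ?h * Ih (\<lambda>x. inner (G (Tmap a b x)) (vpoly Q x))"
      by (simp add: locF_def o_def Q(2))
    also have "\<dots> = ?h * (\<Sum>s\<in>UNIV. \<Sum>m\<le>r - k. coeff (Q s) m * Ih (\<lambda>x. x ^ m * G (Tmap a b x) $ s))"
      by (simp only: Ih_inner_vpoly[OF CG Q(1)])
    also have "\<dots> = (\<Sum>s\<in>UNIV. \<Sum>m\<le>r - k. coeff (Q s) m * (?h * Ih (\<lambda>x. x ^ m * G (Tmap a b x) $ s)))"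
      by (simp add: sum_distrib_left mult_ac)
    finally show "?F \<phi> = (\<Sum>s\<in>UNIV. \<Sum>m\<le>r - k. coeff (Q s) m * step_data a b \<alpha> \<beta> G c (2, m) $ s)"
      unfolding \<phi>a inn by (simp add: step_data_def vecF_def distrib_left sum.distrib mult_ac)
  qed
  have deg: "int r - int k = int (r - k)" using kr by simp
  have "(\<forall>\<phi>\<in>VPdeg (int r - int k). ?E \<phi> = ?F \<phi>) \<longleftrightarrow>
    (\<forall>m\<le>r - k. \<forall>s. J_functional k Ih (2, m) (R s) = step_data a b \<alpha> \<beta> G c (2, m) $ s)"
  proof (intro iffI allI ballI impI)
    fix \<phi> :: "real \<Rightarrow> real ^ 'd" assume eq: "\<forall>m\<le>r - k. \<forall>s. J_functional k Ih (2, m) (R s) = step_data a b \<alpha> \<beta> G c (2, m) $ s"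
      and "\<phi> \<in> VPdeg (int r - int k)"
    then obtain P where P: "\<And>s. degree (P s) \<le> r - k" "\<phi> = vpoly P"
      unfolding deg VPdeg_iff by blast
    obtain Q where Q1: "\<And>s. degree (Q s) \<le> r - k"
      and Q2: "\<And>x. vpoly Q x = vpoly P ((b - a) / 2 * x + (a + b) / 2)"
      using vpoly_affine[of P "r - k" "(b - a) / 2" "(a + b) / 2", OF P(1)] by blast
    have Q: "\<And>s. degree (Q s) \<le> r - k" "\<And>x. vpoly Q x = \<phi> (Tmap a b x)"
      by (rule Q1, simp only: P(2) Tmap_affine Q2)
    show "?E \<phi> = ?F \<phi>" unfolding E[OF Q] F[OF Q] using eq by simp
  next
    fix m s assume eq: "\<forall>\<phi>\<in>VPdeg (int r - int k). ?E \<phi> = ?F \<phi>" and m: "m \<le> r - k"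
    \<comment> \<open>Testing with a monomial in the single component s isolates one moment.\<close>
    define Q :: "'d \<Rightarrow> real poly" where "Q s' = (if s' = s then monom 1 m else 0)" for s'
    have Q1: "degree (Q s') \<le> r - k" for s' using m by (simp add: Q_def degree_monom_eq)
    obtain P where P: "\<And>s. degree (P s) \<le> r - k" "\<And>t. vpoly P t = vpoly Q (2 / (b - a) * t + - ((a + b) / (b - a)))"
      using vpoly_affine[of Q "r - k" "2 / (b - a)" "- ((a + b) / (b - a))", OF Q1] by blast
    have Q2: "vpoly Q x = vpoly P (Tmap a b x)" for x
      unfolding P(2) Tinv_affine[of a b, THEN fun_cong, symmetric] using ab by simp
    have "vpoly P \<in> VPdeg (int r - int k)" unfolding deg VPdeg_iff using P(1) by blast
    then have "?E (vpoly P) = ?F (vpoly P)" using eq by blast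
    then have "(\<Sum>s'\<in>UNIV. \<Sum>m'\<le>r - k. coeff (Q s') m' * J_functional k Ih (2, m') (R s'))
      = (\<Sum>s'\<in>UNIV. \<Sum>m'\<le>r - k. coeff (Q s') m' * step_data a b \<alpha> \<beta> G c (2, m') $ s')"
      unfolding E[OF Q1 Q2] F[OF Q1 Q2] .
    moreover have "(\<Sum>s'\<in>UNIV. \<Sum>m'\<le>r - k. coeff (Q s') m' * X m' s') = X m s" for X :: "nat \<Rightarrow> 'd \<Rightarrow> real"
    proof -
      have "(\<Sum>m'\<le>r - k. coeff (Q s') m' * X m' s') = (if s' = s then X m s' else 0)" for s'
        using m by (simp add: Q_def if_distrib[of "\<lambda>c. c * _"] cong: if_cong)
      then show ?thesis by simp
    qed
    ultimately show "J_functional k Ih (2, m) (R s) = step_data a b \<alpha> \<beta> G c (2, m) $ s" by simp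
  qed
  moreover have "(\<forall>i<(k + 1) div 2. hderiv {a..b} i p a = \<alpha> i) \<longleftrightarrow>
      (\<forall>i<(k + 1) div 2. \<forall>s. J_functional k Ih (0, i) (R s) = step_data a b \<alpha> \<beta> G c (0, i) $ s)"
    using ends[of "-1"] by (simp add: J_functional_def step_data_def)
  moreover have "(\<forall>i\<in>{1..k div 2}. hderiv {a..b} i p b = \<beta> i) \<longleftrightarrow>
      (\<forall>i\<in>{1..k div 2}. \<forall>s. J_functional k Ih (1, i) (R s) = step_data a b \<alpha> \<beta> G c (1, i) $ s)"
    using ends[of 1] by (simp add: J_functional_def step_data_def)
  moreover have "(\<forall>j\<in>J_index r k. X j) \<longleftrightarrow>
      (\<forall>i<(k + 1) div 2. X (0, i)) \<and> (\<forall>i\<in>{1..k div 2}. X (1, i)) \<and> (\<forall>m\<le>r - k. X (2, m))" for X :: "nat \<times> nat \<Rightarrow> bool"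
  proof -
    have "(\<forall>j\<in>{n} \<times> A. X j) \<longleftrightarrow> (\<forall>i\<in>A. X (n, i))" for n A by blast
    then show ?thesis unfolding J_index_def ball_Un by (simp only: Ball_def lessThan_iff atMost_iff conj_assoc)
  qed
  ultimately show ?thesis
    unfolding step_conditions_def by (simp only:)
qed

end

subsection \<open>The Hermite interpolant\<close>

lemma finite_Dapp: "finite (Dapp k tI KI KtI)"
proof -
  have "Dapp k tI KI KtI = {1} \<times> {..<k div 2} \<union> {-1} \<times> {..<(k - 1) div 2} \<union> (\<Union>m\<in>{..KI}. {tI m} \<times> {..KtI m})"
    by (auto simp: Dapp_def)
  then show ?thesis by simp
qed

lemma Dapp_downward: "(x, l) \<in> Dapp k tI KI KtI \<Longrightarrow> j \<le> l \<Longrightarrow> (x, j) \<in> Dapp k tI KI KtI"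
  by (auto simp: Dapp_def intro: order.trans)

lemma Dapp_range: "tI ` {..KI} \<subseteq> {-1..1} \<Longrightarrow> (x, l) \<in> Dapp k tI KI KtI \<Longrightarrow> x \<in> {-1..1}"
  by (auto simp: Dapp_def)

text \<open>Truncated subtraction makes the number of conditions max rapp (r + 1), the dimension of
  the polynomial space in both cases. The added nodes avoid the old ones and the end points, so no
  condition occurs twice.\<close>

lemma unisolvent_Iapp:
  assumes "inj_on sx {..<r + 1 - rapp k tI KI KtI}"
    "sx ` {..<r + 1 - rapp k tI KI KtI} \<subseteq> {-1<..<1} - tI ` {..KI}"
  shows "unisolvent (Dapp k tI KI KtI \<union> Dext r k tI KI KtI sx) (max (rapp k tI KI KtI - 1) r)
      (\<lambda>(x, l) P. poly ((pderiv ^^ l) P) x)"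
proof (rule unisolvent_Hermite)
  let ?D = "Dapp k tI KI KtI" and ?E = "Dext r k tI KI KtI sx" and ?n = "r + 1 - rapp k tI KI KtI"
  have E: "?E = (\<lambda>j. (sx j, 0)) ` {..<?n}" by (auto simp: Dext_def)
  have "inj_on (\<lambda>j. (sx j, 0::nat)) {..<?n}" using assms(1) by (auto simp: inj_on_def)
  then have cardE: "card ?E = ?n" unfolding E by (simp add: card_image)
  have "(sx j, 0) \<notin> ?D" if "j < ?n" for j
  proof -
    have "sx j \<in> {-1<..<1} - tI ` {..KI}" using that assms(2) by blast
    then show ?thesis by (auto simp: Dapp_def)
  qed
  then have "?D \<inter> ?E = {}" unfolding E by auto
  then have "card (?D \<union> ?E) = rapp k tI KI KtI + ?n"
    using cardE by (subst card_Un_disjoint) (auto simp: finite_Dapp E rapp_def)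
  then show "card (?D \<union> ?E) = Suc (max (rapp k tI KI KtI - 1) r)" by linarith
  show "finite (?D \<union> ?E)" by (simp add: finite_Dapp E)
  show "(x, j) \<in> ?D \<union> ?E" if "(x, l) \<in> ?D \<union> ?E" "j \<le> l" for x l j
    using that Dapp_downward by (auto simp: Dext_def)
qed

lemma VPdeg_Tmap:
  assumes "a < b" "p \<in> VPdeg (int n)"
  obtains R where "\<And>s. degree (R s) \<le> n" "\<And>x. vpoly R x = p (Tmap a b x)"
proof -
  obtain P where P: "\<And>s. degree (P s) \<le> n" "p = vpoly P" using assms(2) unfolding VPdeg_iff by blast
  from vpoly_affine[of P n "(b - a) / 2" "(a + b) / 2", OF P(1)] that
  show thesis unfolding P(2) Tmap_affine by blast
qed

lemma VPdeg_Tinv: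
  assumes "a < b" "\<And>s. degree (R s) \<le> n"
  obtains p where "p \<in> VPdeg (int n)" "\<And>x. vpoly R x = p (Tmap a b x)"
proof -
  obtain P where P: "\<And>s. degree (P s) \<le> n" "\<And>t. vpoly P t = vpoly R (2 / (b - a) * t + - ((a + b) / (b - a)))"
    using vpoly_affine[of R n "2 / (b - a)" "- ((a + b) / (b - a))", OF assms(2)] by blast
  have "vpoly R x = vpoly P (Tmap a b x)" for x
    unfolding P(2) Tinv_affine[of a b, THEN fun_cong, symmetric] using assms(1) by simp
  moreover have "vpoly P \<in> VPdeg (int n)" unfolding VPdeg_iff using P(1) by blast
  ultimately show thesis using that by blast
qed

lemma VPdeg_eqI:
  assumes "a < b" "p \<in> VPdeg (int n)" "q \<in> VPdeg (int n)"
    and "\<And>x. vpoly R x = p (Tmap a b x)" "\<And>x. vpoly R x = q (Tmap a b x)"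
  shows "p = q"
proof
  fix t
  show "p t = q t" using assms(4,5)[of "Tinv a b t"] assms(1) by simp
qed

lemma hderiv_VPdeg_Tmap:
  fixes p :: "real \<Rightarrow> real ^ 'd"
  assumes "a < b" "p \<in> VPdeg (int n)" "\<And>x. vpoly R x = p (Tmap a b x)" "x \<in> {-1..1}"
  shows "vpoly (\<lambda>s. (pderiv ^^ i) (R s)) x = ((b - a) / 2) ^ i *\<^sub>R hderiv {a..b} i p (Tmap a b x)"
proof -
  obtain P where P: "p = vpoly P" using assms(2) unfolding VPdeg_iff by blast
  have Cp: "Ck_on {a..b} i p" unfolding P by (rule Cinf_on_imp_Ck_on[OF Cinf_on_vpoly[OF assms(1)]])
  have "(\<lambda>x. p (Tmap a b x)) = vpoly R" using assms(3) by (simp add: fun_eq_iff)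
  then show ?thesis
    using hderiv_vpoly[OF _ assms(4), of i R] hderiv_Tmap[OF assms(1) Cp le_refl assms(4)] by simp
qed

lemma Cinf_on_VPdeg: "a < b \<Longrightarrow> p \<in> VPdeg (int n) \<Longrightarrow> Cinf_on {a..b} p"
  unfolding VPdeg_iff using Cinf_on_vpoly by blast

text \<open>Transport to [-1,1] multiplies each condition by a nonzero power of (b - a)/2, so
  unisolvence there gives the existence and uniqueness that the definite description in
  \<open>Iapp\<close> requires.\<close>

lemma Iapp_interpolates:
  fixes \<phi> :: "real \<Rightarrow> real ^ 'd"
  assumes sx: "inj_on sx {..<r + 1 - rapp k tI KI KtI}"
    "sx ` {..<r + 1 - rapp k tI KI KtI} \<subseteq> {-1<..<1} - tI ` {..KI}"
    and tI: "tI ` {..KI} \<subseteq> {-1..1}" and ab: "a < b"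
  shows "Iapp r k tI KI KtI sx a b \<phi> \<in> VPdeg (int (max (rapp k tI KI KtI - 1) r))" (is ?deg)
    and "\<And>x l. (x, l) \<in> Dapp k tI KI KtI \<Longrightarrow>
      hderiv {a..b} l (Iapp r k tI KI KtI sx a b \<phi>) (Tmap a b x) = hderiv {a..b} l \<phi> (Tmap a b x)"
proof -
  let ?n = "max (rapp k tI KI KtI - 1) r" and ?D = "Dapp k tI KI KtI \<union> Dext r k tI KI KtI sx"
  let ?\<Lambda> = "\<lambda>(x, l) P. poly ((pderiv ^^ l) P) x :: real"
  let ?ok = "\<lambda>p. p \<in> VPdeg (int ?n) \<and>
       (\<forall>(x, l) \<in> ?D. hderiv {a..b} l p (Tmap a b x) = hderiv {a..b} l \<phi> (Tmap a b x))"
  interpret H: unisolvent ?D ?n ?\<Lambda> by (rule unisolvent_Iapp[OF sx])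
  have h: "(b - a) / 2 \<noteq> 0" using ab by simp
  have D: "x \<in> {-1..1}" if xl: "(x, l) \<in> ?D" for x l
  proof -
    consider "(x, l) \<in> Dapp k tI KI KtI" | i where "i < r + 1 - rapp k tI KI KtI" "x = sx i"
      using xl by (auto simp: Dext_def)
    then show ?thesis
    proof cases
      case 1
      then show ?thesis by (rule Dapp_range[OF tI])
    next
      case (2 i)
      then have "x \<in> {-1<..<1}" using sx(2) by blast
      then show ?thesis by simp
    qed
  qed
  let ?v = "\<lambda>(x, l). ((b - a) / 2) ^ l *\<^sub>R hderiv {a..b} l \<phi> (Tmap a b x)"
  have iff: "?ok p \<longleftrightarrow> (\<forall>j\<in>?D. \<forall>s. ?\<Lambda> j (R s) = ?v j $ s)"
    if p: "p \<in> VPdeg (int ?n)" and R: "\<And>x. vpoly R x = p (Tmap a b x)" for p R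
  proof -
    have "(case j of (x, l) \<Rightarrow> hderiv {a..b} l p (Tmap a b x) = hderiv {a..b} l \<phi> (Tmap a b x))
        \<longleftrightarrow> (\<forall>s. ?\<Lambda> j (R s) = ?v j $ s)" if j: "j \<in> ?D" for j
    proof -
      obtain x l where xl: "j = (x, l)" by (cases j)
      have "(\<forall>s. ?\<Lambda> j (R s) = ?v j $ s) \<longleftrightarrow> vpoly (\<lambda>s. (pderiv ^^ l) (R s)) x = ?v j"
        by (simp add: vec_eq_iff xl)
      also have "\<dots> \<longleftrightarrow> hderiv {a..b} l p (Tmap a b x) = hderiv {a..b} l \<phi> (Tmap a b x)"
        unfolding hderiv_VPdeg_Tmap[OF ab p R D[OF j[unfolded xl]]] using h by (simp add: xl)
      finally show ?thesis by (simp add: xl)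
    qed
    then show ?thesis using p by blast
  qed
  obtain R where R: "\<And>s. degree (R s) \<le> ?n" "\<forall>j\<in>?D. \<forall>s. ?\<Lambda> j (R s) = ?v j $ s"
    using H.ex_vpoly[of ?v] by blast
  obtain p where p: "p \<in> VPdeg (int ?n)" "\<And>x. vpoly R x = p (Tmap a b x)"
    using VPdeg_Tinv[where R = R, OF ab R(1)] by blast
  have "?ok p" unfolding iff[OF p] by (rule R(2))
  moreover have "q = p" if q: "?ok q" for q
  proof -
    obtain Q where Q: "\<And>s. degree (Q s) \<le> ?n" "\<And>x. vpoly Q x = q (Tmap a b x)"
      using VPdeg_Tmap[OF ab conjunct1[OF q]] by blast
    have q': "\<forall>j\<in>?D. \<forall>s. ?\<Lambda> j (Q s) = ?v j $ s"
      using q unfolding iff[OF conjunct1[OF q] Q(2)] .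
    have "Q s - R s = 0" for s
    proof (rule H.inj)
      show "degree (Q s - R s) \<le> ?n" by (intro degree_diff_le Q R)
      show "?\<Lambda> j (Q s - R s) = 0" if "j \<in> ?D" for j
        unfolding H.diff[OF that] using R(2) q' that by simp
    qed
    then have "Q = R" by (simp add: fun_eq_iff)
    then show ?thesis using VPdeg_eqI[OF ab conjunct1[OF q] p(1) Q(2)] p(2) by blast
  qed
  ultimately have "?ok (THE p. ?ok p)" by (rule theI)
  moreover have n: "max (int (rapp k tI KI KtI) - 1) (int r) = int ?n" by simp
  ultimately have ok: "?ok (Iapp r k tI KI KtI sx a b \<phi>)" unfolding Iapp_def n by blast
  then show ?deg by blast
  show "\<And>x l. (x, l) \<in> Dapp k tI KI KtI \<Longrightarrow>
      hderiv {a..b} l (Iapp r k tI KI KtI sx a b \<phi>) (Tmap a b x) = hderiv {a..b} l \<phi> (Tmap a b x)"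
    using ok by blast
qed

subsection \<open>The projection\<close>

context step_functionals
begin

lemma isJ_iff:
  "isJ r k Ih Ic a b v p \<longleftrightarrow> p \<in> VPdeg (int r) \<and>
    step_conditions a b (\<lambda>i. hderiv {a..b} i v a) (\<lambda>i. hderiv {a..b} i v b) (locOp Ic a b (hderiv {a..b} 1 v)) (v a) p"
proof -
  have "(1 \<le> k \<longrightarrow> (\<forall>i\<le>(k - 1) div 2. X i)) \<longleftrightarrow> (\<forall>i<(k + 1) div 2. X i)" for X
    by (cases k) (simp_all add: less_Suc_eq_le)
  moreover have "(2 \<le> k \<longrightarrow> (\<forall>i\<in>{1..k div 2}. X i)) \<longleftrightarrow> (\<forall>i\<in>{1..k div 2}. X i)" for X
    by auto
  ultimately show ?thesis unfolding isJ_def step_conditions_def Let_def by (simp only:)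
qed

text \<open>Justifies the definite description in \<open>Jop\<close>: unisolvence of the step
  functionals yields a solution and its uniqueness.\<close>

lemma Jop_isJ:
  fixes v :: "real \<Rightarrow> real ^ 'd"
  assumes ab: "a < b" and Ic_ok: "operator_ok Ic kc" and v: "Cinf_on {a..b} v"
  shows "isJ r k Ih Ic a b v (Jop r k Ih Ic a b v)"
proof -
  interpret J: unisolvent "J_index r k" r "J_functional k Ih" by (rule unisolvent_J)
  let ?G = "locOp Ic a b (hderiv {a..b} 1 v)"
  let ?\<alpha> = "\<lambda>i. hderiv {a..b} i v a" and ?\<beta> = "\<lambda>i. hderiv {a..b} i v b"
  let ?d = "step_data a b ?\<alpha> ?\<beta> ?G (v a)"
  have G: "Ck_on {a..b} kI ?G"
    by (rule Cinf_on_imp_Ck_on[OF Cinf_on_locOp[OF Ic_ok ab Cinf_on_hderiv_1[OF ab v]]])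
  obtain R where R: "\<And>s. degree (R s) \<le> r" "\<And>j s. j \<in> J_index r k \<Longrightarrow> J_functional k Ih j (R s) = ?d j $ s"
    using J.ex_vpoly[of ?d] by blast
  obtain p where p: "p \<in> VPdeg (int r)" "\<And>x. vpoly R x = p (Tmap a b x)"
    using VPdeg_Tinv[where R = R, OF ab R(1)] by blast
  have "isJ r k Ih Ic a b v p"
    unfolding isJ_iff step_conditions_iff[OF ab G p] using p(1) R(2) by blast
  moreover have "q = p" if "isJ r k Ih Ic a b v q" for q
  proof -
    have q: "q \<in> VPdeg (int r)" "step_conditions a b ?\<alpha> ?\<beta> ?G (v a) q" using that unfolding isJ_iff by blast+
    obtain Q where Q: "\<And>s. degree (Q s) \<le> r" "\<And>x. vpoly Q x = q (Tmap a b x)"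
      using VPdeg_Tmap[OF ab q(1)] by blast
    have "Q s - R s = 0" for s
    proof (rule J.inj)
      show "degree (Q s - R s) \<le> r" by (intro degree_diff_le Q R)
      show "J_functional k Ih j (Q s - R s) = 0" if "j \<in> J_index r k" for j
        using q(2) R(2)[OF that] that unfolding step_conditions_iff[OF ab G q(1) Q(2)] J.diff[OF that] by simp
    qed
    then have "Q = R" by (simp add: fun_eq_iff)
    then show ?thesis using VPdeg_eqI[OF ab q(1) p(1) Q(2)] p(2) by blast
  qed
  ultimately show ?thesis unfolding Jop_def by (rule theI)
qed

end

lemma higher_pderiv_diff: "(pderiv ^^ n) (P - Q :: real poly) = (pderiv ^^ n) P - (pderiv ^^ n) Q"
  by (induction n arbitrary: P Q) (simp_all add: pderiv_diff)

subsection \<open>The error on one mesh interval\<close>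

locale variational_scheme = step_functionals r k kI Ih
  for r k kI :: nat and Ih :: "(real \<Rightarrow> real) \<Rightarrow> real" +
  fixes kc :: nat and Ic :: "(real \<Rightarrow> real) \<Rightarrow> (real \<Rightarrow> real)"
    and f :: "real \<Rightarrow> real ^ 'd \<Rightarrow> real ^ 'd" and t0 T C2 :: real and u :: "real \<Rightarrow> real ^ 'd"
    and tI sx :: "nat \<Rightarrow> real" and KI :: nat and KtI :: "nat \<Rightarrow> nat"
  assumes T_pos: "0 < T"
    and f_smooth: "smooth_map (\<lambda>(t, x). f t x)"
    and Ic_ok: "operator_ok Ic kc"
    and u_smooth: "Cinf_on {t0..t0 + T} u"
    and u_ode: "\<forall>t\<in>{t0..t0 + T}. (u has_vector_derivative f t (u t)) (at t within {t0..t0 + T})"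
    and A2: "A2 Ih kI TYPE('d)"
    and A4: "A4 f t0 T (max (k div 2 - 1) (max kI kc)) C2"
    and A5: "A5a Ic kI kc t0 T tI KI KtI TYPE('d) \<or> A5b Ih Ic kI kc t0 T tI KI KtI TYPE('d)"
    and sx_new: "inj_on sx {..<r + 1 - rapp k tI KI KtI}"
      "sx ` {..<r + 1 - rapp k tI KI KtI} \<subseteq> {-1<..<1} - tI ` {..KI}"
begin

abbreviation "kJ \<equiv> max (k div 2 - 1) (max kI kc)"
abbreviation "Iu a b \<equiv> Iapp r k tI KI KtI sx a b u"
abbreviation "Ju a b \<equiv> Jop r k Ih Ic a b u"
abbreviation "errI V a b \<equiv> supn {a<..b} (\<lambda>t. u t - V t) + supn {a<..b} (\<lambda>t. u t - Iu a b t)"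
abbreviation "fdiff V \<equiv> (\<lambda>t. f t (V t) - f t (u t))"

lemma tI_range: "tI ` {..KI} \<subseteq> {-1..1}"
  using A5 by (auto simp: A5a_def A5b_def distinct_pts_def)

lemma quadrature_bound:
  "\<exists>C\<ge>0. \<forall>a b (w :: real \<Rightarrow> real ^ 'd) m. admissible_interval t0 T a b \<longrightarrow> Cinf_on {a..b} w \<longrightarrow> m \<le> r \<longrightarrow>
    norm (vecF Ih (\<lambda>x. x ^ m *\<^sub>R locOp Ic a b w (Tmap a b x)))
      \<le> C * (pt_terms a b tI KI (\<lambda>m. min (KtI m) (max kI kc)) w + supn {a<..b} w)"
  using A5 quadrature_bound_a[OF Ic_ok A2] quadrature_bound_b[OF Ih_ok Ic_ok] by blast

context
  fixes a b :: real
  assumes adm: "admissible_interval t0 T a b"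
begin

lemma interval: "a < b" "t0 \<le> a" "b \<le> t0 + T" "0 < (b - a) / 2" "(b - a) / 2 \<le> 1"
  using adm by (auto simp: admissible_interval_def)

lemma u_Cinf: "Cinf_on {a..b} u"
  by (rule Cinf_on_subinterval[OF _ _ u_smooth]) (use interval in auto)

text \<open>Lets the derivatives of u in the data of the projection be subtracted from those of f
  along V, leaving only derivatives of \<open>fdiff V\<close>.\<close>

lemma hderiv_u: "t \<in> {a..b} \<Longrightarrow> hderiv {a..b} (Suc i) u t = hderiv {a..b} i (\<lambda>t. f t (u t)) t"
proof (rule Ck_on_Suc(2)[OF interval(1) _ Cinf_on_imp_Ck_on[OF Cinf_on_smooth_map[OF interval(1) f_smooth u_Cinf]] le_refl])
  fix x assume "x \<in> {a..b}"
  moreover have "{a..b} \<subseteq> {t0..t0 + T}" using interval by auto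
  ultimately show "(u has_vector_derivative f x (u x)) (at x within {a..b})"
    using u_ode has_vector_derivative_within_subset by blast
qed

lemma Cinf_fdiff:
  assumes "V \<in> VPdeg (int r)"
  shows "Cinf_on {a..b} (\<lambda>t. f t (V t))" "Cinf_on {a..b} (\<lambda>t. f t (u t))" "Cinf_on {a..b} (fdiff V)"
proof -
  show 1: "Cinf_on {a..b} (\<lambda>t. f t (V t))" "Cinf_on {a..b} (\<lambda>t. f t (u t))"
    using Cinf_on_smooth_map[OF interval(1) f_smooth] u_Cinf Cinf_on_VPdeg[OF interval(1) assms] by blast+
  then show "Cinf_on {a..b} (fdiff V)"
    unfolding Cinf_on_def using Ck_on_diff[OF interval(1)] by blast
qed

text \<open>The absolute value is taken because (A4) does not fix the sign of its constant.\<close>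

lemma fdiff_le:
  assumes "V \<in> VPdeg (int r)" "s \<in> {a..b}" "i \<le> kJ"
  shows "norm (hderiv {a..b} i (fdiff V) s) \<le> \<bar>C2\<bar> * (\<Sum>l\<le>i. norm (hderiv {a..b} l (\<lambda>t. V t - u t) s))"
proof -
  have "norm (hderiv {a..b} i (fdiff V) s) \<le> C2 * (\<Sum>l\<le>i. norm (hderiv {a..b} l (\<lambda>t. V t - u t) s))"
    using A4[unfolded A4_def, rule_format, OF interval(2,1,3) Cinf_on_VPdeg[OF interval(1) assms(1)] u_Cinf assms(2,3)] .
  also have "\<dots> \<le> \<bar>C2\<bar> * (\<Sum>l\<le>i. norm (hderiv {a..b} l (\<lambda>t. V t - u t) s))"
    by (intro mult_right_mono sum_nonneg) auto
  finally show ?thesis .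
qed

lemma continuous_errors:
  assumes "V \<in> VPdeg (int n)"
  shows "continuous_on {a..b} (\<lambda>t. u t - V t)"
  using Ck_on_continuous_on[OF Cinf_on_imp_Ck_on[OF u_Cinf]]
    Ck_on_continuous_on[OF Cinf_on_imp_Ck_on[OF Cinf_on_VPdeg[OF interval(1) assms]]]
  by (intro continuous_on_diff) blast+

lemma Iu_interpolates:
  shows "Iu a b \<in> VPdeg (int (max (rapp k tI KI KtI - 1) r))"
    and "(x, l) \<in> Dapp k tI KI KtI \<Longrightarrow> hderiv {a..b} l (Iu a b) (Tmap a b x) = hderiv {a..b} l u (Tmap a b x)"
  using Iapp_interpolates[OF sx_new tI_range interval(1)] by blast+

lemma supn_fdiff:
  assumes V: "V \<in> VPdeg (int r)"
  shows "supn {a<..b} (fdiff V) \<le> \<bar>C2\<bar> * supn {a<..b} (\<lambda>t. u t - V t)"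
proof (rule supn_le_Ioc[OF interval(1)])
  fix t assume t: "t \<in> {a..b}"
  have "norm (fdiff V t) \<le> \<bar>C2\<bar> * norm (u t - V t)"
    using fdiff_le[OF V t, of 0] by (simp add: norm_minus_commute)
  also have "\<dots> \<le> \<bar>C2\<bar> * supn {a<..b} (\<lambda>t. u t - V t)"
    by (intro mult_left_mono norm_le_supn[OF interval(1) continuous_errors[OF V] t]) simp
  finally show "norm (fdiff V t) \<le> \<bar>C2\<bar> * supn {a<..b} (\<lambda>t. u t - V t)" .
qed

end

text \<open>At a Hermite node the derivatives of u coincide with those of its interpolant, also for
  all lower orders. Hence those of V - u are derivatives of a polynomial whose supremum is at most
  \<open>errI V a b\<close>, and the inverse inequality applies on [-1,1].\<close>

lemma pointwise_bound:
  "\<exists>C\<ge>0. \<forall>a b V x j. admissible_interval t0 T a b \<longrightarrow> V \<in> VPdeg (int r) \<longrightarrow> (x, j) \<in> Dapp k tI KI KtI \<longrightarrow> j \<le> kJ \<longrightarrow>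
     ((b - a) / 2) ^ j * norm (hderiv {a..b} j (fdiff V) (Tmap a b x)) \<le> C * errI V a b"
proof -
  let ?n = "max (rapp k tI KI KtI - 1) r"
  obtain K where K: "\<And>i. K i \<ge> 0" "\<And>i (P :: 'd \<Rightarrow> real poly) B x. (\<forall>s. degree (P s) \<le> ?n) \<Longrightarrow>
     (\<forall>x\<in>{-1..1}. norm (vpoly P x) \<le> B) \<Longrightarrow> x \<in> {-1..1} \<Longrightarrow> norm (vpoly (\<lambda>s. (pderiv ^^ i) (P s)) x) \<le> K i * B"
    using inverse_inequality[of ?n, where 'd = 'd] by metis
  let ?K = "\<Sum>i\<le>kJ. K i"
  have "((b - a) / 2) ^ j * norm (hderiv {a..b} j (fdiff V) (Tmap a b x)) \<le> \<bar>C2\<bar> * ?K * errI V a b"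
    if adm: "admissible_interval t0 T a b" and V: "V \<in> VPdeg (int r)"
      and xj: "(x, j) \<in> Dapp k tI KI KtI" and j: "j \<le> kJ" for a b V x j
  proof -
    note int = interval[OF adm]
    let ?h = "(b - a) / 2" and ?s = "Tmap a b x"
    have x: "x \<in> {-1..1}" by (rule Dapp_range[OF tI_range xj])
    have s: "?s \<in> {a..b}" by (rule Tmap_in[OF int(1) x])
    have E0: "0 \<le> errI V a b"
      using supn_nonneg[OF int(1) continuous_errors[OF adm V]]
        supn_nonneg[OF int(1) continuous_errors[OF adm Iu_interpolates(1)[OF adm]]] by (rule add_nonneg_nonneg)
    obtain R where R: "\<And>s. degree (R s) \<le> r" "\<And>x. vpoly R x = V (Tmap a b x)"
      using VPdeg_Tmap[OF int(1) V] by blast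
    obtain Q where Q: "\<And>s. degree (Q s) \<le> ?n" "\<And>x. vpoly Q x = Iu a b (Tmap a b x)"
      using VPdeg_Tmap[OF int(1) Iu_interpolates(1)[OF adm]] by blast
    let ?P = "\<lambda>s. R s - Q s"
    have deg: "\<forall>s. degree (?P s) \<le> ?n"
      by (intro allI degree_diff_le Q(1) order_trans[OF R(1)]) simp
    have bnd: "\<forall>y\<in>{-1..1}. norm (vpoly ?P y) \<le> errI V a b"
    proof
      fix y :: real assume y: "y \<in> {-1..1}"
      have "vpoly ?P y = (u (Tmap a b y) - Iu a b (Tmap a b y)) - (u (Tmap a b y) - V (Tmap a b y))"
        unfolding diff_diff_eq2 R(2)[symmetric] Q(2)[symmetric] by (simp add: vec_eq_iff)
      then have "norm (vpoly ?P y) \<le> norm (u (Tmap a b y) - Iu a b (Tmap a b y)) + norm (u (Tmap a b y) - V (Tmap a b y))"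
        by (simp only: norm_triangle_ineq4)
      also have "\<dots> \<le> supn {a<..b} (\<lambda>t. u t - Iu a b t) + supn {a<..b} (\<lambda>t. u t - V t)"
        using Tmap_in[OF int(1) y]
        by (intro add_mono norm_le_supn[OF int(1) continuous_errors[OF adm Iu_interpolates(1)[OF adm]]]
            norm_le_supn[OF int(1) continuous_errors[OF adm V]])
      finally show "norm (vpoly ?P y) \<le> errI V a b" by simp
    qed
    have l: "?h ^ j * norm (hderiv {a..b} l (\<lambda>t. V t - u t) ?s) \<le> K l * errI V a b" if l: "l \<le> j" for l
    proof -
      have CV: "Ck_on {a..b} l V" by (rule Cinf_on_imp_Ck_on[OF Cinf_on_VPdeg[OF int(1) V]])
      have "hderiv {a..b} l (\<lambda>t. V t - u t) ?s = hderiv {a..b} l V ?s - hderiv {a..b} l (Iu a b) ?s"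
        using hderiv_diff[OF int(1) CV Cinf_on_imp_Ck_on[OF u_Cinf[OF adm]] le_refl s]
          Iu_interpolates(2)[OF adm Dapp_downward[OF xj l]] by simp
      then have eq: "?h ^ l *\<^sub>R hderiv {a..b} l (\<lambda>t. V t - u t) ?s = vpoly (\<lambda>s. (pderiv ^^ l) (?P s)) x"
        using hderiv_VPdeg_Tmap[OF int(1) V R(2) x, of l] hderiv_VPdeg_Tmap[OF int(1) Iu_interpolates(1)[OF adm] Q(2) x, of l]
        by (simp add: higher_pderiv_diff vec_eq_iff right_diff_distrib)
      have "?h ^ l * norm (hderiv {a..b} l (\<lambda>t. V t - u t) ?s) = norm (?h ^ l *\<^sub>R hderiv {a..b} l (\<lambda>t. V t - u t) ?s)"
        using int(1) by simp
      also have "\<dots> = norm (vpoly (\<lambda>s. (pderiv ^^ l) (?P s)) x)" by (simp only: eq)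
      also have "\<dots> \<le> K l * errI V a b" by (rule K(2)[OF deg bnd x])
      finally have "?h ^ l * norm (hderiv {a..b} l (\<lambda>t. V t - u t) ?s) \<le> K l * errI V a b" .
      \<comment> \<open>(A4) brings in lower orders l with the power j of the step size; as (b -
        a)/2 \<le> 1 this only helps.\<close>
      moreover have "?h ^ j \<le> ?h ^ l" using int(4,5) l by (intro power_decreasing) auto
      ultimately show ?thesis using mult_right_mono[of "?h ^ j" "?h ^ l" "norm (hderiv {a..b} l (\<lambda>t. V t - u t) ?s)"] by simp
    qed
    have "?h ^ j * norm (hderiv {a..b} j (fdiff V) ?s)
        \<le> ?h ^ j * (\<bar>C2\<bar> * (\<Sum>l\<le>j. norm (hderiv {a..b} l (\<lambda>t. V t - u t) ?s)))"
      using int(4) by (intro mult_left_mono fdiff_le[OF adm V s j]) auto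
    also have "\<dots> = \<bar>C2\<bar> * (\<Sum>l\<le>j. ?h ^ j * norm (hderiv {a..b} l (\<lambda>t. V t - u t) ?s))"
      by (simp only: sum_distrib_left mult_ac)
    also have "\<dots> \<le> \<bar>C2\<bar> * (\<Sum>l\<le>j. K l * errI V a b)"
      by (intro mult_left_mono sum_mono l) auto
    also have "\<dots> \<le> \<bar>C2\<bar> * (\<Sum>l\<le>kJ. K l * errI V a b)"
      using j K(1) E0 by (intro mult_left_mono sum_mono2) auto
    also have "\<dots> = \<bar>C2\<bar> * ?K * errI V a b" by (simp only: sum_distrib_right mult.assoc)
    finally show ?thesis .
  qed
  moreover have "0 \<le> \<bar>C2\<bar> * ?K" using K(1) by (intro mult_nonneg_nonneg sum_nonneg) auto
  ultimately show ?thesis by blast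
qed

text \<open>The payoff of the truncation: the remaining orders are at most \<open>max kI kc\<close>,
  hence within kJ, and the nodes are Hermite nodes, so \<open>pointwise_bound\<close> covers every
  point term.\<close>

lemma consistency_bound:
  "\<exists>C\<ge>0. \<forall>a b V m. admissible_interval t0 T a b \<longrightarrow> V \<in> VPdeg (int r) \<longrightarrow> m \<le> r \<longrightarrow>
    norm (vecF Ih (\<lambda>x. x ^ m *\<^sub>R locOp Ic a b (fdiff V) (Tmap a b x))) \<le> C * errI V a b"
proof -
  obtain C where C: "C \<ge> 0" "\<And>a b V x j. admissible_interval t0 T a b \<Longrightarrow> V \<in> VPdeg (int r) \<Longrightarrow> (x, j) \<in> Dapp k tI KI KtI \<Longrightarrow> j \<le> kJ \<Longrightarrow>
     ((b - a) / 2) ^ j * norm (hderiv {a..b} j (fdiff V) (Tmap a b x)) \<le> C * errI V a b"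
    using pointwise_bound by blast
  obtain D where D: "D \<ge> 0" "\<And>a b (w :: real \<Rightarrow> real ^ 'd) m. admissible_interval t0 T a b \<Longrightarrow> Cinf_on {a..b} w \<Longrightarrow> m \<le> r \<Longrightarrow>
    norm (vecF Ih (\<lambda>x. x ^ m *\<^sub>R locOp Ic a b w (Tmap a b x)))
      \<le> D * (pt_terms a b tI KI (\<lambda>m. min (KtI m) (max kI kc)) w + supn {a<..b} w)"
    using quadrature_bound by blast
  let ?N = "\<Sum>m\<le>KI. \<Sum>j\<le>min (KtI m) (max kI kc). C"
  have "norm (vecF Ih (\<lambda>x. x ^ m *\<^sub>R locOp Ic a b (fdiff V) (Tmap a b x))) \<le> D * (?N + \<bar>C2\<bar>) * errI V a b"
    if adm: "admissible_interval t0 T a b" and V: "V \<in> VPdeg (int r)" and m: "m \<le> r" for a b V m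
  proof -
    note int = interval[OF adm]
    have I0: "0 \<le> supn {a<..b} (\<lambda>t. u t - Iu a b t)"
      by (rule supn_nonneg[OF int(1) continuous_errors[OF adm Iu_interpolates(1)[OF adm]]])
    have "pt_terms a b tI KI (\<lambda>m. min (KtI m) (max kI kc)) (fdiff V)
        \<le> (\<Sum>m\<le>KI. \<Sum>j\<le>min (KtI m) (max kI kc). C * errI V a b)"
      unfolding pt_terms_def by (intro sum_mono C(2)[OF adm V]) (auto simp: Dapp_def)
    also have "\<dots> = ?N * errI V a b" by (simp only: sum_distrib_right)
    finally have 1: "pt_terms a b tI KI (\<lambda>m. min (KtI m) (max kI kc)) (fdiff V) \<le> ?N * errI V a b" .
    have 2: "supn {a<..b} (fdiff V) \<le> \<bar>C2\<bar> * errI V a b"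
      using I0 by (intro order_trans[OF supn_fdiff[OF adm V]] mult_left_mono) auto
    have "norm (vecF Ih (\<lambda>x. x ^ m *\<^sub>R locOp Ic a b (fdiff V) (Tmap a b x)))
        \<le> D * (pt_terms a b tI KI (\<lambda>m. min (KtI m) (max kI kc)) (fdiff V) + supn {a<..b} (fdiff V))"
      by (rule D(2)[OF adm Cinf_fdiff(3)[OF adm V] m])
    also have "\<dots> \<le> D * (?N * errI V a b + \<bar>C2\<bar> * errI V a b)"
      by (intro mult_left_mono add_mono 1 2 D(1))
    also have "\<dots> = D * (?N + \<bar>C2\<bar>) * errI V a b" by (simp only: distrib_right mult.assoc)
    finally show ?thesis .
  qed
  moreover have "0 \<le> D * (?N + \<bar>C2\<bar>)" using C(1) D(1) by (intro mult_nonneg_nonneg add_nonneg_nonneg sum_nonneg) auto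
  ultimately show ?thesis by blast
qed

text \<open>No value is prescribed at the right end point, so the entry \<open>0\<close> there is junk.\<close>

definition solves_step :: "real \<Rightarrow> real \<Rightarrow> real ^ 'd \<Rightarrow> (real \<Rightarrow> real ^ 'd) \<Rightarrow> bool" where
  "solves_step a b c V \<longleftrightarrow> V \<in> VPdeg (int r) \<and>
    step_conditions a b (\<lambda>i. case i of 0 \<Rightarrow> c | Suc i \<Rightarrow> hderiv {a..b} i (\<lambda>t. f t (V t)) a)
      (\<lambda>i. case i of 0 \<Rightarrow> 0 | Suc i \<Rightarrow> hderiv {a..b} i (\<lambda>t. f t (V t)) b)
      (locOp Ic a b (\<lambda>t. f t (V t))) c V"

text \<open>The constant polynomial with value u(a) - c cancels c - u(a) in the entry for the left
  value if k \<ge> 1 and in all moments if k = 0; it does not affect the other entries. What is left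
  has a factor (b - a)/2 throughout.\<close>

lemma step_data_difference:
  assumes adm: "admissible_interval t0 T a b" and V: "solves_step a b c V"
    and R: "\<And>x. vpoly R x = V (Tmap a b x)" and S: "\<And>x. vpoly S x = Ju a b (Tmap a b x)"
    and j: "(p, i) \<in> J_index r k"
  shows "(\<chi> s. J_functional k Ih (p, i) (R s - S s + [:(u a - c) $ s:])) =
    (if p = 0 then (case i of 0 \<Rightarrow> 0 | Suc i \<Rightarrow> ((b - a) / 2) ^ Suc i *\<^sub>R hderiv {a..b} i (fdiff V) a)
     else if p = 1 then (case i of 0 \<Rightarrow> 0 | Suc i \<Rightarrow> ((b - a) / 2) ^ Suc i *\<^sub>R hderiv {a..b} i (fdiff V) b)
     else ((b - a) / 2) *\<^sub>R vecF Ih (\<lambda>x. x ^ i *\<^sub>R locOp Ic a b (fdiff V) (Tmap a b x)))"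
proof -
  interpret J: unisolvent "J_index r k" r "J_functional k Ih" by (rule unisolvent_J)
  note int = interval[OF adm]
  note uC = u_Cinf[OF adm]
  have Vd: "V \<in> VPdeg (int r)" using V by (simp add: solves_step_def)
  note fC = Cinf_fdiff[OF adm Vd]
  have G: "Ck_on {a..b} l (locOp Ic a b w)" if "Cinf_on {a..b} w" for l and w :: "real \<Rightarrow> real ^ 'd"
    by (rule Cinf_on_imp_Ck_on[OF Cinf_on_locOp[OF Ic_ok int(1) that]])
  note u'C = Cinf_on_hderiv_1[OF int(1) uC]
  have JR: "J_functional k Ih (p, i) (R s) = step_data a b (\<lambda>i. case i of 0 \<Rightarrow> c | Suc i \<Rightarrow> hderiv {a..b} i (\<lambda>t. f t (V t)) a)
      (\<lambda>i. case i of 0 \<Rightarrow> 0 | Suc i \<Rightarrow> hderiv {a..b} i (\<lambda>t. f t (V t)) b)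
      (locOp Ic a b (\<lambda>t. f t (V t))) c (p, i) $ s" for s
    using V j unfolding solves_step_def step_conditions_iff[OF int(1) G[OF fC(1)] Vd R] by blast
  have JJ: "Ju a b \<in> VPdeg (int r)" "step_conditions a b (\<lambda>i. hderiv {a..b} i u a) (\<lambda>i. hderiv {a..b} i u b)
      (locOp Ic a b (hderiv {a..b} 1 u)) (u a) (Ju a b)"
    using Jop_isJ[OF int(1) Ic_ok uC] unfolding isJ_iff by blast+
  have JS: "J_functional k Ih (p, i) (S s) = step_data a b (\<lambda>i. hderiv {a..b} i u a) (\<lambda>i. hderiv {a..b} i u b)
      (locOp Ic a b (hderiv {a..b} 1 u)) (u a) (p, i) $ s" for s
    using JJ(2) j unfolding step_conditions_iff[OF int(1) G[OF u'C] JJ(1) S] by blast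
  have eq: "J_functional k Ih (p, i) (R s - S s + [:(u a - c) $ s:]) =
      J_functional k Ih (p, i) (R s) - J_functional k Ih (p, i) (S s) + J_functional k Ih (p, i) [:(u a - c) $ s:]" for s
    by (simp only: J.add[OF j] J.diff[OF j])
  have hd: "hderiv {a..b} l (\<lambda>t. f t (V t)) x - hderiv {a..b} (Suc l) u x = hderiv {a..b} l (fdiff V) x"
    if "x \<in> {a..b}" for x l
    unfolding hderiv_u[OF adm that]
    using hderiv_diff[OF int(1) Cinf_on_imp_Ck_on[OF fC(1)] Cinf_on_imp_Ck_on[OF fC(2)] le_refl that] by simp
  have ends: "a \<in> {a..b}" "b \<in> {a..b}" using int(1) by auto
  consider "p = 0" "i = 0" | l where "p = 0" "i = Suc l" | l where "p = 1" "i = Suc l" | "p = 2"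
    using j by (cases i) (auto simp: J_index_def)
  then show ?thesis
  proof cases
    case 1
    then show ?thesis unfolding eq JR JS by (simp add: step_data_def J_functional_const vec_eq_iff)
  next
    case 2
    then show ?thesis unfolding eq JR JS
      by (simp add: step_data_def J_functional_const vec_eq_iff right_diff_distrib hd[OF ends(1), symmetric]
          del: hderiv.simps(2))
  next
    case 3
    then show ?thesis unfolding eq JR JS
      by (simp add: step_data_def J_functional_const vec_eq_iff right_diff_distrib hd[OF ends(2), symmetric]
          del: hderiv.simps(2))
  next
    case 4
    let ?v = "\<lambda>w. vecF Ih (\<lambda>x. x ^ i *\<^sub>R locOp Ic a b w (Tmap a b x))"
    have C: "Ck_on {-1..1} kI (\<lambda>x. x ^ i *\<^sub>R locOp Ic a b w (Tmap a b x))" if "Cinf_on {a..b} w" for w :: "real \<Rightarrow> real ^ 'd"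
      by (rule Ck_on_power_scaleR[OF _ Ck_on_Tmap[OF int(1) G[OF that]]]) simp
    have "?v (\<lambda>t. f t (V t)) - ?v (hderiv {a..b} 1 u) = vecF Ih (\<lambda>x. x ^ i *\<^sub>R locOp Ic a b (\<lambda>t. f t (V t)) (Tmap a b x)
        - x ^ i *\<^sub>R locOp Ic a b (hderiv {a..b} 1 u) (Tmap a b x))"
      by (rule vecF_diff[OF Ih_ok C[OF fC(1)] C[OF u'C], symmetric])
    also have "\<dots> = ?v (fdiff V)"
    proof (rule vecF_cong[OF Ih_ok _ C[OF fC(3)]])
      show "Ck_on {-1..1} kI (\<lambda>x. x ^ i *\<^sub>R locOp Ic a b (\<lambda>t. f t (V t)) (Tmap a b x)
        - x ^ i *\<^sub>R locOp Ic a b (hderiv {a..b} 1 u) (Tmap a b x))"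
        by (rule Ck_on_diff[OF _ C[OF fC(1)] C[OF u'C]]) simp
      fix x :: real assume "x \<in> {-1..1}"
      then have t: "Tmap a b x \<in> {a..b}" by (rule Tmap_in[OF int(1)])
      \<comment> \<open>The projection uses u' and the method uses f; the differential equation
        identifies them on [a,b].\<close>
      have "locOp Ic a b (hderiv {a..b} 1 u) (Tmap a b x) = locOp Ic a b (\<lambda>t. f t (u t)) (Tmap a b x)"
        by (rule locOp_cong[OF Ic_ok int(1) Cinf_on_imp_Ck_on[OF u'C] Cinf_on_imp_Ck_on[OF fC(2)] _ t])
          (use hderiv_u[OF adm, of _ 0] in simp)
      then show "x ^ i *\<^sub>R locOp Ic a b (\<lambda>t. f t (V t)) (Tmap a b x)
        - x ^ i *\<^sub>R locOp Ic a b (hderiv {a..b} 1 u) (Tmap a b x) = x ^ i *\<^sub>R locOp Ic a b (fdiff V) (Tmap a b x)"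
        using locOp_diff[OF Ic_ok int(1) Cinf_on_imp_Ck_on[OF fC(1)] Cinf_on_imp_Ck_on[OF fC(2)] t]
        by (simp add: scaleR_diff_right)
    qed
    finally have v: "?v (\<lambda>t. f t (V t)) - ?v (hderiv {a..b} 1 u) = ?v (fdiff V)" .
    have sd: "step_data a b \<alpha> \<beta> (locOp Ic a b w) c' (p, i)
        = ((b - a) / 2) *\<^sub>R ?v w + (if k = 0 then (-1) ^ i *\<^sub>R c' else 0)" for \<alpha> \<beta> w c'
      using 4 by (simp add: step_data_def)
    have const: "J_functional k Ih (p, i) [:x:] = (if k = 0 then x * (-1) ^ i else 0)" for x
      using 4 by (simp add: J_functional_const)
    have "(\<chi> s. J_functional k Ih (p, i) (R s - S s + [:(u a - c) $ s:]))
        = ((b - a) / 2) *\<^sub>R (?v (\<lambda>t. f t (V t)) - ?v (hderiv {a..b} 1 u))"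
      unfolding eq JR JS sd const
      by (simp add: vec_eq_iff right_diff_distrib diff_divide_distrib mult.commute[of _ "(-1) ^ i"])
    then show ?thesis unfolding v using 4 by simp
  qed
qed

text \<open>All data are of size (b - a) times \<open>errI V a b\<close>, hence so is the polynomial
  on [-1,1] together with its derivative. Going back to [a,b] divides the derivative by (b - a)/2,
  which uses up the gain.\<close>

lemma local_error:
  "\<exists>C\<ge>0. \<forall>a b c V t. admissible_interval t0 T a b \<longrightarrow> solves_step a b c V \<longrightarrow> t \<in> {a..b} \<longrightarrow>
     norm (V t - Ju a b t + (u a - c)) \<le> C * ((b - a) * errI V a b) \<and>
     norm (hderiv {a..b} 1 V t - hderiv {a..b} 1 (Ju a b) t) \<le> C * errI V a b"
proof -
  interpret J: unisolvent "J_index r k" r "J_functional k Ih" by (rule unisolvent_J)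
  obtain C where C: "C \<ge> 0" "\<And>a b V x j. admissible_interval t0 T a b \<Longrightarrow> V \<in> VPdeg (int r) \<Longrightarrow> (x, j) \<in> Dapp k tI KI KtI \<Longrightarrow> j \<le> kJ \<Longrightarrow>
     ((b - a) / 2) ^ j * norm (hderiv {a..b} j (fdiff V) (Tmap a b x)) \<le> C * errI V a b"
    using pointwise_bound by blast
  obtain D where D: "D \<ge> 0" "\<And>a b V m. admissible_interval t0 T a b \<Longrightarrow> V \<in> VPdeg (int r) \<Longrightarrow> m \<le> r \<Longrightarrow>
    norm (vecF Ih (\<lambda>x. x ^ m *\<^sub>R locOp Ic a b (fdiff V) (Tmap a b x))) \<le> D * errI V a b"
    using consistency_bound by blast
  obtain K where K: "\<And>i. K i \<ge> 0" "\<And>i (P :: 'd \<Rightarrow> real poly) x. (\<forall>s. degree (P s) \<le> r) \<Longrightarrow> x \<in> {-1..1} \<Longrightarrow>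
     norm (vpoly (\<lambda>s. (pderiv ^^ i) (P s)) x) \<le> K i * (\<Sum>j\<in>J_index r k. norm (\<chi> s. J_functional k Ih j (P s)))"
    using J.vpoly_bound[where 'd = 'd] by metis
  let ?M = "real (Suc r) * (C + D)"
  let ?C = "(K 0 + K 1) * ?M"
  have "norm (V t - Ju a b t + (u a - c)) \<le> ?C * ((b - a) * errI V a b) \<and>
     norm (hderiv {a..b} 1 V t - hderiv {a..b} 1 (Ju a b) t) \<le> ?C * errI V a b"
    if adm: "admissible_interval t0 T a b" and V: "solves_step a b c V" and t: "t \<in> {a..b}" for a b c V t
  proof -
    note int = interval[OF adm]
    let ?h = "(b - a) / 2"
    have Vd: "V \<in> VPdeg (int r)" using V by (simp add: solves_step_def)
    have Jd: "Ju a b \<in> VPdeg (int r)" using Jop_isJ[OF int(1) Ic_ok u_Cinf[OF adm]] unfolding isJ_iff by blast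
    have E0: "0 \<le> errI V a b"
      using supn_nonneg[OF int(1) continuous_errors[OF adm Vd]]
        supn_nonneg[OF int(1) continuous_errors[OF adm Iu_interpolates(1)[OF adm]]] by (rule add_nonneg_nonneg)
    obtain R where R: "\<And>s. degree (R s) \<le> r" "\<And>x. vpoly R x = V (Tmap a b x)"
      using VPdeg_Tmap[OF int(1) Vd] by blast
    obtain S where S: "\<And>s. degree (S s) \<le> r" "\<And>x. vpoly S x = Ju a b (Tmap a b x)"
      using VPdeg_Tmap[OF int(1) Jd] by blast
    let ?F = "\<lambda>s. R s - S s + [:(u a - c) $ s:]"
    have deg: "\<forall>s. degree (?F s) \<le> r"
      using R(1) S(1) by (auto intro!: degree_add_le degree_diff_le)
    have "norm (\<chi> s. J_functional k Ih j (?F s)) \<le> ?h * ((C + D) * errI V a b)" if j: "j \<in> J_index r k" for j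
    proof -
      have CD: "C * errI V a b \<le> (C + D) * errI V a b" "D * errI V a b \<le> (C + D) * errI V a b"
        using C(1) D(1) E0 by (auto intro!: mult_right_mono)
      have 0: "0 \<le> ?h * ((C + D) * errI V a b)" using C(1) D(1) E0 int(4) by (intro mult_nonneg_nonneg) auto
      \<comment> \<open>A condition on the derivative of V of order l + 1 involves f only to order
        l, so one power of the step size is left over.\<close>
      have pt: "norm (?h ^ Suc l *\<^sub>R hderiv {a..b} l (fdiff V) (Tmap a b x)) \<le> ?h * ((C + D) * errI V a b)"
        if "(x, l) \<in> Dapp k tI KI KtI" "l \<le> kJ" for x l
      proof -
        have "?h * (?h ^ l * norm (hderiv {a..b} l (fdiff V) (Tmap a b x))) \<le> ?h * ((C + D) * errI V a b)"
          using int(4) order_trans[OF C(2)[OF adm Vd that] CD(1)] by (intro mult_left_mono) auto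
        then show ?thesis using int(4) by (simp add: mult.assoc abs_mult)
      qed
      obtain p i where pi: "j = (p, i)" by (cases j)
      note eq = step_data_difference[OF adm V R(2) S(2) j[unfolded pi]]
      consider "p = 0" "i = 0" | l where "p = 0" "i = Suc l" "Suc l < (k + 1) div 2"
        | l where "p = 1" "i = Suc l" "Suc l \<le> k div 2" | "p = 2" "i \<le> r"
        using j unfolding pi by (cases i) (auto simp: J_index_def)
      then show ?thesis
      proof cases
        case 1
        then show ?thesis unfolding pi eq using 0 by simp
      next
        case 2
        \<comment> \<open>The orders of f at the left end point are one less than those of V, which
          places them among the Hermite conditions and within kJ.\<close>
        then have "l < (k - 1) div 2" by linarith
        then have "(-1, l) \<in> Dapp k tI KI KtI" "l \<le> kJ" by (auto simp: Dapp_def)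
        from pt[OF this] show ?thesis unfolding pi eq using 2 by simp
      next
        case 3
        then have "(1, l) \<in> Dapp k tI KI KtI" "l \<le> kJ" by (auto simp: Dapp_def)
        from pt[OF this] show ?thesis unfolding pi eq using 3 by simp
      next
        case 4
        have "?h * norm (vecF Ih (\<lambda>x. x ^ i *\<^sub>R locOp Ic a b (fdiff V) (Tmap a b x))) \<le> ?h * ((C + D) * errI V a b)"
          using int(4) order_trans[OF D(2)[OF adm Vd 4(2)] CD(2)] by (intro mult_left_mono) auto
        then show ?thesis unfolding pi eq using 4 int(4) by (simp add: abs_mult)
      qed
    qed
    then have "(\<Sum>j\<in>J_index r k. norm (\<chi> s. J_functional k Ih j (?F s))) \<le> real (card (J_index r k)) * (?h * ((C + D) * errI V a b))"
      by (rule sum_bounded_above)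
    then have sum: "(\<Sum>j\<in>J_index r k. norm (\<chi> s. J_functional k Ih j (?F s))) \<le> ?h * (?M * errI V a b)" (is "?S \<le> _")
      by (simp only: J.card_J mult_ac)
    let ?x = "Tinv a b t"
    have x: "?x \<in> {-1..1}" by (rule Tinv_in[OF int(1) t])
    have M0: "0 \<le> ?M * errI V a b" using C(1) D(1) E0 by (intro mult_nonneg_nonneg) auto
    have b: "norm (vpoly (\<lambda>s. (pderiv ^^ i) (?F s)) ?x) \<le> ?h * (?C * errI V a b)" if "i = 0 \<or> i = 1" for i
    proof -
      have "norm (vpoly (\<lambda>s. (pderiv ^^ i) (?F s)) ?x) \<le> K i * ?S" using deg x by (rule K(2)[of ?F])
      also have "\<dots> \<le> (K 0 + K 1) * (?h * (?M * errI V a b))"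
        using that K(1)[of 0] K(1)[of 1] M0 int(4) by (intro mult_mono sum) (auto intro!: sum_nonneg)
      finally show ?thesis by (simp only: mult_ac)
    qed
    have "vpoly ?F ?x = V t - Ju a b t + (u a - c)"
      using R(2)[of ?x] S(2)[of ?x] int(1) by (simp add: vec_eq_iff)
    then have 1: "norm (V t - Ju a b t + (u a - c)) \<le> ?h * (?C * errI V a b)" using b[of 0] by simp
    have "?C * errI V a b \<ge> 0" 
      using mult_nonneg_nonneg[OF add_nonneg_nonneg[OF K(1)[of 0] K(1)[of 1]] M0] by (simp only: mult.assoc)
    then have "?h * (?C * errI V a b) \<le> (b - a) * (?C * errI V a b)" using int(1) by (intro mult_right_mono) auto
    then have 2: "norm (V t - Ju a b t + (u a - c)) \<le> ?C * ((b - a) * errI V a b)" using 1 by (simp only: mult_ac)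
    \<comment> \<open>Differentiation removes the added constant, so no error from the left enters
      the derivative estimate directly.\<close>
    have "vpoly (\<lambda>s. (pderiv ^^ 1) (?F s)) ?x = vpoly (\<lambda>s. (pderiv ^^ 1) (R s)) ?x - vpoly (\<lambda>s. (pderiv ^^ 1) (S s)) ?x"
      by (simp add: vec_eq_iff pderiv_add pderiv_diff pderiv_pCons)
    also have "\<dots> = ?h *\<^sub>R (hderiv {a..b} 1 V t - hderiv {a..b} 1 (Ju a b) t)"
      using hderiv_VPdeg_Tmap[OF int(1) Vd R(2) x, of 1] hderiv_VPdeg_Tmap[OF int(1) Jd S(2) x, of 1] int(1)
      by (simp add: scaleR_diff_right)
    finally have "?h * norm (hderiv {a..b} 1 V t - hderiv {a..b} 1 (Ju a b) t) \<le> ?h * (?C * errI V a b)"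
      using b[of 1] int(4) by (simp del: hderiv.simps)
    then have "norm (hderiv {a..b} 1 V t - hderiv {a..b} 1 (Ju a b) t) \<le> ?C * errI V a b"
      using int(4) by (simp only: mult_le_cancel_left_pos)
    with 2 show ?thesis by blast
  qed
  moreover have "0 \<le> ?C" using C(1) D(1) K(1)[of 0] K(1)[of 1] by (intro mult_nonneg_nonneg add_nonneg_nonneg) auto
  ultimately show ?thesis by blast
qed

end

subsection \<open>Error propagation\<close>

text \<open>Since 1 + x \<le> exp x, the growth factors multiply to one exponential of the total
  length; all sources are charged with the full exponential.\<close>

lemma discrete_Gronwall:
  fixes e g h :: "nat \<Rightarrow> real"
  assumes "0 \<le> c" "e 0 \<le> 0" "\<And>i. i \<in> {1..n} \<Longrightarrow> 0 \<le> h i" "\<And>i. i \<in> {1..n} \<Longrightarrow> 0 \<le> g i"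
    and "\<And>i. i \<in> {1..n} \<Longrightarrow> e i \<le> (1 + c * h i) * e (i - 1) + g i"
  shows "e n \<le> exp (c * (\<Sum>i=1..n. h i)) * (\<Sum>i=1..n. g i)"
  using assms(3-5)
proof (induction n)
  case (Suc n)
  let ?E = "exp (c * (\<Sum>i=1..n. h i))" and ?G = "\<Sum>i=1..n. g i"
  have IH: "e n \<le> ?E * ?G" using Suc by simp
  have h: "0 \<le> h (Suc n)" "0 \<le> g (Suc n)" and G: "0 \<le> ?G" and H: "0 \<le> (\<Sum>i=1..n. h i)"
    using Suc.prems by (auto intro!: sum_nonneg)
  have "e (Suc n) \<le> (1 + c * h (Suc n)) * e n + g (Suc n)" using Suc.prems(3)[of "Suc n"] by simp
  also have "\<dots> \<le> exp (c * h (Suc n)) * (?E * ?G) + exp (c * (\<Sum>i=1..Suc n. h i)) * g (Suc n)"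
  proof (rule add_mono)
    have "(1 + c * h (Suc n)) * e n \<le> (1 + c * h (Suc n)) * (?E * ?G)"
      using IH assms(1) h by (intro mult_left_mono) auto
    also have "\<dots> \<le> exp (c * h (Suc n)) * (?E * ?G)"
      using G by (intro mult_right_mono exp_ge_add_one_self) auto
    finally show "(1 + c * h (Suc n)) * e n \<le> exp (c * h (Suc n)) * (?E * ?G)" .
    have "1 \<le> exp (c * (\<Sum>i=1..Suc n. h i))" using assms(1) h H by simp
    then show "g (Suc n) \<le> exp (c * (\<Sum>i=1..Suc n. h i)) * g (Suc n)"
      using h(2) mult_right_mono[of 1 _ "g (Suc n)"] by simp
  qed
  also have "exp (c * h (Suc n)) * (?E * ?G) = exp (c * (\<Sum>i=1..Suc n. h i)) * ?G"
    by (simp add: distrib_left exp_add)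
  finally show ?case by (simp add: distrib_left)
qed (use assms(2) in simp)

lemma le_maxz: "finite A \<Longrightarrow> \<nu> \<in> A \<Longrightarrow> g \<nu> \<le> maxz A g"
  by (auto simp: maxz_def)

lemma maxz_nonneg: "finite A \<Longrightarrow> (\<And>\<nu>. \<nu> \<in> A \<Longrightarrow> 0 \<le> g \<nu>) \<Longrightarrow> 0 \<le> maxz A g"
  by (cases "A = {}") (auto simp: maxz_def Max_ge_iff)

lemma mesh_bounds:
  assumes "mesh t0 T \<tau>0 tm N" "n \<le> N"
  shows "t0 \<le> tm n" "tm n \<le> t0 + T"
proof -
  have step: "tm i \<le> tm (Suc i)" if "i < N" for i
  proof -
    have "Suc i \<in> {1..N}" using that by simp
    then have "tm (Suc i - 1) < tm (Suc i)" using assms(1) unfolding mesh_def by blast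
    then show ?thesis by simp
  qed
  have "j \<le> N \<Longrightarrow> i \<le> j \<Longrightarrow> tm i \<le> tm j" for i j
  proof (induction j)
    case (Suc j)
    show ?case
    proof (cases "i = Suc j")
      case False
      then have "tm i \<le> tm j" using Suc by simp
      then show ?thesis using step[of j] Suc.prems(1) by simp
    qed simp
  qed simp
  then have "tm 0 \<le> tm n" "tm n \<le> tm N" using assms(2) by auto
  then show "t0 \<le> tm n" "tm n \<le> t0 + T" using assms(1) by (auto simp: mesh_def)
qed

lemma mesh_admissible:
  assumes "mesh t0 T \<tau>0 tm N" "n \<in> {1..N}"
  shows "admissible_interval t0 T (tm (n - 1)) (tm n)"
  using mesh_bounds[OF assms(1), of "n - 1"] mesh_bounds[OF assms(1), of n] assms
  by (auto simp: admissible_interval_def mesh_def)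

lemma sum_mesh_widths:
  fixes tm :: "nat \<Rightarrow> real"
  shows "(\<Sum>\<nu>=1..n. tm \<nu> - tm (\<nu> - 1)) = tm n - tm 0"
  by (induction n) auto

context variational_scheme
begin

text \<open>Puts the method in the shape shared with the projection: for k = 0 the part of the jump
  term with the value from the left moves to the right-hand side.\<close>

lemma method_M_solves_step:
  assumes M: "method_M r k Ih Ic f u0 tm N U" and n: "n \<in> {1..N}"
  shows "solves_step (tm (n - 1)) (tm n) (if n = 1 then u0 else U (n - 1) (tm (n - 1))) (U n)"
proof -
  let ?a = "tm (n - 1)" and ?b = "tm n" and ?c = "if n = 1 then u0 else U (n - 1) (tm (n - 1))" and ?V = "U n"
  let ?S = "{?a..?b}" and ?f = "\<lambda>t. f t (U n t)"
  note m = M[unfolded method_M_def Let_def, rule_format, OF n]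
  have left: "hderiv ?S i ?V ?a = (case i of 0 \<Rightarrow> ?c | Suc i \<Rightarrow> hderiv ?S i ?f ?a)" if "i < (k + 1) div 2" for i
  proof (cases i)
    case 0
    then have "1 \<le> k" using that by (cases k) auto
    then show ?thesis using m 0 by simp
  next
    case (Suc l)
    then have "l < (k - 1) div 2" "3 \<le> k" using that by linarith+
    then have "hderiv ?S (Suc l) ?V ?a = hderiv ?S l ?f ?a" using m by blast
    then show ?thesis unfolding Suc nat.case .
  qed
  have right: "hderiv ?S i ?V ?b = (case i of 0 \<Rightarrow> 0 | Suc i \<Rightarrow> hderiv ?S i ?f ?b)" if i: "i \<in> {1..k div 2}" for i
  proof -
    obtain l where l: "i = Suc l" using i by (cases i) auto
    then have "l < k div 2" "2 \<le> k" using i by auto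
    then have "hderiv ?S (Suc l) ?V ?b = hderiv ?S l ?f ?b" using m by blast
    then show ?thesis unfolding l nat.case .
  qed
  have var: "locF Ih ?a ?b (\<lambda>t. inner (hderiv ?S 1 ?V t) (\<phi> t)) + (if k = 0 then inner (?V ?a) (\<phi> ?a) else 0)
      = locF Ih ?a ?b (\<lambda>t. inner (locOp Ic ?a ?b ?f t) (\<phi> t)) + (if k = 0 then inner ?c (\<phi> ?a) else 0)"
    if "\<phi> \<in> VPdeg (int r - int k)" for \<phi>
  proof -
    have "locF Ih ?a ?b (\<lambda>t. inner (hderiv ?S 1 ?V t) (\<phi> t)) + (if k = 0 then inner (?V ?a - ?c) (\<phi> ?a) else 0)
      = locF Ih ?a ?b (\<lambda>t. inner (locOp Ic ?a ?b ?f t) (\<phi> t))" using m that by blast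
    then show ?thesis 
      by (cases "k = 0") (simp_all add: inner_diff_left diff_eq_eq add_diff_eq del: hderiv.simps One_nat_def)
  qed
  show ?thesis
    unfolding solves_step_def step_conditions_def
    using m left right var by blast
qed

lemma error_estimate:
  assumes u_init: "u t0 = u0"
  shows "\<exists>\<tau>0 > 0. \<exists>C. \<forall>tm N U.
           mesh t0 T \<tau>0 tm N \<longrightarrow> method_M r k Ih Ic f u0 tm N U \<longrightarrow>
           (\<forall>n\<in>{1..N}. \<forall>l\<in>{0, 1}.
              supn {tm (n - 1)<..tm n} (hderiv {tm (n - 1)..tm n} l (\<lambda>t. u t - U n t))
              \<le> C * maxz {1..n} (\<lambda>\<nu>.
                     supn {tm (\<nu> - 1)<..tm \<nu>}
                       (\<lambda>t. u t - Iapp r k tI KI KtI sx (tm (\<nu> - 1)) (tm \<nu>) u t)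
                   + (\<Sum>j\<le>l. supn {tm (\<nu> - 1)<..tm \<nu>}
                       (hderiv {tm (\<nu> - 1)..tm \<nu>} j
                          (\<lambda>t. u t - Jop r k Ih Ic (tm (\<nu> - 1)) (tm \<nu>) u t))))
                + C * maxz {1..n - 1} (\<lambda>\<nu>.
                     norm (u (tm \<nu>) - Jop r k Ih Ic (tm (\<nu> - 1)) (tm \<nu>) u (tm \<nu>))
                     / (tm \<nu> - tm (\<nu> - 1))))"
proof -
  obtain L where L0: "L \<ge> 0" and L: "\<And>a b c V t. admissible_interval t0 T a b \<Longrightarrow> solves_step a b c V \<Longrightarrow> t \<in> {a..b} \<Longrightarrow>
     norm (V t - Ju a b t + (u a - c)) \<le> L * ((b - a) * errI V a b) \<and>
     norm (hderiv {a..b} 1 V t - hderiv {a..b} 1 (Ju a b) t) \<le> L * errI V a b"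
    using local_error by blast
  \<comment> \<open>Ensures L h \<le> 1/2 on every interval, so that the local error can be
    absorbed; adding 1 to L covers the case L = 0.\<close>
  define \<tau>0 where "\<tau>0 = 1 / (2 * (L + 1))"
  define E where "E = exp (2 * L * T)"
  \<comment> \<open>The first 2 bounds the contributions of the current interval, the rest is twice
    the Gronwall bound for the error transported from the left.\<close>
  define CA where "CA = 2 + 2 * (E * (T + 2 * L * T))"
  define C where "C = (1 + L) * (1 + CA)"
  have \<tau>0: "\<tau>0 > 0" using L0 by (simp add: \<tau>0_def)
  have E0: "E > 0" by (simp add: E_def)
  have CA0: "CA \<ge> 0" unfolding CA_def using E0 L0 T_pos by (intro add_nonneg_nonneg mult_nonneg_nonneg) auto
  have "supn {tm (n - 1)<..tm n} (hderiv {tm (n - 1)..tm n} l (\<lambda>t. u t - U n t))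
      \<le> C * maxz {1..n} (\<lambda>\<nu>. supn {tm (\<nu> - 1)<..tm \<nu>} (\<lambda>t. u t - Iu (tm (\<nu> - 1)) (tm \<nu>) t)
            + (\<Sum>j\<le>l. supn {tm (\<nu> - 1)<..tm \<nu>} (hderiv {tm (\<nu> - 1)..tm \<nu>} j (\<lambda>t. u t - Ju (tm (\<nu> - 1)) (tm \<nu>) t))))
        + C * maxz {1..n - 1} (\<lambda>\<nu>. norm (u (tm \<nu>) - Ju (tm (\<nu> - 1)) (tm \<nu>) (tm \<nu>)) / (tm \<nu> - tm (\<nu> - 1)))"
    (is "?lhs \<le> C * maxz {1..n} ?m1 + C * maxz {1..n - 1} ?m2")
    if mesh: "mesh t0 T \<tau>0 tm N" and M: "method_M r k Ih Ic f u0 tm N U" and n: "n \<in> {1..N}" and l: "l \<in> {0, 1}"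
    for tm N U n l
  proof -
    let ?J = "\<lambda>\<nu>. Ju (tm (\<nu> - 1)) (tm \<nu>)" and ?I = "\<lambda>\<nu>. Iu (tm (\<nu> - 1)) (tm \<nu>)"
    let ?h = "\<lambda>\<nu>. tm \<nu> - tm (\<nu> - 1)"
    let ?sup = "\<lambda>\<nu>. supn {tm (\<nu> - 1)<..tm \<nu>} :: (real \<Rightarrow> real ^ 'd) \<Rightarrow> real"
    let ?A = "\<lambda>\<nu>. ?sup \<nu> (\<lambda>t. u t - U \<nu> t)" and ?B = "\<lambda>\<nu>. ?sup \<nu> (\<lambda>t. u t - ?I \<nu> t)"
      and ?D = "\<lambda>\<nu>. ?sup \<nu> (\<lambda>t. u t - ?J \<nu> t)"
    let ?c = "\<lambda>\<nu>. if \<nu> = 1 then u0 else U (\<nu> - 1) (tm (\<nu> - 1))"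
    \<comment> \<open>\<open>e 0\<close> is the error of the initial value, which is exact; with
      this convention the first interval obeys the same recursion as the others.\<close>
    define e where "e \<nu> = (if \<nu> = 0 then 0 else norm (u (tm \<nu>) - U \<nu> (tm \<nu>)))" for \<nu>
    let ?d = "\<lambda>\<nu>. norm (u (tm \<nu>) - ?J \<nu> (tm \<nu>))"
    let ?m1 = "\<lambda>\<nu>. ?B \<nu> + (\<Sum>j\<le>l. ?sup \<nu> (hderiv {tm (\<nu> - 1)..tm \<nu>} j (\<lambda>t. u t - ?J \<nu> t)))"
    define m1 where "m1 = maxz {1..n} ?m1"
    define m2 where "m2 = maxz {1..n - 1} ?m2"
    have adm: "admissible_interval t0 T (tm (\<nu> - 1)) (tm \<nu>)" if "\<nu> \<in> {1..N}" for \<nu>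
      by (rule mesh_admissible[OF mesh that])
    note int = interval[OF adm]
    have sol: "solves_step (tm (\<nu> - 1)) (tm \<nu>) (?c \<nu>) (U \<nu>)" if "\<nu> \<in> {1..N}" for \<nu>
      by (rule method_M_solves_step[OF M that])
    have Ud: "U \<nu> \<in> VPdeg (int r)" if "\<nu> \<in> {1..N}" for \<nu>
      using sol[OF that] by (simp add: solves_step_def)
    have Jd: "?J \<nu> \<in> VPdeg (int r)" if "\<nu> \<in> {1..N}" for \<nu>
      using Jop_isJ[OF int(1)[OF that] Ic_ok u_Cinf[OF adm[OF that]]] unfolding isJ_iff by blast
    note contU = continuous_errors[OF adm Ud] and contJ = continuous_errors[OF adm Jd]
      and contI = continuous_errors[OF adm Iu_interpolates(1)[OF adm]]
    have A0: "0 \<le> ?A \<nu>" and B0: "0 \<le> ?B \<nu>" and D0: "0 \<le> ?D \<nu>" if "\<nu> \<in> {1..N}" for \<nu>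
      using supn_nonneg[OF int(1)[OF that] contU[OF that that]] supn_nonneg[OF int(1)[OF that] contI[OF that that]]
        supn_nonneg[OF int(1)[OF that] contJ[OF that that]] by blast+
    have prev: "norm (u (tm (\<nu> - 1)) - ?c \<nu>) = e (\<nu> - 1)" if "\<nu> \<in> {1..N}" for \<nu>
      using that mesh u_init by (auto simp: e_def mesh_def)
    have h: "0 < ?h \<nu>" "L * ?h \<nu> \<le> 1 / 2" if "\<nu> \<in> {1..N}" for \<nu>
    proof -
      show "0 < ?h \<nu>" using int(1)[OF that] by simp
      have "?h \<nu> \<le> \<tau>0" using mesh that by (auto simp: mesh_def)
      then have "L * ?h \<nu> \<le> L * \<tau>0" by (rule mult_left_mono[OF _ L0])
      also have "\<dots> \<le> 1 / 2" using L0 by (simp add: \<tau>0_def field_simps)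
      finally show "L * ?h \<nu> \<le> 1 / 2" .
    qed
    \<comment> \<open>The local estimate has \<open>?A \<nu>\<close> on both sides; with L h \<le>
      1/2 half of it is subtracted and the inequality doubled.\<close>
    have A: "?A \<nu> \<le> 2 * ?D \<nu> + 2 * e (\<nu> - 1) + ?B \<nu>" if \<nu>: "\<nu> \<in> {1..N}" for \<nu>
    proof -
      have "?A \<nu> \<le> ?D \<nu> + e (\<nu> - 1) + L * (?h \<nu> * (?A \<nu> + ?B \<nu>))"
      proof (rule supn_le_Ioc[OF int(1)[OF \<nu>]])
        fix t assume t: "t \<in> {tm (\<nu> - 1)..tm \<nu>}"
        let ?e = "u (tm (\<nu> - 1)) - ?c \<nu>"
        have "norm (u t - U \<nu> t) = norm ((u t - ?J \<nu> t) - (U \<nu> t - ?J \<nu> t + ?e) + ?e)" by simp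
        also have "\<dots> \<le> norm (u t - ?J \<nu> t) + norm (U \<nu> t - ?J \<nu> t + ?e) + norm ?e"
          by (intro norm_triangle_le add_right_mono norm_triangle_ineq4)
        also have "\<dots> \<le> ?D \<nu> + L * (?h \<nu> * (?A \<nu> + ?B \<nu>)) + e (\<nu> - 1)"
          using L[OF adm[OF \<nu>] sol[OF \<nu>] t] norm_le_supn[OF int(1)[OF \<nu>] contJ[OF \<nu> \<nu>] t] prev[OF \<nu>]
          by (intro add_mono) auto
        finally show "norm (u t - U \<nu> t) \<le> ?D \<nu> + e (\<nu> - 1) + L * (?h \<nu> * (?A \<nu> + ?B \<nu>))" by simp
      qed
      moreover have "L * (?h \<nu> * (?A \<nu> + ?B \<nu>)) \<le> 1 / 2 * (?A \<nu> + ?B \<nu>)"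
        using mult_right_mono[OF h(2)[OF \<nu>], of "?A \<nu> + ?B \<nu>"] A0[OF \<nu>] B0[OF \<nu>] by (simp only: mult.assoc)
      ultimately show ?thesis by simp
    qed
    have AB: "?A \<nu> + ?B \<nu> \<le> 2 * (?D \<nu> + e (\<nu> - 1) + ?B \<nu>)" if \<nu>: "\<nu> \<in> {1..N}" for \<nu>
      using A[OF \<nu>] by simp
    let ?g = "\<lambda>\<nu>. ?d \<nu> + 2 * L * ?h \<nu> * (?D \<nu> + ?B \<nu>)"
    have e: "e \<nu> \<le> (1 + 2 * L * ?h \<nu>) * e (\<nu> - 1) + ?g \<nu>" if \<nu>: "\<nu> \<in> {1..N}" for \<nu>
    proof -
      let ?t = "tm \<nu>" and ?e = "u (tm (\<nu> - 1)) - ?c \<nu>"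
      have t: "?t \<in> {tm (\<nu> - 1)..tm \<nu>}" using int(1)[OF \<nu>] by simp
      have "e \<nu> = norm ((u ?t - ?J \<nu> ?t) - (U \<nu> ?t - ?J \<nu> ?t + ?e) + ?e)"
        using \<nu> by (simp add: e_def)
      also have "\<dots> \<le> norm (u ?t - ?J \<nu> ?t) + norm (U \<nu> ?t - ?J \<nu> ?t + ?e) + norm ?e"
        by (intro norm_triangle_le add_right_mono norm_triangle_ineq4)
      also have "\<dots> \<le> ?d \<nu> + L * (?h \<nu> * (?A \<nu> + ?B \<nu>)) + e (\<nu> - 1)"
        using L[OF adm[OF \<nu>] sol[OF \<nu>] t] prev[OF \<nu>] by (intro add_mono) auto
      finally have "e \<nu> \<le> ?d \<nu> + L * (?h \<nu> * (?A \<nu> + ?B \<nu>)) + e (\<nu> - 1)" .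
      moreover have "L * (?h \<nu> * (?A \<nu> + ?B \<nu>)) \<le> L * (?h \<nu> * (2 * (?D \<nu> + e (\<nu> - 1) + ?B \<nu>)))"
        using h(1)[OF \<nu>] L0 AB[OF \<nu>] by (intro mult_left_mono) auto
      moreover have id: "\<alpha> + L * (\<beta> * (2 * (\<gamma> + \<delta> + \<epsilon>))) + \<delta> = (1 + 2 * L * \<beta>) * \<delta> + (\<alpha> + 2 * L * \<beta> * (\<gamma> + \<epsilon>))"
        for \<alpha> \<beta> \<gamma> \<delta> \<epsilon> :: real by (simp add: algebra_simps)
      ultimately show ?thesis unfolding id[symmetric] by linarith
    qed
    have m1: "?B \<nu> + ?D \<nu> \<le> m1" "l = 1 \<Longrightarrow> ?B \<nu> + ?D \<nu> + ?sup \<nu> (hderiv {tm (\<nu> - 1)..tm \<nu>} 1 (\<lambda>t. u t - ?J \<nu> t)) \<le> m1"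
      if \<nu>: "\<nu> \<in> {1..n}" for \<nu>
    proof -
      have \<nu>N: "\<nu> \<in> {1..N}" using \<nu> n by simp
      have C: "Ck_on {tm (\<nu> - 1)..tm \<nu>} 1 (\<lambda>t. u t - ?J \<nu> t)"
        by (intro Ck_on_diff int(1)[OF \<nu>N] Cinf_on_imp_Ck_on u_Cinf[OF adm[OF \<nu>N]] Cinf_on_VPdeg[OF int(1)[OF \<nu>N] Jd[OF \<nu>N]])
      have "0 \<le> ?sup \<nu> (hderiv {tm (\<nu> - 1)..tm \<nu>} 1 (\<lambda>t. u t - ?J \<nu> t))"
        by (rule supn_nonneg[OF int(1)[OF \<nu>N] Ck_onD(2)[OF C]]) simp
      moreover have "?m1 \<nu> \<le> m1" unfolding m1_def by (rule le_maxz) (use \<nu> in auto)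
      ultimately show "?B \<nu> + ?D \<nu> \<le> m1" "l = 1 \<Longrightarrow> ?B \<nu> + ?D \<nu> + ?sup \<nu> (hderiv {tm (\<nu> - 1)..tm \<nu>} 1 (\<lambda>t. u t - ?J \<nu> t)) \<le> m1"
        using l by (auto simp del: hderiv.simps(2) simp: hderiv.simps(1))
    qed
    \<comment> \<open>Writing the end point defect as h times a quotient supplies the step size
      needed to sum over arbitrarily many intervals.\<close>
    have m2: "?d \<nu> \<le> ?h \<nu> * m2" if \<nu>: "\<nu> \<in> {1..n - 1}" for \<nu>
    proof -
      have "\<nu> \<in> {1..N}" using \<nu> n by auto
      note h = h(1)[OF this]
      have "?d \<nu> / ?h \<nu> \<le> m2" unfolding m2_def by (rule le_maxz) (use \<nu> in auto)
      then show ?thesis using h by (simp add: field_simps)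
    qed
    have m20: "0 \<le> m2" unfolding m2_def
    proof (rule maxz_nonneg)
      fix \<nu> assume "\<nu> \<in> {1..n - 1}"
      then have "\<nu> \<in> {1..N}" using n by auto
      then show "0 \<le> ?d \<nu> / ?h \<nu>" using h(1) by (intro divide_nonneg_pos) auto
    qed simp
    have nn: "n \<in> {1..n}" using n by simp
    have m10: "0 \<le> m1" using m1(1)[OF nn] B0[OF n] D0[OF n] by linarith
    have width: "(\<Sum>\<nu>=1..n - 1. ?h \<nu>) \<le> T"
    proof -
      have "n - 1 \<le> N" using n by auto
      from mesh_bounds(2)[OF mesh this] mesh show ?thesis
        unfolding sum_mesh_widths by (simp add: mesh_def)
    qed
    have width0: "0 \<le> (\<Sum>\<nu>=1..n - 1. ?h \<nu>)"
      using h(1) n by (intro sum_nonneg less_imp_le) auto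
    have sub: "\<nu> \<in> {1..N}" if "\<nu> \<in> {1..n - 1}" for \<nu> using that n by auto
    \<comment> \<open>Propagation ends at the left end of the current interval, which is then
      handled by the local bound \<open>A\<close>; so no defect at its right end occurs.\<close>
    have "e (n - 1) \<le> exp (2 * L * (\<Sum>\<nu>=1..n - 1. ?h \<nu>)) * (\<Sum>\<nu>=1..n - 1. ?g \<nu>)"
    proof (rule discrete_Gronwall)
      fix \<nu> assume "\<nu> \<in> {1..n - 1}"
      note \<nu> = sub[OF this]
      show "0 \<le> ?h \<nu>" using h(1)[OF \<nu>] by simp
      show "0 \<le> ?g \<nu>" using L0 h(1)[OF \<nu>] B0[OF \<nu>] D0[OF \<nu>] by (intro add_nonneg_nonneg mult_nonneg_nonneg) auto
      show "e \<nu> \<le> (1 + 2 * L * ?h \<nu>) * e (\<nu> - 1) + ?g \<nu>" by (rule e[OF \<nu>])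
    qed (use L0 in \<open>auto simp: e_def\<close>)
    also have "\<dots> \<le> E * (T * m2 + 2 * L * (T * m1))"
    proof (rule mult_mono)
      show "exp (2 * L * (\<Sum>\<nu>=1..n - 1. ?h \<nu>)) \<le> E"
        unfolding E_def using mult_left_mono[OF width, of "2 * L"] L0 by simp
      have "(\<Sum>\<nu>=1..n - 1. ?g \<nu>) \<le> (\<Sum>\<nu>=1..n - 1. ?h \<nu> * (m2 + 2 * L * m1))"
      proof (rule sum_mono)
        fix \<nu> assume \<nu>: "\<nu> \<in> {1..n - 1}"
        then have \<nu>n: "\<nu> \<in> {1..n}" by auto
        have "2 * L * ?h \<nu> * (?D \<nu> + ?B \<nu>) \<le> 2 * L * ?h \<nu> * m1"
          using L0 h(1)[OF sub[OF \<nu>]] m1(1)[OF \<nu>n] by (intro mult_left_mono) auto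
        then show "?g \<nu> \<le> ?h \<nu> * (m2 + 2 * L * m1)" using m2[OF \<nu>] by (simp add: algebra_simps)
      qed
      also have "\<dots> = (\<Sum>\<nu>=1..n - 1. ?h \<nu>) * (m2 + 2 * L * m1)" by (simp only: sum_distrib_right)
      also have "\<dots> \<le> T * (m2 + 2 * L * m1)"
        using width m10 m20 L0 by (intro mult_right_mono) auto
      finally show "(\<Sum>\<nu>=1..n - 1. ?g \<nu>) \<le> T * m2 + 2 * L * (T * m1)" by (simp add: algebra_simps)
      show "0 \<le> (\<Sum>\<nu>=1..n - 1. ?g \<nu>)"
        using L0 h(1)[OF sub] B0[OF sub] D0[OF sub]
        by (intro sum_nonneg add_nonneg_nonneg mult_nonneg_nonneg) (auto intro: less_imp_le)
    qed (use E0 in simp)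
    also have "\<dots> \<le> E * ((T + 2 * L * T) * (m1 + m2))"
    proof (rule mult_left_mono)
      have "0 \<le> T * m1" "0 \<le> 2 * L * (T * m2)" using T_pos m10 m20 L0 by auto
      then show "T * m2 + 2 * L * (T * m1) \<le> (T + 2 * L * T) * (m1 + m2)" by (simp add: algebra_simps)
    qed (use E0 in simp)
    finally have en: "e (n - 1) \<le> E * (T + 2 * L * T) * (m1 + m2)" by (simp only: mult.assoc)
    have An: "?A n \<le> CA * (m1 + m2)"
      using A[OF n] m1(1)[OF nn] B0[OF n] en m20 unfolding CA_def by (simp add: distrib_right)
    have "?lhs \<le> C * (m1 + m2)"
    proof (cases "l = 0")
      case True
      have "CA * (m1 + m2) \<le> C * (m1 + m2)"
        using CA0 L0 m10 m20 unfolding C_def by (intro mult_right_mono) (auto simp: algebra_simps)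
      then show ?thesis using An True by simp
    next
      case False
      then have l1: "l = 1" using l by simp
      let ?S = "{tm (n - 1)..tm n}"
      note uC = Cinf_on_imp_Ck_on[OF u_Cinf[OF adm[OF n]], of 1]
        and UC = Cinf_on_imp_Ck_on[OF Cinf_on_VPdeg[OF int(1)[OF n] Ud[OF n]], of 1]
        and JC = Cinf_on_imp_Ck_on[OF Cinf_on_VPdeg[OF int(1)[OF n] Jd[OF n]], of 1]
      \<comment> \<open>The second estimate of \<open>local_error\<close> has no factor h, but the
        suprema in it are already bounded by the case l = 0.\<close>
      have "?sup n (hderiv ?S 1 (\<lambda>t. u t - U n t)) \<le> m1 + L * (CA * (m1 + m2) + m1)"
      proof (rule supn_le_Ioc[OF int(1)[OF n]])
        fix t assume t: "t \<in> ?S"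
        have "hderiv ?S 1 (\<lambda>t. u t - U n t) t = hderiv ?S 1 (\<lambda>t. u t - ?J n t) t - (hderiv ?S 1 (U n) t - hderiv ?S 1 (?J n) t)"
          using hderiv_diff[OF int(1)[OF n] uC UC le_refl t] hderiv_diff[OF int(1)[OF n] uC JC le_refl t] by simp
        then have "norm (hderiv ?S 1 (\<lambda>t. u t - U n t) t)
            \<le> norm (hderiv ?S 1 (\<lambda>t. u t - ?J n t) t) + norm (hderiv ?S 1 (U n) t - hderiv ?S 1 (?J n) t)"
          by (simp only: norm_triangle_ineq4)
        also have "\<dots> \<le> ?sup n (hderiv ?S 1 (\<lambda>t. u t - ?J n t)) + L * (?A n + ?B n)"
          using norm_le_supn[OF int(1)[OF n] Ck_onD(2)[OF Ck_on_diff[OF int(1)[OF n] uC JC] le_refl] t]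
            L[OF adm[OF n] sol[OF n] t] by (intro add_mono) blast+
        also have "\<dots> \<le> m1 + L * (CA * (m1 + m2) + m1)"
          using m1[OF nn] l1 An B0[OF n] D0[OF n]
          by (intro add_mono mult_left_mono[OF _ L0]) (simp_all del: hderiv.simps)
        finally show "norm (hderiv ?S 1 (\<lambda>t. u t - U n t) t) \<le> m1 + L * (CA * (m1 + m2) + m1)" .
      qed
      also have "\<dots> \<le> C * (m1 + m2)"
      proof -
        have "0 \<le> CA * (m1 + m2)" "0 \<le> L * m2" using CA0 L0 m10 m20 by auto
        then show ?thesis using m20 unfolding C_def by (simp add: algebra_simps)
      qed
      finally show ?thesis using l1 by simp
    qed
    then show ?thesis unfolding m1_def m2_def by (simp only: distrib_left)
  qed
  then show ?thesis using \<tau>0 by blast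
qed

end

theorem mainTheorem8:
  fixes r k kI kc :: nat
    and Ih :: "(real \<Rightarrow> real) \<Rightarrow> real"
    and Ic :: "(real \<Rightarrow> real) \<Rightarrow> (real \<Rightarrow> real)"
    and f :: "real \<Rightarrow> real ^ 'd \<Rightarrow> real ^ 'd"
    and t0 T C2 :: real
    and u0 :: "real ^ 'd"
    and u :: "real \<Rightarrow> real ^ 'd"
    and tI sx :: "nat \<Rightarrow> real" and KI :: nat and KtI :: "nat \<Rightarrow> nat"
  assumes kr: "k \<le> r"
    and T_pos: "0 < T"
    and f_smooth: "smooth_map (\<lambda>(t, x). f t x)"
    and Ih_ok: "functional_ok Ih kI"
    and Ic_ok: "operator_ok Ic kc"
    and u_smooth: "Cinf_on {t0..t0 + T} u"
    and u_init: "u t0 = u0"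
    and u_ode: "\<forall>t\<in>{t0..t0 + T}. (u has_vector_derivative f t (u t)) (at t within {t0..t0 + T})"
    and A1: "A1 r k Ih"
    and A2: "A2 Ih kI TYPE('d)"
    and A4: "A4 f t0 T (max (k div 2 - 1) (max kI kc)) C2"
    and A5: "A5a Ic kI kc t0 T tI KI KtI TYPE('d) \<or> A5b Ih Ic kI kc t0 T tI KI KtI TYPE('d)"
    and sx_new: "inj_on sx {..<r + 1 - rapp k tI KI KtI}"
      "sx ` {..<r + 1 - rapp k tI KI KtI} \<subseteq> {-1<..<1} - tI ` {..KI}"
  shows "\<exists>\<tau>0 > 0. \<exists>C. \<forall>tm N U.
           mesh t0 T \<tau>0 tm N \<longrightarrow> method_M r k Ih Ic f u0 tm N U \<longrightarrow>
           (\<forall>n\<in>{1..N}. \<forall>l\<in>{0, 1}.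
              supn {tm (n - 1)<..tm n} (hderiv {tm (n - 1)..tm n} l (\<lambda>t. u t - U n t))
              \<le> C * maxz {1..n} (\<lambda>\<nu>.
                     supn {tm (\<nu> - 1)<..tm \<nu>}
                       (\<lambda>t. u t - Iapp r k tI KI KtI sx (tm (\<nu> - 1)) (tm \<nu>) u t)
                   + (\<Sum>j\<le>l. supn {tm (\<nu> - 1)<..tm \<nu>}
                       (hderiv {tm (\<nu> - 1)..tm \<nu>} j
                          (\<lambda>t. u t - Jop r k Ih Ic (tm (\<nu> - 1)) (tm \<nu>) u t))))
                + C * maxz {1..n - 1} (\<lambda>\<nu>.
                     norm (u (tm \<nu>) - Jop r k Ih Ic (tm (\<nu> - 1)) (tm \<nu>) u (tm \<nu>))
                     / (tm \<nu> - tm (\<nu> - 1))))"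
proof -
  interpret variational_scheme r k kI Ih kc Ic f t0 T C2 u tI sx KI KtI
    by unfold_locales (fact assms)+
  show ?thesis by (rule error_estimate[OF u_init])
qed

end
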